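(* Let $M$ be a smooth Banach manifold, let $S$ be a semispray on $M$, and let $S^{c_\infty}=\varprojlim S^{c_i}$ be its lift to a semispray on $T^\infty M$. For any $x=(x_i)_{i\in\mathbb{N}}\in T^\infty M$ and $\xi=(\xi_i)_{i\in\mathbb{N}}\in T_xT^\infty M$, there exists, for some $\epsilon>0$, a unique geodesic $\gamma_\xi:(-\epsilon,\epsilon)\to T^\infty M$ of $S^{c_\infty}$ such that $\gamma_\xi(0)=x$ and $\gamma_\xi'(0)=\xi$. Moreover $\gamma_\xi=\varprojlim\gamma_{\xi_i}$, where, for each $i\in\mathbb{N}$, $\gamma_{\xi_i}:(-\epsilon,\epsilon)\to T^iM$ is a geodesic of $S^{c_i}$ with $\gamma_{\xi_i}(0)=x_i$ and $\gamma_{\xi_i}'(0)=\xi_i$.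
   Context: All maps and manifolds are smooth; $M$ is a Banach manifold modeled on a Banach space $\mathbb{E}$ and admits smooth partitions of unity ("partitionable"). $T^0M=M$, $T^rM=T(T^{r-1}M)$, and $\pi_r:T^{r+1}M\to T^rM$ is the tangent bundle projection. $D$ denotes the tangent map, $D^2=DD$. Atlas: for an atlas $\{(U_\alpha,\phi_\alpha)\}$ of $M$, put $\phi_{\alpha_0}=\phi_\alpha$, $U_{\alpha_0}=U_\alpha$, $U_{\alpha_r}=\pi_{r-1}^{-1}(U_{\alpha_{r-1}})$, $\phi_{\alpha_r}=D\phi_{\alpha_{r-1}}$; these are charts of $T^rM$ with model space $\mathbb{E}_r=\mathbb{E}^{2^r}$. Canonical involution: $\kappa_1=\mathrm{id}_{TM}$, and for $r\ge 2$, $\kappa_r:T^rM\to T^rM$ is the diffeomorphism with $\partial_t\partial_s\gamma(t,s)=\kappa_r\partial_s\partial_t\gamma(t,s)$ for every smooth $\gamma:(-\epsilon,\epsilon)^2\to T^{r-2}M$; in charts $\kappa_r(x,y,X,Y)=(x,X,y,Y)$. Complete lift: for a vector field $\mathbf{A}:T^rM\to T^{r+1}M$ ($r\ge0$), $\mathbf{A}^c=D\kappa_{r+1}\circ\kappa_{r+2}\circ D\mathbf{A}\circ\kappa_{r+1}:T^{r+1}M\to T^{r+2}M$, a vector field on $T^{r+1}M$. For a vector field $S$ on $TM$: $S^{c_0}=S$, $S^{c_j}=(S^{c_{j-1}})^c:T(T^jM)\to T^2(T^jM)$. Semisprays and geodesics: for $r\ge1$, a semispray on $T^{r-1}M$ is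 a vector field $S:T^rM\to T^{r+1}M$ with $\kappa_{r+1}\circ S=S$, equivalently $D\pi_{r-1}\circ S=\mathrm{id}_{T^rM}$. A semispray on $T^\infty M$ is a vector field $S$ on $TT^\infty M$ with $D\pi_{T^\infty M}\circ S=\mathrm{id}_{TT^\infty M}$, where $\pi_{T^\infty M}=\varprojlim\pi_i:TT^\infty M\to T^\infty M$ is the tangent bundle projection. If $S$ is a semispray on $M$ then $S^{c_i}$ is a semispray on $T^iM$ and $S^{c_\infty}$ is a semispray on $T^\infty M$. A geodesic of a semispray $S$ on $N$ ($N=T^iM$ or $T^\infty M$) is a smooth curve $\gamma:(-\epsilon,\epsilon)\to N$, $\epsilon>0$, with $\gamma''(t)=S(\gamma'(t))$ for all $t$, where $\gamma':(-\epsilon,\epsilon)\to TN$ is the canonical lift (velocity curve) and $\gamma''=(\gamma')'$. $T^\infty M$: the projective limit $\varprojlim T^iM$ of the system $\{T^iM\}_{i\in\mathbb{N}}$ with connecting maps $\pi_i:T^{i+1}M\to T^iM$. It is a (generalized) Fréchet manifold modeled on $\mathbb{E}_\infty=\varprojlim\mathbb{E}_i$ (connecting maps $\mathbb{E}_{i+1}=\mathbb{E}_i^2\to\mathbb{E}_i$, $(x,y)\mapsto x$), with charts $(\varprojlim U_{\alpha_i},\varprojlim\phi_{\alpha_i})$. Its tangent bundles are identified with projective limits: $TT^\infty M=\varprojlim\{T(T^iM),D\pi_i\}$ and $T^2(T^\infty M)=\varprojlim\{T^2(T^iM),D^2\pi_i\}$; $S^{c_\infty}=\varprojlim S^{c_i}$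 maps $(\xi_i)_i$ to $(S^{c_i}(\xi_i))_i$. $\gamma_\xi=\varprojlim\gamma_{\xi_i}$ means $\gamma_\xi(t)=(\gamma_{\xi_i}(t))_{i\in\mathbb{N}}$. *)

theory Defs
  imports "HOL-Analysis.Analysis"
begin

text \<open>
  The manifolds \<open>T\<^sup>r M\<close> are modelled on the product of \<open>2 ^ r\<close> copies of \<open>E\<close>, with \<open>r\<close> ranging over all naturals
  inside one statement.  All these model spaces are realised as closed subspaces
  \<open>model r\<close> (sequences vanishing from index \<open>2 ^ r\<close> on) of the Banach space
  \<open>nat \<Rightarrow>\<^sub>C 'e\<close> of bounded sequences in \<open>'e\<close>; the induced norm is the maximum norm.
\<close>

type_synonym 'e coord = "nat \<Rightarrow>\<^sub>C 'e"

definition model :: "nat \<Rightarrow> ('e::real_normed_vector) coord set"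
  where "model r = {v. \<forall>k\<ge>2 ^ r. apply_bcontfun v k = 0}"

definition embed :: "'e::real_normed_vector \<Rightarrow> 'e coord"
  where "embed e = Bcontfun (\<lambda>k. if k = 0 then e else 0)"

text \<open>\<open>join r x y\<close> is the pair \<open>(x, y)\<close> under \<open>model (r + 1) = model r \<times> model r\<close>.\<close>

definition join :: "nat \<Rightarrow> ('e::real_normed_vector) coord \<Rightarrow> 'e coord \<Rightarrow> 'e coord"
  where "join r x y = Bcontfun (\<lambda>k. if k < 2 ^ r then x k else y (k - 2 ^ r))"

lemma apply_embed: "apply_bcontfun (embed e) k = (if k = 0 then e else 0)"
proof -
  have "range (\<lambda>k::nat. if k = 0 then e else 0) \<subseteq> {e, 0}"
    by auto
  then have "bounded (range (\<lambda>k::nat. if k = 0 then e else 0))"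
    by (rule bounded_subset[rotated]) simp
  then have "(\<lambda>k::nat. if k = 0 then e else 0) \<in> bcontfun"
    by (auto simp: bcontfun_def)
  then show ?thesis
    by (simp add: embed_def Bcontfun_inverse)
qed

lemma apply_join: "apply_bcontfun (join r x y) k = (if k < 2 ^ r then x k else y (k - 2 ^ r))"
proof -
  have "bounded (range (apply_bcontfun x) \<union> range (apply_bcontfun y))"
    by simp
  then have "bounded (range (\<lambda>k. if k < 2 ^ r then x k else y (k - 2 ^ r)))"
    by (rule bounded_subset) auto
  then have "(\<lambda>k. if k < 2 ^ r then x k else y (k - 2 ^ r)) \<in> bcontfun"
    by (auto simp: bcontfun_def)
  then show ?thesis
    by (simp add: join_def Bcontfun_inverse)
qed

lemma bij_betw_embed: "bij_betw embed UNIV (model 0)"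
  unfolding bij_betw_def
proof
  show "inj embed"
    by (metis apply_embed injI)
  have "v = embed (v 0)" if "v \<in> model 0" for v :: "'a coord"
    using that by (intro bcontfun_eqI) (auto simp: apply_embed model_def)
  moreover have "embed e \<in> model 0" for e :: 'a
    by (simp add: apply_embed model_def)
  ultimately show "range embed = (model 0 :: 'a coord set)"
    by blast
qed

lemma bij_betw_join: "bij_betw (\<lambda>(x, y). join r x y) (model r \<times> model r) (model (Suc r))"
proof (rule bij_betwI')
  fix p q :: "'a coord \<times> 'a coord"
  assume p: "p \<in> model r \<times> model r" and q: "q \<in> model r \<times> model r"
  obtain x y x' y' where pq: "p = (x, y)" "q = (x', y')"
    by (cases p; cases q)
  have "x = x' \<and> y = y'" if "join r x y = join r x' y'"
  proof -
    have eq: "(if k < 2 ^ r then x k else y (k - 2 ^ r)) =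
        (if k < 2 ^ r then x' k else y' (k - 2 ^ r))" for k
      by (metis apply_join that)
    have "x k = x' k" for k
    proof (cases "k < 2 ^ r")
      case True
      then show ?thesis using eq[of k] by simp
    next
      case False
      then show ?thesis using p q pq by (auto simp: model_def)
    qed
    moreover have "y k = y' k" for k
      using eq[of "k + 2 ^ r"] by simp
    ultimately show ?thesis by (auto intro: bcontfun_eqI)
  qed
  then show "(case p of (x, y) \<Rightarrow> join r x y) = (case q of (x, y) \<Rightarrow> join r x y) \<longleftrightarrow> p = q"
    using pq by auto
next
  fix p :: "'a coord \<times> 'a coord"
  assume "p \<in> model r \<times> model r"
  then show "(case p of (x, y) \<Rightarrow> join r x y) \<in> model (Suc r)"
    by (auto simp: model_def apply_join)
next
  fix v :: "'a coord"
  assume v: "v \<in> model (Suc r)"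
  let ?x = "Bcontfun (\<lambda>k. if k < 2 ^ r then v k else 0)"
  let ?y = "Bcontfun (\<lambda>k. v (k + 2 ^ r))"
  have b: "bounded (insert 0 (range (apply_bcontfun v)))"
    by simp
  have "(\<lambda>k. if k < 2 ^ r then v k else 0) \<in> bcontfun"
    unfolding bcontfun_def by (auto intro: bounded_subset[OF b])
  then have x: "apply_bcontfun ?x = (\<lambda>k. if k < 2 ^ r then v k else 0)"
    by (rule Bcontfun_inverse)
  have "(\<lambda>k. v (k + 2 ^ r)) \<in> bcontfun"
    unfolding bcontfun_def by (auto intro: bounded_subset[OF b])
  then have y: "apply_bcontfun ?y = (\<lambda>k. v (k + 2 ^ r))"
    by (rule Bcontfun_inverse)
  have "v = join r ?x ?y"
    by (rule bcontfun_eqI) (auto simp: apply_join x y)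
  moreover have "?x \<in> model r" "?y \<in> model r"
    using v by (auto simp: model_def x y)
  ultimately show "\<exists>p\<in>model r \<times> model r. v = (case p of (x, y) \<Rightarrow> join r x y)"
    by (intro bexI[of _ "(?x, ?y)"]) auto
qed


section \<open>Smooth maps between Banach spaces\<close>

definition bounded_multilinear_on ::
    "'a::real_normed_vector set \<Rightarrow> nat \<Rightarrow> ('a list \<Rightarrow> 'b::real_normed_vector) \<Rightarrow> bool"
  where "bounded_multilinear_on E k m \<longleftrightarrow>
    (\<forall>vs. length vs = k \<and> set vs \<subseteq> E \<longrightarrow>
       (\<forall>j<k. \<forall>u\<in>E. \<forall>v\<in>E. \<forall>a.
          m (vs[j := u + a *\<^sub>R v]) = m (vs[j := u]) + a *\<^sub>R m (vs[j := v]))) \<and>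
    (\<exists>C. \<forall>vs. length vs = k \<and> set vs \<subseteq> E \<longrightarrow> norm (m vs) \<le> C * (\<Prod>v\<leftarrow>vs. norm v))"

text \<open>
  \<open>f\<close> is infinitely Frechet differentiable on the relatively open subset \<open>U\<close> of the subspace
  \<open>E\<close>.  Here \<open>d k x\<close> is the \<open>k\<close>-th derivative at \<open>x\<close>, a bounded \<open>k\<close>-linear map on \<open>E\<close>, and
  \<open>d (k + 1)\<close> is the derivative of \<open>d k\<close> in the operator norm of \<open>k\<close>-linear maps, under the
  usual identification of \<open>L(E, L\<^sup>k(E, F))\<close> with \<open>L\<^sup>k\<^sup>+\<^sup>1(E, F)\<close>.
\<close>

definition smooth_on ::
    "'a::real_normed_vector set \<Rightarrow> 'a set \<Rightarrow> ('a \<Rightarrow> 'b::real_normed_vector) \<Rightarrow> bool"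
  where "smooth_on E U f \<longleftrightarrow>
    (\<exists>d :: nat \<Rightarrow> 'a \<Rightarrow> 'a list \<Rightarrow> 'b.
      (\<forall>x\<in>U. d 0 x [] = f x) \<and>
      (\<forall>k. \<forall>x\<in>U. bounded_multilinear_on E k (d k x) \<and>
        (\<forall>e>0. \<exists>\<delta>>0. \<forall>y\<in>U. norm (y - x) < \<delta> \<longrightarrow>
          (\<forall>vs. length vs = k \<and> set vs \<subseteq> E \<longrightarrow>
            norm (d k y vs - d k x vs - d (Suc k) x ((y - x) # vs))
              \<le> e * norm (y - x) * (\<Prod>v\<leftarrow>vs. norm v)))))"


section \<open>Manifolds and smooth maps\<close>

text \<open>
  A manifold is given by an indexed atlas; its underlying set is the union of the chart
  domains, and its topology is the one induced by the charts.
\<close>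

record ('p, 'i, 'v) atlas =
  chart_dom :: "'i \<Rightarrow> 'p set"
  chart :: "'i \<Rightarrow> 'p \<Rightarrow> 'v"

definition points :: "('p, 'i, 'v) atlas \<Rightarrow> 'p set"
  where "points N = (\<Union>\<alpha>. chart_dom N \<alpha>)"

definition chart_inv :: "('p, 'i, 'v) atlas \<Rightarrow> 'i \<Rightarrow> 'v \<Rightarrow> 'p"
  where "chart_inv N \<alpha> = inv_into (chart_dom N \<alpha>) (chart N \<alpha>)"

definition local_rep ::
    "('p, 'i, 'v) atlas \<Rightarrow> ('q, 'j, 'w) atlas \<Rightarrow> ('p \<Rightarrow> 'q) \<Rightarrow> 'i \<Rightarrow> 'j \<Rightarrow> 'v \<Rightarrow> 'w"
  where "local_rep N P f \<alpha> \<beta> = (\<lambda>v. chart P \<beta> (f (chart_inv N \<alpha> v)))"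

text \<open>
  The argument \<open>E\<close> is the model space of \<open>N\<close>.  Openness of the domain of every local
  representative expresses continuity of \<open>f\<close>.
\<close>

definition smooth_map ::
    "'v::real_normed_vector set \<Rightarrow> ('p, 'i, 'v) atlas \<Rightarrow>
     ('q, 'j, 'w::real_normed_vector) atlas \<Rightarrow> ('p \<Rightarrow> 'q) \<Rightarrow> bool"
  where "smooth_map E N P f \<longleftrightarrow>
    f ` points N \<subseteq> points P \<and>
    (\<forall>\<alpha> \<beta>. let W = chart N \<alpha> ` {p \<in> chart_dom N \<alpha>. f p \<in> chart_dom P \<beta>} in
      openin (top_of_set E) W \<and> smooth_on E W (local_rep N P f \<alpha> \<beta>))"

definition atlas_topology :: "('p, 'i, 'v::topological_space) atlas \<Rightarrow> 'p topology"
  where "atlas_topology N =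
    topology (\<lambda>W. W \<subseteq> points N \<and> (\<forall>\<alpha>. open (chart N \<alpha> ` (W \<inter> chart_dom N \<alpha>))))"

definition banach_manifold :: "('m, 'i, 'e::banach) atlas \<Rightarrow> bool"
  where "banach_manifold M \<longleftrightarrow>
    (\<forall>\<alpha>. inj_on (chart M \<alpha>) (chart_dom M \<alpha>) \<and> open (chart M \<alpha> ` chart_dom M \<alpha>)) \<and>
    (\<forall>\<alpha> \<beta>. let W = chart M \<alpha> ` (chart_dom M \<alpha> \<inter> chart_dom M \<beta>) in
      open W \<and> smooth_on UNIV W (chart M \<beta> \<circ> chart_inv M \<alpha>)) \<and>
    Hausdorff_space (atlas_topology M)"

lemma openin_atlas_topology:
  assumes inj: "\<And>\<alpha>. inj_on (chart N \<alpha>) (chart_dom N \<alpha>)"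
  shows "openin (atlas_topology N) W \<longleftrightarrow>
    W \<subseteq> points N \<and> (\<forall>\<alpha>. open (chart N \<alpha> ` (W \<inter> chart_dom N \<alpha>)))"
proof -
  have "istopology (\<lambda>W. W \<subseteq> points N \<and> (\<forall>\<alpha>. open (chart N \<alpha> ` (W \<inter> chart_dom N \<alpha>))))"
    unfolding istopology_def
  proof (rule conjI; intro allI impI conjI)
    fix V W \<alpha>
    assume V: "V \<subseteq> points N \<and> (\<forall>\<alpha>. open (chart N \<alpha> ` (V \<inter> chart_dom N \<alpha>)))"
      and W: "W \<subseteq> points N \<and> (\<forall>\<alpha>. open (chart N \<alpha> ` (W \<inter> chart_dom N \<alpha>)))"
    then show "V \<inter> W \<subseteq> points N" by blast
    have "chart N \<alpha> ` (V \<inter> W \<inter> chart_dom N \<alpha>) =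
        chart N \<alpha> ` (V \<inter> chart_dom N \<alpha>) \<inter> chart N \<alpha> ` (W \<inter> chart_dom N \<alpha>)"
      using inj[of \<alpha>] by (auto simp: inj_on_def)
    then show "open (chart N \<alpha> ` (V \<inter> W \<inter> chart_dom N \<alpha>))"
      using V W by (simp add: open_Int)
  next
    fix K \<alpha>
    assume K: "\<forall>W\<in>K. W \<subseteq> points N \<and> (\<forall>\<alpha>. open (chart N \<alpha> ` (W \<inter> chart_dom N \<alpha>)))"
    then show "\<Union>K \<subseteq> points N" by blast
    have "chart N \<alpha> ` (\<Union>K \<inter> chart_dom N \<alpha>) =
        (\<Union>W\<in>K. chart N \<alpha> ` (W \<inter> chart_dom N \<alpha>))"
      by blast
    then show "open (chart N \<alpha> ` (\<Union>K \<inter> chart_dom N \<alpha>))"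
      using K by auto
  qed
  then show ?thesis
    by (simp add: atlas_topology_def topology_inverse')
qed

definition real_atlas :: "real set \<Rightarrow> (real, unit, real) atlas"
  where "real_atlas I = \<lparr>chart_dom = (\<lambda>_. I), chart = (\<lambda>_ t. t)\<rparr>"

text \<open>
  Every open cover of \<open>M\<close> has a subordinate smooth partition of unity (indexed by the cover).
\<close>

definition partitionable :: "('m, 'i, 'e::banach) atlas \<Rightarrow> bool"
  where "partitionable M \<longleftrightarrow>
    (\<forall>\<V>. (\<forall>V\<in>\<V>. openin (atlas_topology M) V) \<and> \<Union>\<V> = points M \<longrightarrow>
      (\<exists>\<psi> :: 'm set \<Rightarrow> 'm \<Rightarrow> real.
        (\<forall>V\<in>\<V>. smooth_map UNIV M (real_atlas UNIV) (\<psi> V) \<and>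
          (\<forall>x\<in>points M. 0 \<le> \<psi> V x) \<and>
          atlas_topology M closure_of {x \<in> points M. \<psi> V x \<noteq> 0} \<subseteq> V) \<and>
        (\<forall>x\<in>points M. \<exists>W. openin (atlas_topology M) W \<and> x \<in> W \<and>
          finite {V \<in> \<V>. \<exists>y\<in>W. \<psi> V y \<noteq> 0}) \<and>
        (\<forall>x\<in>points M. (\<Sum>V | V \<in> \<V> \<and> \<psi> V x \<noteq> 0. \<psi> V x) = 1)))"


section \<open>Iterated tangent bundles\<close>

text \<open>
  A tangent vector \<open>Tan p w\<close> consists of its base point \<open>p\<close> and, for every chart \<open>\<alpha>\<close> around
  \<open>p\<close>, its component \<open>w \<alpha>\<close> in that chart.  The recursive type holds the points of all
  \<open>T\<^sup>r M\<close>; \<open>proj\<close> is the tangent bundle projection \<open>\<pi>\<^sub>r\<close> for every \<open>r\<close>.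
\<close>

datatype ('m, 'i, 'v) tpoint =
    Base (foot: 'm)
  | Tan (proj: "('m, 'i, 'v) tpoint") (vcomp: "'i \<Rightarrow> 'v")

type_synonym ('m, 'i, 'e) tp = "('m, 'i, 'e coord) tpoint"

type_synonym ('m, 'i, 'e) tatlas = "(('m, 'i, 'e) tp, 'i, 'e coord) atlas"

text \<open>
  Tangent vectors at \<open>p\<close>: the components transform by the derivatives of the coordinate
  changes.  Outside the charts around \<open>p\<close> they are fixed to be \<open>0\<close>, so that a tangent vector
  has only one representation.
\<close>

definition tangent_space ::
    "nat \<Rightarrow> ('m, 'i, 'e::real_normed_vector) tatlas \<Rightarrow> ('m, 'i, 'e) tp \<Rightarrow> ('m, 'i, 'e) tp set"
  where "tangent_space r N p = {Tan p w | w.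
    (\<forall>\<alpha>. if p \<in> chart_dom N \<alpha> then w \<alpha> \<in> model r else w \<alpha> = 0) \<and>
    (\<forall>\<alpha> \<beta>. p \<in> chart_dom N \<alpha> \<inter> chart_dom N \<beta> \<longrightarrow>
      (\<exists>L. ((chart N \<beta> \<circ> chart_inv N \<alpha>) has_derivative L) (at (chart N \<alpha> p) within model r) \<and>
        w \<beta> = L (w \<alpha>)))}"

definition tangent_bundle ::
    "nat \<Rightarrow> ('m, 'i, 'e::real_normed_vector) tatlas \<Rightarrow> ('m, 'i, 'e) tatlas"
  where "tangent_bundle r N = \<lparr>
    chart_dom = (\<lambda>\<alpha>. \<Union>p\<in>chart_dom N \<alpha>. tangent_space r N p),
    chart = (\<lambda>\<alpha> q. join r (chart N \<alpha> (proj q)) (vcomp q \<alpha>))\<rparr>"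

text \<open>\<open>Tpow M r\<close> is \<open>T\<^sup>r M\<close> with the charts \<open>(U\<^bsub>\<alpha>\<^sub>r\<^esub>, \<phi>\<^bsub>\<alpha>\<^sub>r\<^esub>)\<close>.\<close>

primrec Tpow :: "('m, 'i, 'e::real_normed_vector) atlas \<Rightarrow> nat \<Rightarrow> ('m, 'i, 'e) tatlas"
  where
    "Tpow M 0 = \<lparr>chart_dom = (\<lambda>\<alpha>. Base ` chart_dom M \<alpha>),
                 chart = (\<lambda>\<alpha> p. embed (chart M \<alpha> (foot p)))\<rparr>"
  | "Tpow M (Suc r) = tangent_bundle r (Tpow M r)"

text \<open>\<open>tmap M a b f\<close> is the tangent map \<open>T\<^sup>a\<^sup>+\<^sup>1 M \<rightarrow> T\<^sup>b\<^sup>+\<^sup>1 M\<close> of \<open>f : T\<^sup>a M \<rightarrow> T\<^sup>b M\<close>.\<close>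

definition tmap ::
    "('m, 'i, 'e::real_normed_vector) atlas \<Rightarrow> nat \<Rightarrow> nat \<Rightarrow>
     (('m, 'i, 'e) tp \<Rightarrow> ('m, 'i, 'e) tp) \<Rightarrow> ('m, 'i, 'e) tp \<Rightarrow> ('m, 'i, 'e) tp"
  where "tmap M a b f q = (THE q'. q' \<in> tangent_space b (Tpow M b) (f (proj q)) \<and>
    (\<forall>\<alpha> \<beta>. proj q \<in> chart_dom (Tpow M a) \<alpha> \<and> f (proj q) \<in> chart_dom (Tpow M b) \<beta> \<longrightarrow>
      (\<exists>L. (local_rep (Tpow M a) (Tpow M b) f \<alpha> \<beta> has_derivative L)
             (at (chart (Tpow M a) \<alpha> (proj q)) within model a) \<and>
           vcomp q' \<beta> = L (vcomp q \<alpha>))))"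

text \<open>The canonical lift \<open>\<gamma>'\<close> of a curve \<open>\<gamma>\<close> in \<open>T\<^sup>r M\<close>.\<close>

definition velocity ::
    "('m, 'i, 'e::real_normed_vector) atlas \<Rightarrow> nat \<Rightarrow> (real \<Rightarrow> ('m, 'i, 'e) tp) \<Rightarrow>
     real \<Rightarrow> ('m, 'i, 'e) tp"
  where "velocity M r \<gamma> t = (THE q. q \<in> tangent_space r (Tpow M r) (\<gamma> t) \<and>
    (\<forall>\<alpha>. \<gamma> t \<in> chart_dom (Tpow M r) \<alpha> \<longrightarrow>
      ((\<lambda>s. chart (Tpow M r) \<alpha> (\<gamma> s)) has_vector_derivative vcomp q \<alpha>) (at t)))"

text \<open>In charts, \<open>kappa M r (x, y, X, Y) = (x, X, y, Y)\<close> for \<open>r \<ge> 2\<close>.\<close>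

definition kappa ::
    "('m, 'i, 'e::real_normed_vector) atlas \<Rightarrow> nat \<Rightarrow> ('m, 'i, 'e) tp \<Rightarrow> ('m, 'i, 'e) tp"
  where "kappa M r p = (if r < 2 then p else
    (THE q. q \<in> points (Tpow M r) \<and>
      (\<forall>\<alpha>. p \<in> chart_dom (Tpow M r) \<alpha> \<longrightarrow> q \<in> chart_dom (Tpow M r) \<alpha> \<and>
        (\<exists>x\<in>model (r - 2). \<exists>y\<in>model (r - 2). \<exists>X\<in>model (r - 2). \<exists>Y\<in>model (r - 2).
          chart (Tpow M r) \<alpha> p = join (r - 1) (join (r - 2) x y) (join (r - 2) X Y) \<and>
          chart (Tpow M r) \<alpha> q = join (r - 1) (join (r - 2) x X) (join (r - 2) y Y)))))"


section \<open>Semisprays, complete lifts and geodesics\<close>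

definition vector_field ::
    "('m, 'i, 'e::real_normed_vector) atlas \<Rightarrow> nat \<Rightarrow> (('m, 'i, 'e) tp \<Rightarrow> ('m, 'i, 'e) tp) \<Rightarrow> bool"
  where "vector_field M r A \<longleftrightarrow>
    smooth_map (model r) (Tpow M r) (Tpow M (Suc r)) A \<and>
    (\<forall>p\<in>points (Tpow M r). proj (A p) = p)"

text \<open>\<open>semispray M r S\<close>: \<open>S : T\<^sup>r\<^sup>+\<^sup>1 M \<rightarrow> T\<^sup>r\<^sup>+\<^sup>2 M\<close> is a semispray on \<open>T\<^sup>r M\<close>.\<close>

definition semispray ::
    "('m, 'i, 'e::real_normed_vector) atlas \<Rightarrow> nat \<Rightarrow> (('m, 'i, 'e) tp \<Rightarrow> ('m, 'i, 'e) tp) \<Rightarrow> bool"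
  where "semispray M r S \<longleftrightarrow>
    vector_field M (r + 1) S \<and>
    (\<forall>p\<in>points (Tpow M (r + 1)). kappa M (r + 2) (S p) = S p)"

text \<open>The complete lift of a vector field \<open>A : T\<^sup>r M \<rightarrow> T\<^sup>r\<^sup>+\<^sup>1 M\<close>.\<close>

definition complete_lift ::
    "('m, 'i, 'e::real_normed_vector) atlas \<Rightarrow> nat \<Rightarrow>
     (('m, 'i, 'e) tp \<Rightarrow> ('m, 'i, 'e) tp) \<Rightarrow> ('m, 'i, 'e) tp \<Rightarrow> ('m, 'i, 'e) tp"
  where "complete_lift M r A =
    tmap M (r + 1) (r + 1) (kappa M (r + 1)) \<circ> kappa M (r + 2) \<circ> tmap M r (r + 1) A \<circ>
      kappa M (r + 1)"

primrec iter_lift ::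
    "('m, 'i, 'e::real_normed_vector) atlas \<Rightarrow> (('m, 'i, 'e) tp \<Rightarrow> ('m, 'i, 'e) tp) \<Rightarrow>
     nat \<Rightarrow> ('m, 'i, 'e) tp \<Rightarrow> ('m, 'i, 'e) tp"
  where
    "iter_lift M S 0 = S"
  | "iter_lift M S (Suc j) = complete_lift M (j + 1) (iter_lift M S j)"

text \<open>\<open>\<gamma>\<close> is a geodesic \<open>(-\<epsilon>, \<epsilon>) \<rightarrow> T\<^sup>r M\<close> of the semispray \<open>S\<close> on \<open>T\<^sup>r M\<close>.\<close>

definition geodesic ::
    "('m, 'i, 'e::real_normed_vector) atlas \<Rightarrow> nat \<Rightarrow> (('m, 'i, 'e) tp \<Rightarrow> ('m, 'i, 'e) tp) \<Rightarrow>
     real \<Rightarrow> (real \<Rightarrow> ('m, 'i, 'e) tp) \<Rightarrow> bool"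
  where "geodesic M r S \<epsilon> \<gamma> \<longleftrightarrow>
    smooth_map UNIV (real_atlas {-\<epsilon><..<\<epsilon>}) (Tpow M r) \<gamma> \<and>
    (\<forall>t\<in>{-\<epsilon><..<\<epsilon>}. velocity M (r + 1) (velocity M r \<gamma>) t = S (velocity M r \<gamma> t))"


section \<open>The projective limit\<close>

definition Tinf :: "('m, 'i, 'e::real_normed_vector) atlas \<Rightarrow> (nat \<Rightarrow> ('m, 'i, 'e) tp) set"
  where "Tinf M = {x. \<forall>i. x i \<in> points (Tpow M i) \<and> proj (x (Suc i)) = x i}"

definition TTinf :: "('m, 'i, 'e::real_normed_vector) atlas \<Rightarrow> (nat \<Rightarrow> ('m, 'i, 'e) tp) set"
  where "TTinf M =
    {\<xi>. \<forall>i. \<xi> i \<in> points (Tpow M (i + 1)) \<and> tmap M (i + 1) i proj (\<xi> (Suc i)) = \<xi> i}"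

definition tangent_space_inf ::
    "('m, 'i, 'e::real_normed_vector) atlas \<Rightarrow> (nat \<Rightarrow> ('m, 'i, 'e) tp) \<Rightarrow>
     (nat \<Rightarrow> ('m, 'i, 'e) tp) set"
  where "tangent_space_inf M x = {\<xi> \<in> TTinf M. \<forall>i. proj (\<xi> i) = x i}"

definition Tinf_atlas ::
    "('m, 'i, 'e::real_normed_vector) atlas \<Rightarrow> (nat \<Rightarrow> ('m, 'i, 'e) tp, 'i, nat \<Rightarrow> 'e coord) atlas"
  where "Tinf_atlas M = \<lparr>
    chart_dom = (\<lambda>\<alpha>. {x \<in> Tinf M. \<forall>i. x i \<in> chart_dom (Tpow M i) \<alpha>}),
    chart = (\<lambda>\<alpha> x i. chart (Tpow M i) \<alpha> (x i))\<rparr>"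

text \<open>
  Infinite differentiability of a curve in the Frechet space \<open>E\<^sub>\<infinity>\<close>, which is a closed subspace
  of the product \<open>nat \<Rightarrow> 'e coord\<close>; the limit is taken in the product topology.
\<close>

definition smooth_frechet_curve :: "real set \<Rightarrow> (real \<Rightarrow> nat \<Rightarrow> 'v::real_normed_vector) \<Rightarrow> bool"
  where "smooth_frechet_curve I c \<longleftrightarrow>
    (\<exists>d :: nat \<Rightarrow> real \<Rightarrow> nat \<Rightarrow> 'v. \<forall>t\<in>I. d 0 t = c t \<and>
      (\<forall>k. ((\<lambda>s. (\<lambda>i. (d k s i - d k t i) /\<^sub>R (s - t))) \<longlongrightarrow> d (Suc k) t) (at t)))"

definition smooth_curve_inf ::
    "('m, 'i, 'e::real_normed_vector) atlas \<Rightarrow> real \<Rightarrow> (real \<Rightarrow> nat \<Rightarrow> ('m, 'i, 'e) tp) \<Rightarrow> bool"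
  where "smooth_curve_inf M \<epsilon> \<gamma> \<longleftrightarrow>
    (\<forall>t\<in>{-\<epsilon><..<\<epsilon>}. \<gamma> t \<in> Tinf M) \<and>
    (\<forall>\<alpha>. let I = {t \<in> {-\<epsilon><..<\<epsilon>}. \<gamma> t \<in> chart_dom (Tinf_atlas M) \<alpha>} in
      open I \<and> smooth_frechet_curve I (\<lambda>t. chart (Tinf_atlas M) \<alpha> (\<gamma> t)))"

text \<open>
  With \<open>TT\<^sup>\<infinity> M\<close> and \<open>T\<^sup>2T\<^sup>\<infinity> M\<close> identified with the limits of \<open>T(T\<^sup>i M)\<close> and \<open>T\<^sup>2(T\<^sup>i M)\<close>,
  \<open>velocity_inf M j\<close> is the canonical lift of curves in \<open>T\<^sup>\<infinity> M\<close> for \<open>j = 0\<close> and in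
  \<open>TT\<^sup>\<infinity> M\<close> for \<open>j = 1\<close>.
\<close>

definition velocity_inf ::
    "('m, 'i, 'e::real_normed_vector) atlas \<Rightarrow> nat \<Rightarrow> (real \<Rightarrow> nat \<Rightarrow> ('m, 'i, 'e) tp) \<Rightarrow>
     real \<Rightarrow> nat \<Rightarrow> ('m, 'i, 'e) tp"
  where "velocity_inf M j \<gamma> t = (\<lambda>i. velocity M (i + j) (\<lambda>s. \<gamma> s i) t)"

definition lift_inf ::
    "('m, 'i, 'e::real_normed_vector) atlas \<Rightarrow> (('m, 'i, 'e) tp \<Rightarrow> ('m, 'i, 'e) tp) \<Rightarrow>
     (nat \<Rightarrow> ('m, 'i, 'e) tp) \<Rightarrow> nat \<Rightarrow> ('m, 'i, 'e) tp"
  where "lift_inf M S \<xi> = (\<lambda>i. iter_lift M S i (\<xi> i))"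

definition geodesic_inf ::
    "('m, 'i, 'e::real_normed_vector) atlas \<Rightarrow>
     ((nat \<Rightarrow> ('m, 'i, 'e) tp) \<Rightarrow> nat \<Rightarrow> ('m, 'i, 'e) tp) \<Rightarrow>
     real \<Rightarrow> (real \<Rightarrow> nat \<Rightarrow> ('m, 'i, 'e) tp) \<Rightarrow> bool"
  where "geodesic_inf M S \<epsilon> \<gamma> \<longleftrightarrow>
    smooth_curve_inf M \<epsilon> \<gamma> \<and>
    (\<forall>t\<in>{-\<epsilon><..<\<epsilon>}.
      velocity_inf M 1 (velocity_inf M 0 \<gamma>) t = S (velocity_inf M 0 \<gamma> t))"

end

theory Submission
  imports Defs
begin

text \<open>
  The points of \<open>T\<^sup>\<infinity> M\<close> over a chart domain \<open>U\<^sub>\<alpha>\<close> of \<open>M\<close> all lie in the limit of the charts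
  \<open>\<phi>\<^bsub>\<alpha>\<^sub>i\<^esub>\<close>, so existence can be shown in a single chart.  There \<open>S\<^bsup>c\<^sub>i\<^esup>\<close> is a vector field \<open>A\<^sub>i\<close> on an
  open set of the model space of \<open>T\<^sup>i\<^sup>+\<^sup>1 M\<close>, and \<open>A\<^sub>i\<^sub>+\<^sub>1 = flip \<circ> T A\<^sub>i \<circ> flip\<close>, where
  \<open>flip (x, y, X, Y) = (x, X, y, Y)\<close>.  Hence the integral curves of \<open>A\<^sub>i\<^sub>+\<^sub>1\<close> are the curves
  \<open>flip (z, v)\<close> with \<open>z\<close> an integral curve of \<open>A\<^sub>i\<close> and \<open>v\<close> a solution of the linear equation
  \<open>v' = DA\<^sub>i(z) v\<close>.  Linear equations are solvable on the whole interval of definition of \<open>z\<close>, so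
  the \<open>\<epsilon>\<close> obtained for \<open>i = 0\<close> serves all \<open>i\<close>, although the neighbourhoods given by the Picard
  theorem at the single levels could shrink to nothing.

  For uniqueness, the Hausdorff property of \<open>M\<close> keeps the base curve of a second geodesic equal to
  that of the first, hence in the chart, where uniqueness for ordinary differential equations
  applies at every level.
\<close>

section \<open>The model spaces\<close>

text \<open>The statement needs all iterated tangent maps at once, whereas smoothness is given by
  multilinear derivatives of every order. Smoothness is therefore converted once into the
  coinductive predicate \<open>tsmooth\<close>, one unfolding of which is one application of the
  tangent functor; for maps between model spaces only first and second derivatives are then
  computed. The second derivative enters through \<open>flip\<close>: exchanging y and X commutes
  with T T f because second derivatives are symmetric. This is why \<open>kappa\<close> does not
  depend on the chart. All maps that occur (projections, involutions, lifts of S) cover the identity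
  of M, so one chart index serves source and target on every level. Of the two sides of the
  semispray condition, proj o S = id yields the formula for \<open>A_{i+1}\<close>, and kappa o S =
  S makes an integral curve the velocity curve of its own first half, hence turns flows into
  geodesics. Both have to be carried through the lifts. The levels fit together since the
  compatibility of \<xi>, read in the chart, says that the flipped initial vector of level i + 1
  begins with the initial vector of level i.\<close>

definition trunc :: "nat \<Rightarrow> ('e::real_normed_vector) coord \<Rightarrow> 'e coord"
  where "trunc r v = Bcontfun (\<lambda>k. if k < 2 ^ r then v k else 0)"

text \<open>Together with \<open>trunc r\<close> this inverts \<open>join r\<close> on
  \<open>model (Suc r)\<close>. Both maps are total with values in \<open>model r\<close>, so the
  coordinate algebra needs few membership hypotheses.\<close>

definition shift :: "nat \<Rightarrow> ('e::real_normed_vector) coord \<Rightarrow> 'e coord"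
  where "shift r v = Bcontfun (\<lambda>k. if k < 2 ^ r then v (k + 2 ^ r) else 0)"

text \<open>Total and bounded linear on the whole ambient space; the formula of \<open>kappa\<close>
  in charts is recovered on \<open>model (Suc (Suc r))\<close>.\<close>

definition flip :: "nat \<Rightarrow> ('e::real_normed_vector) coord \<Rightarrow> 'e coord"
  where "flip r q = join (Suc r)
    (join r (trunc r (trunc (Suc r) q)) (trunc r (shift (Suc r) q)))
    (join r (shift r (trunc (Suc r) q)) (shift r (shift (Suc r) q)))"

lemma apply_trunc: "apply_bcontfun (trunc r v) k = (if k < 2 ^ r then v k else 0)"
proof -
  have "bounded (insert 0 (range (apply_bcontfun v)))"
    by simp
  then have "bounded (range (\<lambda>k. if k < 2 ^ r then v k else 0))"
    by (rule bounded_subset) auto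
  then have "(\<lambda>k. if k < 2 ^ r then v k else 0) \<in> bcontfun"
    by (auto simp: bcontfun_def)
  then show ?thesis
    by (simp add: trunc_def Bcontfun_inverse)
qed

lemma apply_shift: "apply_bcontfun (shift r v) k = (if k < 2 ^ r then v (k + 2 ^ r) else 0)"
proof -
  have "bounded (insert 0 (range (apply_bcontfun v)))"
    by simp
  then have "bounded (range (\<lambda>k. if k < 2 ^ r then v (k + 2 ^ r) else 0))"
    by (rule bounded_subset) auto
  then have "(\<lambda>k. if k < 2 ^ r then v (k + 2 ^ r) else 0) \<in> bcontfun"
    by (auto simp: bcontfun_def)
  then show ?thesis
    by (simp add: shift_def Bcontfun_inverse)
qed

lemma trunc_in_model [simp]: "trunc r v \<in> model r"
  by (simp add: model_def apply_trunc)

lemma shift_in_model [simp]: "shift r v \<in> model r"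
  by (simp add: model_def apply_shift)

lemma join_in_model [simp]: "y \<in> model r \<Longrightarrow> join r x y \<in> model (Suc r)"
  by (auto simp: model_def apply_join)

lemma trunc_id [simp]: "v \<in> model r \<Longrightarrow> trunc r v = v"
  by (rule bcontfun_eqI) (auto simp: model_def apply_trunc)

lemma in_model_iff: "v \<in> model r \<longleftrightarrow> trunc r v = v"
  by (metis trunc_id trunc_in_model)

lemma trunc_join [simp]: "trunc r (join r x y) = trunc r x"
  by (rule bcontfun_eqI) (auto simp: apply_trunc apply_join)

lemma shift_join [simp]: "shift r (join r x y) = trunc r y"
  by (rule bcontfun_eqI) (auto simp: apply_trunc apply_join apply_shift)

lemma trunc_shift [simp]: "trunc r (shift r x) = shift r x"
  by simp

lemma trunc_trunc_Suc [simp]: "trunc r (trunc (Suc r) x) = trunc r x"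
  by (rule bcontfun_eqI) (auto simp: apply_trunc)

lemma shift_trunc_Suc [simp]: "shift r (trunc (Suc r) x) = shift r x"
  by (rule bcontfun_eqI) (auto simp: apply_trunc apply_shift)

lemma join_trunc_left [simp]: "join r (trunc r x) y = join r x y"
  by (rule bcontfun_eqI) (auto simp: apply_trunc apply_join)

lemma trunc_Suc_join [simp]: "trunc (Suc r) (join r x y) = join r x (trunc r y)"
  by (rule bcontfun_eqI) (auto simp: apply_trunc apply_join)

lemma join_eq_iff:
  "y \<in> model r \<Longrightarrow> y' \<in> model r \<Longrightarrow>
    join r x y = join r x' y' \<longleftrightarrow> trunc r x = trunc r x' \<and> y = y'"
  by (metis join_trunc_left shift_join trunc_id trunc_join)

lemma join_trunc_shift [simp]: "join r (trunc r q) (shift r q) = trunc (Suc r) q"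
  by (rule bcontfun_eqI) (auto simp: apply_trunc apply_join apply_shift)

lemma join_self_shift [simp]: "join r q (shift r q) = trunc (Suc r) q"
  by (rule bcontfun_eqI) (auto simp: apply_trunc apply_join apply_shift)

lemma model_Suc_cases:
  assumes "q \<in> model (Suc r)"
  obtains x y where "x \<in> model r" "y \<in> model r" "q = join r x y"
  using assms by (metis join_trunc_shift shift_in_model trunc_id trunc_in_model)

lemma flip_join [simp]:
  "flip r (join (Suc r) (join r x y) (join r X Y)) =
    join (Suc r) (join r x (trunc r X)) (join r y (trunc r Y))"
  by (simp add: flip_def)

lemma flip_in_model [simp]: "flip r q \<in> model (Suc (Suc r))"
  by (simp add: flip_def)

lemma model_Suc_Suc_cases:
  assumes "q \<in> model (Suc (Suc r))"
  obtains x y X Y where "x \<in> model r" "y \<in> model r" "X \<in> model r" "Y \<in> model r"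
    "q = join (Suc r) (join r x y) (join r X Y)"
  using assms by (metis model_Suc_cases)

lemma flip_flip [simp]:
  assumes "q \<in> model (Suc (Suc r))"
  shows "flip r (flip r q) = q"
proof -
  obtain x y X Y where "x \<in> model r" "y \<in> model r" "X \<in> model r" "Y \<in> model r"
    "q = join (Suc r) (join r x y) (join r X Y)"
    using assms by (rule model_Suc_Suc_cases)
  then show ?thesis by simp
qed

section \<open>Norms and linearity of the coordinate operations\<close>

lemma norm_apply_le: "norm (apply_bcontfun v k) \<le> norm v"
  by (rule norm_bounded)

text \<open>The norm is a supremum over coordinates, so algebra and the bound 1 can be checked one
  coordinate at a time.\<close>

lemma bounded_linear_coordI:
  assumes "\<And>x y k. apply_bcontfun (f (x + y)) k = apply_bcontfun (f x) k + apply_bcontfun (f y) k"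
    and "\<And>c x k. apply_bcontfun (f (c *\<^sub>R x)) k = c *\<^sub>R apply_bcontfun (f x) k"
    and "\<And>x k. norm (apply_bcontfun (f x) k) \<le> norm x"
  shows "bounded_linear (f :: 'a::real_normed_vector \<Rightarrow> ('e::real_normed_vector) coord)"
proof (rule bounded_linear_intro[where K = 1])
  show "f (x + y) = f x + f y" for x y
    by (rule bcontfun_eqI) (simp add: assms(1) plus_bcontfun.rep_eq)
  show "f (c *\<^sub>R x) = c *\<^sub>R f x" for c x
    by (rule bcontfun_eqI) (simp add: assms(2) scaleR_bcontfun.rep_eq)
  show "norm (f x) \<le> norm x * 1" for x
    using assms(3) by (simp add: norm_bound)
qed

lemma bounded_linear_trunc: "bounded_linear (trunc r)"
  by (rule bounded_linear_coordI)
    (auto simp: apply_trunc plus_bcontfun.rep_eq scaleR_bcontfun.rep_eq norm_apply_le)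

lemma bounded_linear_shift: "bounded_linear (shift r)"
  by (rule bounded_linear_coordI)
    (auto simp: apply_shift plus_bcontfun.rep_eq scaleR_bcontfun.rep_eq norm_apply_le)

lemma bounded_linear_embed: "bounded_linear embed"
  by (rule bounded_linear_coordI) (auto simp: apply_embed)

lemma bounded_linear_apply_0: "bounded_linear (\<lambda>v::('e::real_normed_vector) coord. apply_bcontfun v 0)"
  by (rule bounded_linear_intro[where K = 1])
    (auto simp: plus_bcontfun.rep_eq scaleR_bcontfun.rep_eq norm_apply_le)

lemma bounded_linear_join: "bounded_linear (\<lambda>p. join r (fst p) (snd p))"
proof (rule bounded_linear_coordI)
  fix p :: "'a coord \<times> 'a coord" and k
  have "norm (fst p) \<le> norm p" "norm (snd p) \<le> norm p"
    by (metis norm_fst_le prod.collapse) (metis norm_snd_le prod.collapse)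
  then show "norm (apply_bcontfun (join r (fst p) (snd p)) k) \<le> norm p"
    using norm_apply_le[of "fst p" k] norm_apply_le[of "snd p" "k - 2 ^ r"]
    by (auto simp: apply_join)
qed (auto simp: apply_join plus_bcontfun.rep_eq scaleR_bcontfun.rep_eq)

lemma norm_trunc_le: "norm (trunc r v) \<le> norm v"
  by (rule norm_bound) (auto simp: apply_trunc norm_apply_le)

lemmas has_derivative_trunc [derivative_intros] =
  bounded_linear.has_derivative[OF bounded_linear_trunc]
lemmas has_derivative_shift [derivative_intros] =
  bounded_linear.has_derivative[OF bounded_linear_shift]

lemma has_derivative_join [derivative_intros]:
  "(f has_derivative f') (at x within S) \<Longrightarrow> (g has_derivative g') (at x within S) \<Longrightarrow>
    ((\<lambda>x. join r (f x) (g x)) has_derivative (\<lambda>h. join r (f' h) (g' h))) (at x within S)"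
  using bounded_linear.has_derivative[OF bounded_linear_join, OF has_derivative_Pair] by auto

lemma bounded_linear_join_comp:
  "bounded_linear f \<Longrightarrow> bounded_linear g \<Longrightarrow> bounded_linear (\<lambda>x. join r (f x) (g x))"
  using bounded_linear_compose[OF bounded_linear_join[of r], OF bounded_linear_Pair, of f g] by simp

lemma bounded_linear_flip: "bounded_linear (flip r)"
  unfolding flip_def
  by (intro bounded_linear_join_comp bounded_linear_compose[OF bounded_linear_trunc]
      bounded_linear_compose[OF bounded_linear_shift] bounded_linear_trunc bounded_linear_shift)

lemma join_add: "join r (x + x') (y + y') = join r x y + join r x' y'"
  by (rule bcontfun_eqI) (simp add: apply_join plus_bcontfun.rep_eq)

lemma zero_in_model [simp]: "0 \<in> model r"
  by (simp add: model_def zero_bcontfun.rep_eq)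

lemma add_in_model [simp]: "u \<in> model r \<Longrightarrow> v \<in> model r \<Longrightarrow> u + v \<in> model r"
  by (simp add: model_def plus_bcontfun.rep_eq)

lemma scaleR_in_model [simp]: "v \<in> model r \<Longrightarrow> c *\<^sub>R v \<in> model r"
  by (simp add: model_def scaleR_bcontfun.rep_eq)

lemma subspace_model: "subspace (model r)"
  by (simp add: subspace_def)

lemma diff_in_model [simp]: "u \<in> model r \<Longrightarrow> v \<in> model r \<Longrightarrow> u - v \<in> model r"
  by (rule subspace_diff[OF subspace_model])

section \<open>The tangent functor on model spaces\<close>

text \<open>
  Differentiability of a map on the subspace \<open>model r\<close> is expressed by differentiability, on
  the whole space, of its composition with the projection \<open>trunc r\<close>; there derivatives are unique.
\<close>

definition mopen :: "nat \<Rightarrow> ('e::real_normed_vector) coord set \<Rightarrow> bool"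
  where "mopen r U \<longleftrightarrow> U \<subseteq> model r \<and> open {y. trunc r y \<in> U}"

definition tdiff :: "nat \<Rightarrow> ('e::real_normed_vector coord \<Rightarrow> 'e coord) \<Rightarrow> 'e coord \<Rightarrow> bool"
  where "tdiff r f x \<longleftrightarrow> (\<lambda>y. f (trunc r y)) differentiable (at x)"

definition dd :: "nat \<Rightarrow> ('e::real_normed_vector coord \<Rightarrow> 'e coord) \<Rightarrow> 'e coord \<Rightarrow> 'e coord \<Rightarrow> 'e coord"
  where "dd r f x = frechet_derivative (\<lambda>y. f (trunc r y)) (at x)"

text \<open>The local form (x, v) |-> (f x, Df(x) v) of the tangent functor; \<open>tan_dom\<close>
  is the tangent bundle restricted to U.\<close>

definition tan_map :: "nat \<Rightarrow> nat \<Rightarrow> ('e::real_normed_vector coord \<Rightarrow> 'e coord) \<Rightarrow> 'e coord \<Rightarrow> 'e coord"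
  where "tan_map r s f q = join s (f (trunc r q)) (dd r f (trunc r q) (shift r q))"

definition tan_dom :: "nat \<Rightarrow> ('e::real_normed_vector) coord set \<Rightarrow> 'e coord set"
  where "tan_dom r U = {q \<in> model (Suc r). trunc r q \<in> U}"

text \<open>
  Smoothness as the existence of all iterated tangent maps: no multilinear maps occur, and
  stability under composition is a coinduction from the chain rule.
\<close>

coinductive tsmooth ::
    "nat \<Rightarrow> nat \<Rightarrow> ('e::real_normed_vector) coord set \<Rightarrow> ('e coord \<Rightarrow> 'e coord) \<Rightarrow> bool"
  where "mopen r U \<Longrightarrow> (\<And>x. x \<in> U \<Longrightarrow> f x \<in> model s) \<Longrightarrow> (\<And>x. x \<in> U \<Longrightarrow> tdiff r f x) \<Longrightarrow>
    tsmooth (Suc r) (Suc s) (tan_dom r U) (tan_map r s f) \<Longrightarrow> tsmooth r s U f"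

lemma tsmooth_coinduct:
  assumes "P r s U f"
    and "\<And>r s U f. P r s U f \<Longrightarrow> mopen r U \<and> (\<forall>x\<in>U. f x \<in> model s) \<and> (\<forall>x\<in>U. tdiff r f x) \<and>
      P (Suc r) (Suc s) (tan_dom r U) (tan_map r s f)"
  shows "tsmooth r s U f"
  by (rule tsmooth.coinduct[of P, OF assms(1)]) (drule assms(2), simp)

lemma mopen_tan_dom: "mopen r U \<Longrightarrow> mopen (Suc r) (tan_dom r U)"
  by (auto simp: mopen_def tan_dom_def)

lemma mopen_Int: "mopen r U \<Longrightarrow> mopen r V \<Longrightarrow> mopen r (U \<inter> V)"
  by (auto simp: mopen_def Collect_conj_eq intro: open_Int)

lemma mopen_iff: "mopen r U \<longleftrightarrow> openin (top_of_set (model r)) U"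
proof
  assume "mopen r U"
  then have "U = model r \<inter> {y. trunc r y \<in> U}" "open {y. trunc r y \<in> U}"
    by (auto simp: mopen_def)
  then show "openin (top_of_set (model r)) U"
    by (metis openin_open_Int)
next
  assume "openin (top_of_set (model r)) U"
  then obtain V where V: "open V" "U = model r \<inter> V"
    by (auto simp: openin_open)
  have "continuous_on UNIV (trunc r)"
    by (rule linear_continuous_on[OF bounded_linear_trunc])
  then have "open (trunc r -` V)"
    using V(1) open_vimage by blast
  then show "mopen r U"
    using V by (auto simp: mopen_def vimage_def)
qed

lemma tdiffD: "tdiff r f x \<Longrightarrow> ((\<lambda>y. f (trunc r y)) has_derivative dd r f x) (at x)"
  unfolding tdiff_def dd_def by (simp add: frechet_derivative_works)

lemma tdiffI: "((\<lambda>y. f (trunc r y)) has_derivative f') (at x) \<Longrightarrow> tdiff r f x"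
  unfolding tdiff_def by (auto simp: differentiable_def)

lemma dd_eqI: "((\<lambda>y. f (trunc r y)) has_derivative f') (at x) \<Longrightarrow> dd r f x = f'"
  unfolding dd_def by (rule frechet_derivative_at[symmetric])

text \<open>Maps that agree on U agree, after composition with \<open>trunc r\<close>, on an open
  set of the whole space, where derivatives are local.\<close>

lemma mopen_transform:
  assumes "mopen r U" "x \<in> U" "\<And>y. y \<in> U \<Longrightarrow> f y = g y"
    and "((\<lambda>y. g (trunc r y)) has_derivative g') (at x)"
  shows "((\<lambda>y. f (trunc r y)) has_derivative g') (at x)"
  using assms(4)
proof (rule has_derivative_transform_within_open)
  show "open {y. trunc r y \<in> U}" "x \<in> {y. trunc r y \<in> U}"
    using assms(1,2) by (auto simp: mopen_def subset_iff)
  show "\<And>y. y \<in> {y. trunc r y \<in> U} \<Longrightarrow> g (trunc r y) = f (trunc r y)"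
    using assms(3) by simp
qed

lemma tdiff_cong:
  assumes "mopen r U" "x \<in> U" "\<And>y. y \<in> U \<Longrightarrow> f y = g y" "tdiff r g x"
  shows "tdiff r f x" "dd r f x = dd r g x"
proof -
  have "((\<lambda>y. f (trunc r y)) has_derivative dd r g x) (at x)"
    using assms tdiffD mopen_transform by blast
  then show "tdiff r f x" and "dd r f x = dd r g x"
    by (rule tdiffI, rule dd_eqI)
qed

text \<open>Composing f with \<open>trunc s\<close> changes nothing on U, so uniqueness of
  derivatives makes \<open>dd r f x\<close> invariant under \<open>trunc s\<close>.\<close>

lemma dd_in_model:
  assumes "mopen r U" "x \<in> U" "\<And>y. y \<in> U \<Longrightarrow> f y \<in> model s" "tdiff r f x"
  shows "dd r f x v \<in> model s"
proof -
  have "((\<lambda>y. trunc s (f (trunc r y))) has_derivative (\<lambda>v. trunc s (dd r f x v))) (at x)"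
    by (intro derivative_intros tdiffD assms)
  then have "((\<lambda>y. f (trunc r y)) has_derivative (\<lambda>v. trunc s (dd r f x v))) (at x)"
    by (rule mopen_transform[OF assms(1,2), rotated]) (simp add: assms(3))
  then have "dd r f x = (\<lambda>v. trunc s (dd r f x v))"
    by (rule dd_eqI)
  then show ?thesis
    by (metis trunc_in_model)
qed

lemma dd_linear: "tdiff r f x \<Longrightarrow> bounded_linear (dd r f x)"
  using tdiffD has_derivative_bounded_linear by blast

text \<open>\<open>trunc r\<close> is idempotent, so the composition with it sees only the component
  of a direction inside the model space.\<close>

lemma dd_trunc:
  assumes "tdiff r f x" "x \<in> model r"
  shows "dd r f x (trunc r v) = dd r f x v"
proof -
  have "((\<lambda>y. f (trunc r (trunc r y))) has_derivative (\<lambda>v. dd r f x (trunc r v))) (at x)"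
  proof -
    have "(trunc r has_derivative trunc r) (at x)"
      by (rule bounded_linear_imp_has_derivative[OF bounded_linear_trunc])
    moreover have "((\<lambda>y. f (trunc r y)) has_derivative dd r f x) (at (trunc r x))"
      using assms tdiffD by simp
    ultimately show ?thesis
      by (rule has_derivative_compose)
  qed
  then have "dd r f x = (\<lambda>v. dd r f x (trunc r v))"
    by (intro dd_eqI) simp
  then show ?thesis
    by metis
qed

lemma tan_map_cong:
  assumes "mopen r U" "\<And>y. y \<in> U \<Longrightarrow> f y = g y" "\<And>y. y \<in> U \<Longrightarrow> tdiff r g y" "q \<in> tan_dom r U"
  shows "tan_map r s f q = tan_map r s g q"
  using assms tdiff_cong(2)[of r U "trunc r q" f g] by (simp add: tan_dom_def tan_map_def)

lemma tan_map_join: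
  "x \<in> model r \<Longrightarrow> v \<in> model r \<Longrightarrow> tan_map r s f (join r x v) = join s (f x) (dd r f x v)"
  by (simp add: tan_map_def)

section \<open>Stability of smoothness under restriction, composition and linear maps\<close>

lemma tsmooth_cases:
  assumes "tsmooth r s U f"
  shows "mopen r U" "\<And>x. x \<in> U \<Longrightarrow> f x \<in> model s" "\<And>x. x \<in> U \<Longrightarrow> tdiff r f x"
    "tsmooth (Suc r) (Suc s) (tan_dom r U) (tan_map r s f)"
  using assms by (auto elim: tsmooth.cases)

lemma tsmooth_mem: "tsmooth r s U f \<Longrightarrow> x \<in> U \<Longrightarrow> x \<in> model r"
  by (meson mopen_def subsetD tsmooth_cases(1))

lemma tsmooth_cong:
  assumes "tsmooth r s V f" "mopen r U" "U \<subseteq> V" "\<And>x. x \<in> U \<Longrightarrow> g x = f x"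
  shows "tsmooth r s U g"
proof -
  \<comment> \<open>Function and set vary in the invariant: on the next level the two tangent maps
    agree only on \<open>tan_dom r U\<close>.\<close>
  define P where "P = (\<lambda>r s U g. \<exists>V f. tsmooth r s V f \<and> mopen r U \<and> U \<subseteq> V \<and>
    (\<forall>x\<in>U. g x = (f x :: 'a coord)))"
  have "P r s U g"
    unfolding P_def using assms by blast
  then show ?thesis
  proof (rule tsmooth_coinduct)
    fix r s U g
    assume step: "P r s U g"
    from step obtain V f where *: "tsmooth r s V f" "mopen r U" "U \<subseteq> V" "\<forall>x\<in>U. g x = f x"
      unfolding P_def by blast
    note f = tsmooth_cases[OF *(1)]
    have "tan_map r s g q = tan_map r s f q" if "q \<in> tan_dom r U" for q
      using that * f by (intro tan_map_cong[of r U]) auto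
    moreover have "tan_dom r U \<subseteq> tan_dom r V"
      using *(3) by (auto simp: tan_dom_def)
    ultimately have "P (Suc r) (Suc s) (tan_dom r U) (tan_map r s g)"
      unfolding P_def using f(4) mopen_tan_dom[OF *(2)] by blast
    moreover have "tdiff r g x" if "x \<in> U" for x
      using that * f by (intro tdiff_cong(1)[of r U x g f]) auto
    moreover have "\<forall>x\<in>U. g x \<in> model s"
      using * f(2) by auto
    ultimately show "mopen r U \<and> (\<forall>x\<in>U. g x \<in> model s) \<and> (\<forall>x\<in>U. tdiff r g x) \<and>
      P (Suc r) (Suc s) (tan_dom r U) (tan_map r s g)"
      using *(2) by blast
  qed
qed

lemma dd_comp:
  assumes "mopen r U" "x \<in> U" "f ` U \<subseteq> V" "V \<subseteq> model s" "tdiff r f x" "tdiff s g (f x)"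
  shows "tdiff r (\<lambda>y. g (f y)) x" "dd r (\<lambda>y. g (f y)) x v = dd s g (f x) (dd r f x v)"
proof -
  have "((\<lambda>y. g (trunc s (f (trunc r y)))) has_derivative (\<lambda>v. dd s g (f x) (dd r f x v))) (at x)"
  proof -
    have "trunc r x = x"
      using assms(1,2) by (auto simp: mopen_def)
    then have "((\<lambda>y. g (trunc s y)) has_derivative dd s g (f x)) (at (f (trunc r x)))"
      using tdiffD[OF assms(6)] by simp
    with tdiffD[OF assms(5)] show ?thesis
      by (rule has_derivative_compose)
  qed
  then have *: "((\<lambda>y. g (f (trunc r y))) has_derivative (\<lambda>v. dd s g (f x) (dd r f x v))) (at x)"
    by (rule mopen_transform[OF assms(1,2), rotated])
      (metis assms(3,4) image_subset_iff subsetD trunc_id)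
  then show "tdiff r (\<lambda>y. g (f y)) x"
    by (rule tdiffI)
  show "dd r (\<lambda>y. g (f y)) x v = dd s g (f x) (dd r f x v)"
    using dd_eqI[OF *] by simp
qed

lemma tan_map_comp:
  assumes "mopen r U" "f ` U \<subseteq> V" "V \<subseteq> model s" "\<And>x. x \<in> U \<Longrightarrow> tdiff r f x"
    "\<And>y. y \<in> V \<Longrightarrow> tdiff s g y" "q \<in> tan_dom r U"
  shows "tan_map r t (\<lambda>y. g (f y)) q = tan_map s t g (tan_map r s f q)"
proof -
  have x: "trunc r q \<in> U"
    using assms(6) by (simp add: tan_dom_def)
  then have "f (trunc r q) \<in> V"
    using assms(2) by blast
  then have "trunc s (f (trunc r q)) = f (trunc r q)"
    using assms(3) by auto
  moreover have "dd r f (trunc r q) (shift r q) \<in> model s"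
    using dd_in_model[OF assms(1) x _ assms(4)[OF x]] assms(2,3) by blast
  ultimately show ?thesis
    using dd_comp(2)[OF assms(1) x assms(2,3) assms(4)[OF x] assms(5)] \<open>f (trunc r q) \<in> V\<close>
    by (simp add: tan_map_def)
qed

text \<open>By the chain rule, the tangent map of a composition is the composition of the tangent
  maps, hence again of the given form. Agreement with the composition is required on U only, since
  that is where the chain rule applies.\<close>

lemma tsmooth_comp:
  assumes "tsmooth r s U f" "tsmooth s t V g" "f ` U \<subseteq> V"
  shows "tsmooth r t U (\<lambda>x. g (f x))"
proof -
  define P where "P = (\<lambda>r t U k. \<exists>s V f g. tsmooth r s U f \<and> tsmooth s t V g \<and> f ` U \<subseteq> V \<and>
    (\<forall>x\<in>U. k x = (g (f x) :: 'a coord)))"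
  have "P r t U (\<lambda>x. g (f x))"
    using assms unfolding P_def by blast
  then show ?thesis
  proof (rule tsmooth_coinduct)
    fix r t U k
    assume step: "P r t U k"
    then obtain s V f g where *: "tsmooth r s U f" "tsmooth s t V g" "f ` U \<subseteq> V"
      "\<forall>x\<in>U. k x = g (f x)"
      unfolding P_def by blast
    note f = tsmooth_cases[OF *(1)] and g = tsmooth_cases[OF *(2)]
    have V: "V \<subseteq> model s"
      using g(1) by (simp add: mopen_def)
    have td: "tdiff r (\<lambda>x. g (f x)) x" if "x \<in> U" for x
      using dd_comp(1)[OF f(1) that *(3) V f(3)[OF that] g(3)] *(3) that by blast
    then have td': "tdiff r k x" if "x \<in> U" for x
      using tdiff_cong(1)[OF f(1) that _ td[OF that], of k] *(4) by blast
    have "tan_map r t k q = tan_map s t g (tan_map r s f q)" if "q \<in> tan_dom r U" for q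
    proof -
      have "tan_map r t k q = tan_map r t (\<lambda>x. g (f x)) q"
        using tan_map_cong[OF f(1) _ td that, of k] *(4) by blast
      also have "\<dots> = tan_map s t g (tan_map r s f q)"
        by (rule tan_map_comp[OF f(1) *(3) V f(3) g(3) that])
      finally show ?thesis .
    qed
    moreover have "tan_map r s f ` tan_dom r U \<subseteq> tan_dom s V"
    proof safe
      fix q assume q: "q \<in> tan_dom r U"
      then have "f (trunc r q) \<in> V"
        using *(3) by (auto simp: tan_dom_def)
      moreover have "tan_map r s f q \<in> model (Suc s)"
        by (rule tsmooth_cases(2)[OF f(4) q])
      moreover have "trunc s (f (trunc r q)) = f (trunc r q)"
        using calculation(1) V by auto
      ultimately show "tan_map r s f q \<in> tan_dom s V"
        by (simp add: tan_dom_def tan_map_def)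
    qed
    ultimately have "P (Suc r) (Suc t) (tan_dom r U) (tan_map r t k)"
      unfolding P_def using f(4) g(4) by blast
    moreover have "\<forall>x\<in>U. k x \<in> model t"
      using * g(2) by auto
    ultimately show "mopen r U \<and> (\<forall>x\<in>U. k x \<in> model t) \<and> (\<forall>x\<in>U. tdiff r k x) \<and>
      P (Suc r) (Suc t) (tan_dom r U) (tan_map r t k)"
      using f(1) td' by blast
  qed
qed

lemma tan_map_linear:
  assumes "bounded_linear l"
  shows "tdiff r l x" "dd r l x v = l (trunc r v)" "tan_map r s l q = join s (l (trunc r q)) (l (shift r q))"
proof -
  have *: "((\<lambda>y. l (trunc r y)) has_derivative (\<lambda>v. l (trunc r v))) (at x)" for x
    by (intro bounded_linear_imp_has_derivative bounded_linear_compose[OF assms] bounded_linear_trunc)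
  show "tdiff r l x" by (rule tdiffI[OF *])
  show "dd r l x v = l (trunc r v)" for x v using dd_eqI[OF *] by simp
  then show "tan_map r s l q = join s (l (trunc r q)) (l (shift r q))"
    by (simp add: tan_map_def)
qed

text \<open>The tangent map of a bounded linear map is bounded linear, so linearity itself is the
  coinductive invariant.\<close>

lemma tsmooth_linear:
  assumes "bounded_linear l" "\<And>x. x \<in> model r \<Longrightarrow> l x \<in> model s" "mopen r U"
  shows "tsmooth r s U l"
proof -
  define P where "P = (\<lambda>r s (U :: 'a coord set) (l :: 'a coord \<Rightarrow> 'a coord).
    bounded_linear l \<and> (\<forall>x\<in>model r. l x \<in> model s) \<and> mopen r U)"
  have "P r s U l"
    using assms by (simp add: P_def)
  then show ?thesis
  proof (rule tsmooth_coinduct)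
    fix r s U l
    assume step: "P r s U l"
    from step have l: "bounded_linear l"
      by (simp add: P_def)
    have "bounded_linear (\<lambda>q. join s (l (trunc r q)) (l (shift r q)))"
      by (intro bounded_linear_join_comp bounded_linear_compose[OF l bounded_linear_trunc]
          bounded_linear_compose[OF l bounded_linear_shift])
    then have "bounded_linear (tan_map r s l)"
      using tan_map_linear(3)[OF l, of r s] by presburger
    moreover have "\<forall>x\<in>model (Suc r). tan_map r s l x \<in> model (Suc s)"
      using step by (auto simp: P_def tan_map_linear(3)[OF l])
    ultimately have "P (Suc r) (Suc s) (tan_dom r U) (tan_map r s l)"
      using step by (simp add: P_def mopen_tan_dom)
    moreover have "\<forall>x\<in>U. l x \<in> model s"
      using step by (auto simp: P_def mopen_def)
    ultimately show "mopen r U \<and> (\<forall>x\<in>U. l x \<in> model s) \<and> (\<forall>x\<in>U. tdiff r l x) \<and>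
      P (Suc r) (Suc s) (tan_dom r U) (tan_map r s l)"
      using step tan_map_linear(1)[OF l] by (simp add: P_def)
  qed
qed

section \<open>Smooth maps have all iterated tangent maps\<close>

lemma bounded_linear_comp_trunc: "bounded_linear a \<Longrightarrow> bounded_linear (\<lambda>q. a (trunc r q))"
  by (rule bounded_linear_compose[OF _ bounded_linear_trunc])

lemma bounded_linear_comp_shift: "bounded_linear a \<Longrightarrow> bounded_linear (\<lambda>q. a (shift r q))"
  by (rule bounded_linear_compose[OF _ bounded_linear_shift])

lemma bounded_multilinear_on_slot:
  assumes "bounded_multilinear_on E k m" "subspace E"
    and "Suc (length vs + length ws) = k" "set vs \<subseteq> E" "set ws \<subseteq> E" "u \<in> E" "v \<in> E"
  shows "m (vs @ (u + a *\<^sub>R v) # ws) = m (vs @ u # ws) + a *\<^sub>R m (vs @ v # ws)"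
proof -
  have "length (vs @ u # ws) = k" "set (vs @ u # ws) \<subseteq> E" "length vs < k"
    using assms by auto
  then have "m ((vs @ u # ws)[length vs := u + a *\<^sub>R v]) =
      m ((vs @ u # ws)[length vs := u]) + a *\<^sub>R m ((vs @ u # ws)[length vs := v])"
    using assms(1,6,7) unfolding bounded_multilinear_on_def by blast
  then show ?thesis
    by simp
qed

lemma prod_norm_nonneg: "(\<Prod>v\<leftarrow>vs. norm v) \<ge> 0"
  by (induction vs) auto

lemma bounded_multilinear_on_bound:
  assumes "bounded_multilinear_on E k m"
  obtains C where "C \<ge> 0"
    "\<And>vs. length vs = k \<Longrightarrow> set vs \<subseteq> E \<Longrightarrow> norm (m vs) \<le> C * (\<Prod>v\<leftarrow>vs. norm v)"
proof -
  obtain C where C: "\<And>vs. length vs = k \<Longrightarrow> set vs \<subseteq> E \<Longrightarrow> norm (m vs) \<le> C * (\<Prod>v\<leftarrow>vs. norm v)"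
    using assms unfolding bounded_multilinear_on_def by blast
  show ?thesis
  proof (rule that)
    show "max C 0 \<ge> 0" by simp
    show "norm (m vs) \<le> max C 0 * (\<Prod>v\<leftarrow>vs. norm v)" if "length vs = k" "set vs \<subseteq> E" for vs
      by (rule order_trans[OF C[OF that]]) (simp add: prod_norm_nonneg mult_right_mono)
  qed
qed

text \<open>
  \<open>slot_deriv d A x as vs h\<close> is the derivative, at \<open>x\<close> in direction \<open>h\<close>, of
  \<open>y \<mapsto> d k (A y) (vs @ [a\<^sub>1 y, \<dots>, a\<^sub>n y])\<close>.
\<close>

primrec slot_deriv ::
    "(nat \<Rightarrow> 'a \<Rightarrow> 'a list \<Rightarrow> 'b) \<Rightarrow> ('c \<Rightarrow> 'a) \<Rightarrow> 'c \<Rightarrow> ('c \<Rightarrow> 'a) list \<Rightarrow> 'a list \<Rightarrow> 'c \<Rightarrow>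
     'b::real_normed_vector" where
    "slot_deriv d A x [] vs h = d (Suc (length vs)) (A x) (A h # vs)"
  | "slot_deriv d A x (a # as) vs h =
      d (Suc (length vs + length as)) (A x) (vs @ a h # map (\<lambda>b. b x) as) +
      slot_deriv d A x as (vs @ [a x]) h"

section \<open>Derivatives of multilinear expressions under linear substitutions\<close>

context
  fixes E U0 :: "'a::real_normed_vector set" and d :: "nat \<Rightarrow> 'a \<Rightarrow> 'a list \<Rightarrow> 'b::real_normed_vector"
  assumes sub: "subspace E"
    and ml: "\<And>k x. x \<in> U0 \<Longrightarrow> bounded_multilinear_on E k (d k x)"
    and dv: "\<And>k x e. x \<in> U0 \<Longrightarrow> e > 0 \<Longrightarrow> \<exists>\<delta>>0. \<forall>y\<in>U0. norm (y - x) < \<delta> \<longrightarrow>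
          (\<forall>vs. length vs = k \<and> set vs \<subseteq> E \<longrightarrow>
            norm (d k y vs - d k x vs - d (Suc k) x ((y - x) # vs))
              \<le> e * norm (y - x) * (\<Prod>v\<leftarrow>vs. norm v))"
begin

lemma d_slot:
  assumes "x \<in> U0" "Suc (length vs + length ws) = k" "set vs \<subseteq> E" "set ws \<subseteq> E" "u \<in> E" "v \<in> E"
  shows "d k x (vs @ (u + a *\<^sub>R v) # ws) = d k x (vs @ u # ws) + a *\<^sub>R d k x (vs @ v # ws)"
  using bounded_multilinear_on_slot[OF ml[OF assms(1)] sub] assms by blast

text \<open>Each step of the recursion only appends \<open>a x\<close> to the right of the
  distinguished slot; this is why \<open>ws\<close> is generalized in the induction.\<close>

lemma slot_deriv_slot:
  fixes A :: "'c::real_normed_vector \<Rightarrow> 'a"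
  assumes x: "A x \<in> U0" and A: "\<And>h. A h \<in> E" and as: "\<And>a h. a \<in> set as \<Longrightarrow> a h \<in> E"
    and "set vs \<subseteq> E" "set ws \<subseteq> E" "u \<in> E" "v \<in> E"
  shows "slot_deriv d A x as (vs @ (u + c *\<^sub>R v) # ws) h =
    slot_deriv d A x as (vs @ u # ws) h + c *\<^sub>R slot_deriv d A x as (vs @ v # ws) h"
  using assms
proof (induction as arbitrary: ws)
  case Nil
  show ?case
    using d_slot[OF x, of "A h # vs" ws "Suc (Suc (length vs + length ws))" u v c] Nil by simp
next
  case (Cons a as)
  have "slot_deriv d A x as (vs @ (u + c *\<^sub>R v) # (ws @ [a x])) h =
    slot_deriv d A x as (vs @ u # (ws @ [a x])) h + c *\<^sub>R slot_deriv d A x as (vs @ v # (ws @ [a x])) h"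
    using Cons.prems by (intro Cons.IH) auto
  moreover have "d (Suc (Suc (length vs + length ws + length as))) (A x)
        (vs @ (u + c *\<^sub>R v) # (ws @ a h # map (\<lambda>b. b x) as)) =
      d (Suc (Suc (length vs + length ws + length as))) (A x) (vs @ u # (ws @ a h # map (\<lambda>b. b x) as)) +
      c *\<^sub>R d (Suc (Suc (length vs + length ws + length as))) (A x) (vs @ v # (ws @ a h # map (\<lambda>b. b x) as))"
    using Cons.prems by (intro d_slot) auto
  ultimately show ?case
    by (simp add: algebra_simps)
qed

lemma slot_deriv_linear:
  fixes A :: "'c::real_normed_vector \<Rightarrow> 'a"
  assumes "A x \<in> U0" and A: "bounded_linear A" "\<And>h. A h \<in> E"
    and "\<And>a. a \<in> set as \<Longrightarrow> bounded_linear a" "\<And>a h. a \<in> set as \<Longrightarrow> a h \<in> E"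
    and "set vs \<subseteq> E"
  shows "slot_deriv d A x as vs (h + c *\<^sub>R k) = slot_deriv d A x as vs h + c *\<^sub>R slot_deriv d A x as vs k"
  using assms
proof (induction as arbitrary: vs)
  case Nil
  have "A (h + c *\<^sub>R k) = A h + c *\<^sub>R A k"
    by (simp add: A(1) linear_add linear_scale bounded_linear.linear)
  then show ?case
    using d_slot[OF Nil(1), of "[]" vs "Suc (length vs)" "A h" "A k" c] Nil by simp
next
  case (Cons a as)
  have "a (h + c *\<^sub>R k) = a h + c *\<^sub>R a k"
    using Cons.prems(4)[of a] by (simp add: linear_add linear_scale bounded_linear.linear)
  moreover have "d (Suc (length vs + length as)) (A x) (vs @ (a h + c *\<^sub>R a k) # map (\<lambda>b. b x) as) =
      d (Suc (length vs + length as)) (A x) (vs @ a h # map (\<lambda>b. b x) as) +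
      c *\<^sub>R d (Suc (length vs + length as)) (A x) (vs @ a k # map (\<lambda>b. b x) as)"
    using Cons.prems by (intro d_slot) auto
  moreover have "slot_deriv d A x as (vs @ [a x]) (h + c *\<^sub>R k) =
      slot_deriv d A x as (vs @ [a x]) h + c *\<^sub>R slot_deriv d A x as (vs @ [a x]) k"
    using Cons.prems by (intro Cons.IH) auto
  ultimately show ?case
    by (simp add: algebra_simps)
qed

text \<open>The constant is uniform in the fixed vectors \<open>vs\<close>. The remainder estimate
  uses this with a list ending in the varying vector \<open>a (y - x)\<close>.\<close>

lemma slot_deriv_bound:
  fixes A :: "'c::real_normed_vector \<Rightarrow> 'a"
  assumes "A x \<in> U0" and A: "bounded_linear A" "\<And>h. A h \<in> E"
    and "\<And>a. a \<in> set as \<Longrightarrow> bounded_linear a" "\<And>a h. a \<in> set as \<Longrightarrow> a h \<in> E"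
  shows "\<exists>C\<ge>0. \<forall>vs h. length vs = n \<and> set vs \<subseteq> E \<longrightarrow>
    norm (slot_deriv d A x as vs h) \<le> C * norm h * (\<Prod>v\<leftarrow>vs. norm v)"
  using assms
proof (induction as arbitrary: n)
  case Nil
  obtain C where C: "C \<ge> 0" "\<And>vs. length vs = Suc n \<Longrightarrow> set vs \<subseteq> E \<Longrightarrow>
      norm (d (Suc n) (A x) vs) \<le> C * (\<Prod>v\<leftarrow>vs. norm v)"
    using bounded_multilinear_on_bound[OF ml[OF Nil(1)]] by metis
  obtain K where K: "K > 0" "\<And>h. norm (A h) \<le> norm h * K"
    using bounded_linear.pos_bounded[OF A(1)] by blast
  have "norm (slot_deriv d A x [] vs h) \<le> (C * K) * norm h * (\<Prod>v\<leftarrow>vs. norm v)"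
    if "length vs = n" "set vs \<subseteq> E" for vs h
  proof -
    have "norm (slot_deriv d A x [] vs h) \<le> C * (norm (A h) * (\<Prod>v\<leftarrow>vs. norm v))"
      using C(2)[of "A h # vs"] that A by simp
    also have "\<dots> \<le> C * ((norm h * K) * (\<Prod>v\<leftarrow>vs. norm v))"
      by (intro mult_left_mono mult_right_mono K C prod_norm_nonneg)
    finally show ?thesis by (simp add: ac_simps)
  qed
  moreover have "C * K \<ge> 0"
    using C K by simp
  ultimately show ?case by blast
next
  case (Cons a as)
  let ?k = "Suc (n + length as)"
  obtain C where C: "C \<ge> 0" "\<And>vs. length vs = ?k \<Longrightarrow> set vs \<subseteq> E \<Longrightarrow>
      norm (d ?k (A x) vs) \<le> C * (\<Prod>v\<leftarrow>vs. norm v)"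
    using bounded_multilinear_on_bound[OF ml[OF Cons.prems(1)]] by metis
  have a: "bounded_linear a"
    using Cons.prems by simp
  obtain K where K: "K > 0" "\<And>h. norm (a h) \<le> norm h * K"
    using bounded_linear.pos_bounded[OF a] by blast
  have "\<exists>C\<ge>0. \<forall>vs h. length vs = Suc n \<and> set vs \<subseteq> E \<longrightarrow>
    norm (slot_deriv d A x as vs h) \<le> C * norm h * (\<Prod>v\<leftarrow>vs. norm v)"
    using Cons.prems by (intro Cons.IH) auto
  then obtain D where D: "D \<ge> 0" "\<And>vs h. length vs = Suc n \<Longrightarrow> set vs \<subseteq> E \<Longrightarrow>
      norm (slot_deriv d A x as vs h) \<le> D * norm h * (\<Prod>v\<leftarrow>vs. norm v)"
    by blast
  let ?p = "\<Prod>v\<leftarrow>map (\<lambda>b. b x) as. norm v"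
  let ?C = "C * K * ?p + D * norm (a x)"
  have "norm (slot_deriv d A x (a # as) vs h) \<le> ?C * norm h * (\<Prod>v\<leftarrow>vs. norm v)"
    if vs: "length vs = n" "set vs \<subseteq> E" for vs h
  proof -
    let ?q = "\<Prod>v\<leftarrow>vs. norm v"
    have "norm (d ?k (A x) (vs @ a h # map (\<lambda>b. b x) as)) \<le> C * (?q * (norm (a h) * ?p))"
    proof -
      have "(\<lambda>b. b x) ` set as \<subseteq> E"
        using Cons.prems by auto
      then show ?thesis
        using C(2)[of "vs @ a h # map (\<lambda>b. b x) as"] vs Cons.prems by simp
    qed
    also have "\<dots> \<le> C * (?q * ((norm h * K) * ?p))"
      by (intro mult_left_mono mult_right_mono K C prod_norm_nonneg)
    finally have "norm (d ?k (A x) (vs @ a h # map (\<lambda>b. b x) as)) \<le> C * K * ?p * norm h * ?q"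
      by (simp add: ac_simps)
    moreover have "norm (slot_deriv d A x as (vs @ [a x]) h) \<le> D * norm h * (?q * norm (a x))"
      using D(2)[of "vs @ [a x]" h] vs Cons.prems by simp
    ultimately have "norm (slot_deriv d A x (a # as) vs h) \<le>
        C * K * ?p * norm h * ?q + D * norm h * (?q * norm (a x))"
      using vs by (simp add: norm_triangle_mono)
    then show ?thesis by (simp add: algebra_simps)
  qed
  moreover have "?C \<ge> 0"
    using C K D by (intro add_nonneg_nonneg mult_nonneg_nonneg prod_norm_nonneg) auto
  ultimately show ?case by blast
qed

text \<open>The arguments are moved from x to y one at a time. The induction hypothesis is applied
  with \<open>a y\<close> as an additional fixed vector; replacing it afterwards by
  \<open>a x\<close> costs the wanted derivative in this slot and a term quadratic in y - x.\<close>

lemma slot_deriv_remainder: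
  fixes A :: "'c::real_normed_vector \<Rightarrow> 'a"
  assumes "A x \<in> U0" and A: "bounded_linear A" "\<And>h. A h \<in> E"
    and "\<And>a. a \<in> set as \<Longrightarrow> bounded_linear a" "\<And>a h. a \<in> set as \<Longrightarrow> a h \<in> E"
    and "e > 0"
  shows "\<exists>\<delta>>0. \<forall>y vs. norm (y - x) < \<delta> \<and> A y \<in> U0 \<and> length vs = n \<and> set vs \<subseteq> E \<longrightarrow>
    norm (d (n + length as) (A y) (vs @ map (\<lambda>a. a y) as) -
      d (n + length as) (A x) (vs @ map (\<lambda>a. a x) as) - slot_deriv d A x as vs (y - x))
    \<le> e * norm (y - x) * (\<Prod>v\<leftarrow>vs. norm v)"
  using assms
proof (induction as arbitrary: n e)
  case Nil
  obtain K where K: "K > 0" "\<And>h. norm (A h) \<le> norm h * K"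
    using bounded_linear.pos_bounded[OF A(1)] by blast
  have "e / K > 0"
    using Nil K by simp
  from dv[OF Nil(1) this, of n] obtain \<delta> where \<delta>: "\<delta> > 0"
    "\<And>y vs. y \<in> U0 \<Longrightarrow> norm (y - A x) < \<delta> \<Longrightarrow> length vs = n \<Longrightarrow> set vs \<subseteq> E \<Longrightarrow>
      norm (d n y vs - d n (A x) vs - d (Suc n) (A x) ((y - A x) # vs))
        \<le> e / K * norm (y - A x) * (\<Prod>v\<leftarrow>vs. norm v)"
    by blast
  have "norm (d n (A y) vs - d n (A x) vs - d (Suc n) (A x) (A (y - x) # vs))
      \<le> e * norm (y - x) * (\<Prod>v\<leftarrow>vs. norm v)"
    if "norm (y - x) < \<delta> / K" "A y \<in> U0" "length vs = n" "set vs \<subseteq> E" for y vs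
  proof -
    have eq: "A y - A x = A (y - x)"
      by (simp add: A(1) linear_diff bounded_linear.linear)
    have le: "norm (A (y - x)) \<le> norm (y - x) * K"
      by (rule K)
    also have "\<dots> < \<delta>"
      using that(1) K by (simp add: pos_less_divide_eq)
    finally have "norm (d n (A y) vs - d n (A x) vs - d (Suc n) (A x) (A (y - x) # vs))
        \<le> e / K * norm (A (y - x)) * (\<Prod>v\<leftarrow>vs. norm v)"
      using \<delta>(2)[of "A y" vs] that eq by simp
    also have "\<dots> \<le> e / K * (norm (y - x) * K) * (\<Prod>v\<leftarrow>vs. norm v)"
      using K Nil by (intro mult_left_mono mult_right_mono le prod_norm_nonneg) auto
    finally show ?thesis
      using K by simp
  qed
  moreover have "\<delta> / K > 0"
    using \<delta> K by simp
  ultimately show ?case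
    by (intro exI[of _ "\<delta> / K"]) simp
next
  case (Cons a as)
  let ?k = "Suc n + length as"
  have a: "bounded_linear a" and aE: "\<And>h. a h \<in> E"
    using Cons.prems by simp_all
  obtain K where K: "K > 0" "\<And>h. norm (a h) \<le> norm h * K"
    using bounded_linear.pos_bounded[OF a] by blast
  have "\<exists>C\<ge>0. \<forall>vs h. length vs = Suc n \<and> set vs \<subseteq> E \<longrightarrow>
    norm (slot_deriv d A x as vs h) \<le> C * norm h * (\<Prod>v\<leftarrow>vs. norm v)"
    using Cons.prems by (intro slot_deriv_bound) auto
  then obtain D where D: "D \<ge> 0" "\<And>vs h. length vs = Suc n \<Longrightarrow> set vs \<subseteq> E \<Longrightarrow>
      norm (slot_deriv d A x as vs h) \<le> D * norm h * (\<Prod>v\<leftarrow>vs. norm v)"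
    by blast
  \<comment> \<open>A bound for \<open>norm (a y)\<close> as long as y has distance less than 1 from
    x, which explains the 1 in \<open>?\<delta>\<close>.\<close>
  define M where "M = norm (a x) + K"
  have M: "M > 0"
    using K by (simp add: add_nonneg_pos M_def)
  have "e / 2 / M > 0"
    using M Cons.prems by simp
  then have "\<exists>\<delta>>0. \<forall>y vs. norm (y - x) < \<delta> \<and> A y \<in> U0 \<and> length vs = Suc n \<and> set vs \<subseteq> E \<longrightarrow>
    norm (d ?k (A y) (vs @ map (\<lambda>a. a y) as) - d ?k (A x) (vs @ map (\<lambda>a. a x) as)
      - slot_deriv d A x as vs (y - x)) \<le> e / 2 / M * norm (y - x) * (\<Prod>v\<leftarrow>vs. norm v)"
    using Cons.prems by (intro Cons.IH) auto
  then obtain \<delta> where \<delta>: "\<delta> > 0" "\<And>y vs. norm (y - x) < \<delta> \<Longrightarrow> A y \<in> U0 \<Longrightarrow> length vs = Suc n \<Longrightarrow>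
    set vs \<subseteq> E \<Longrightarrow> norm (d ?k (A y) (vs @ map (\<lambda>a. a y) as) - d ?k (A x) (vs @ map (\<lambda>a. a x) as)
      - slot_deriv d A x as vs (y - x)) \<le> e / 2 / M * norm (y - x) * (\<Prod>v\<leftarrow>vs. norm v)"
    by blast
  \<comment> \<open>The quadratic term is at most \<open>D * K\<close> times the square of the
    increment; the radius \<open>e / 2 / W\<close> turns one of the two factors into e / 2. The 1
    keeps W positive.\<close>
  define W where "W = D * K + 1"
  let ?\<delta> = "min (min \<delta> 1) (e / 2 / W)"
  have W: "W > 0"
    using D K by (simp add: add_nonneg_pos W_def)
  have "norm (d ?k (A y) (vs @ a y # map (\<lambda>a. a y) as) - d ?k (A x) (vs @ a x # map (\<lambda>a. a x) as)
      - slot_deriv d A x (a # as) vs (y - x)) \<le> e * norm (y - x) * (\<Prod>v\<leftarrow>vs. norm v)"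
    if y: "norm (y - x) < ?\<delta>" "A y \<in> U0" and vs: "length vs = n" "set vs \<subseteq> E" for y vs
  proof -
    let ?h = "y - x" and ?q = "\<Prod>v\<leftarrow>vs. norm v" and ?as = "map (\<lambda>a. a x) as"
    have ay: "a y = a x + 1 *\<^sub>R a ?h"
      by (simp add: a linear_diff bounded_linear.linear)
    have nay: "norm (a y) \<le> M"
    proof -
      have "norm (a y) \<le> norm (a x) + norm (a ?h)"
        unfolding ay by (metis norm_triangle_ineq scaleR_one)
      also have "norm (a ?h) \<le> norm ?h * K"
        by (rule K)
      also have "norm ?h * K \<le> 1 * K"
        using y K by (intro mult_right_mono) auto
      finally show ?thesis by (simp add: M_def)
    qed
    have "norm (d ?k (A y) ((vs @ [a y]) @ map (\<lambda>a. a y) as) - d ?k (A x) ((vs @ [a y]) @ ?as)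
        - slot_deriv d A x as (vs @ [a y]) ?h) \<le> e / 2 / M * norm ?h * (\<Prod>v\<leftarrow>vs @ [a y]. norm v)"
      using y vs aE by (intro \<delta>(2)) auto
    also have "(\<Prod>v\<leftarrow>vs @ [a y]. norm v) = ?q * norm (a y)"
      by simp
    also have "e / 2 / M * norm ?h * (?q * norm (a y)) \<le> e / 2 / M * norm ?h * (?q * M)"
      using M Cons.prems by (intro mult_left_mono nay mult_nonneg_nonneg prod_norm_nonneg) auto
    also have "\<dots> = e / 2 * norm ?h * ?q"
      using M by simp
    finally have 1: "norm (d ?k (A y) ((vs @ [a y]) @ map (\<lambda>a. a y) as) - d ?k (A x) ((vs @ [a y]) @ ?as)
        - slot_deriv d A x as (vs @ [a y]) ?h) \<le> e / 2 * norm ?h * ?q" .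
    have "norm (slot_deriv d A x as (vs @ [a ?h]) ?h) \<le> D * norm ?h * (\<Prod>v\<leftarrow>vs @ [a ?h]. norm v)"
      using vs aE by (intro D(2)) auto
    also have "(\<Prod>v\<leftarrow>vs @ [a ?h]. norm v) = ?q * norm (a ?h)"
      by simp
    also have "D * norm ?h * (?q * norm (a ?h)) \<le> D * norm ?h * (?q * (norm ?h * K))"
      using D by (intro mult_left_mono K mult_nonneg_nonneg prod_norm_nonneg) auto
    also have "\<dots> = (norm ?h * (D * K)) * (norm ?h * ?q)"
      by simp
    also have "norm ?h * (D * K) \<le> norm ?h * W"
      by (intro mult_left_mono) (auto simp: W_def)
    also have "norm ?h * W \<le> e / 2"
    proof -
      have "norm ?h < e / 2 / W"
        using y by simp
      then show ?thesis
        using W by (metis less_eq_real_def pos_less_divide_eq)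
    qed
    finally have 2: "norm (slot_deriv d A x as (vs @ [a ?h]) ?h) \<le> e / 2 * (norm ?h * ?q)"
      by (simp add: mult_right_mono prod_norm_nonneg)
    \<comment> \<open>The second summand contains the increment twice, once as the direction and
      once in the slot: this is the quadratic error.\<close>
    have 3: "slot_deriv d A x as (vs @ [a y]) ?h =
        slot_deriv d A x as (vs @ [a x]) ?h + slot_deriv d A x as (vs @ [a ?h]) ?h"
      using slot_deriv_slot[of A x as vs "[]" "a x" "a ?h" 1 ?h] Cons.prems vs aE ay by simp
    have 4: "d ?k (A x) (vs @ a y # ?as) = d ?k (A x) (vs @ a x # ?as) + d ?k (A x) (vs @ a ?h # ?as)"
    proof -
      have "set ?as \<subseteq> E"
        using Cons.prems by auto
      then have "d ?k (A x) (vs @ (a x + 1 *\<^sub>R a ?h) # ?as) =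
          d ?k (A x) (vs @ a x # ?as) + 1 *\<^sub>R d ?k (A x) (vs @ a ?h # ?as)"
        using Cons.prems(1) vs aE by (intro d_slot) auto
      then show ?thesis
        unfolding ay[symmetric] by (simp only: scaleR_one)
    qed
    have "d ?k (A y) (vs @ a y # map (\<lambda>a. a y) as) - d ?k (A x) (vs @ a x # ?as)
        - slot_deriv d A x (a # as) vs ?h =
      (d ?k (A y) ((vs @ [a y]) @ map (\<lambda>a. a y) as) - d ?k (A x) ((vs @ [a y]) @ ?as)
        - slot_deriv d A x as (vs @ [a y]) ?h) + slot_deriv d A x as (vs @ [a ?h]) ?h"
      using vs by (simp add: 3 4[unfolded add_Suc] algebra_simps)
    also have "norm \<dots> \<le> e / 2 * norm ?h * ?q + e / 2 * (norm ?h * ?q)"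
      using 1 2 by (rule norm_triangle_mono)
    finally show ?thesis
      by (simp add: field_simps)
  qed
  moreover have "?\<delta> > 0"
    using \<delta> W Cons.prems by simp
  ultimately show ?case
    by (intro exI[of _ ?\<delta>]) (simp only: list.simps length_Cons add_Suc_right add_Suc, blast)
qed

text \<open>The closure of the derivatives \<open>d k\<close> under bounded linear substitutions and sums is
  stable under the tangent functor.\<close>

inductive lin_comb ::
    "nat \<Rightarrow> ('e::real_normed_vector coord \<Rightarrow> 'a) \<Rightarrow> ('e coord \<Rightarrow> 'e coord) \<Rightarrow> bool"
  for s A where
    single: "(\<And>a. a \<in> set as \<Longrightarrow> bounded_linear a) \<Longrightarrow> (\<And>a h. a \<in> set as \<Longrightarrow> a h \<in> E) \<Longrightarrow>
      bounded_linear B \<Longrightarrow> (\<And>y. B y \<in> model s) \<Longrightarrow> k = length as \<Longrightarrow>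
      lin_comb s A (\<lambda>q. B (d k (A q) (map (\<lambda>a. a q) as)))"
  | add: "lin_comb s A f \<Longrightarrow> lin_comb s A g \<Longrightarrow> lin_comb s A (\<lambda>q. f q + g q)"

section \<open>Closure of the derivatives under the tangent functor\<close>

lemma lin_comb_in_model: "lin_comb s A f \<Longrightarrow> f q \<in> model s"
  by (induction rule: lin_comb.induct) simp_all

lemma lin_comb_trunc:
  assumes "lin_comb s A f"
  shows "lin_comb (Suc s) (\<lambda>q. A (trunc r q)) (\<lambda>q. join s (f (trunc r q)) 0)"
  using assms
proof (induction rule: lin_comb.induct)
  case (single as B k)
  have "lin_comb (Suc s) (\<lambda>q. A (trunc r q))
    (\<lambda>q. (\<lambda>y. join s (B y) 0) (d k (A (trunc r q)) (map (\<lambda>a. a q) (map (\<lambda>a q. a (trunc r q)) as))))"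
    using single by (intro lin_comb.single bounded_linear_join_comp)
      (auto intro: bounded_linear_comp_trunc simp: bounded_linear_zero)
  then show ?case
    by (simp add: comp_def)
next
  case (add f g)
  have "join s (f (trunc r q) + g (trunc r q)) 0 = join s (f (trunc r q)) 0 + join s (g (trunc r q)) 0"
    for q
    by (metis add.right_neutral join_add)
  then show ?case
    using lin_comb.add[OF add.IH] by simp
qed

text \<open>In every summand of \<open>slot_deriv\<close> exactly one entry depends on the direction
  (\<open>shift\<close>) and all others on the base point (\<open>trunc\<close>). The list
  \<open>bs\<close> holds the arguments that the recursion has already passed, so that they enter
  the summand as linear functions of q as well.\<close>

lemma lin_comb_slot_deriv:
  assumes A: "bounded_linear A" "\<And>h. A h \<in> E"
    and "\<And>a. a \<in> set as \<Longrightarrow> bounded_linear a" "\<And>a h. a \<in> set as \<Longrightarrow> a h \<in> E"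
    and "\<And>a. a \<in> set bs \<Longrightarrow> bounded_linear a" "\<And>a h. a \<in> set bs \<Longrightarrow> a h \<in> E"
    and B: "bounded_linear B" "\<And>y. B y \<in> model s"
  shows "lin_comb (Suc s) (\<lambda>q. A (trunc r q))
    (\<lambda>q. join s 0 (B (slot_deriv d A (trunc r q) as (map (\<lambda>b. b (trunc r q)) bs) (shift r q))))"
  using assms
proof (induction as arbitrary: bs)
  case Nil
  have "lin_comb (Suc s) (\<lambda>q. A (trunc r q))
    (\<lambda>q. (\<lambda>y. join s 0 (B y)) (d (Suc (length bs)) (A (trunc r q))
      (map (\<lambda>a. a q) ((\<lambda>q. A (shift r q)) # map (\<lambda>a q. a (trunc r q)) bs))))"
    using Nil by (intro lin_comb.single bounded_linear_join_comp)
      (auto intro: bounded_linear_comp_trunc bounded_linear_comp_shift simp: bounded_linear_zero)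
  then show ?case
    by (simp add: comp_def)
next
  case (Cons a as)
  let ?cs = "map (\<lambda>a q. a (trunc r q)) bs @ (\<lambda>q. a (shift r q)) # map (\<lambda>a q. a (trunc r q)) as"
  have "\<forall>b\<in>set (bs @ a # as). bounded_linear b \<and> (\<forall>h. b h \<in> E)"
    using Cons.prems by auto
  then have cs: "\<forall>c\<in>set ?cs. bounded_linear c \<and> (\<forall>h. c h \<in> E)"
    by (simp add: ball_Un bounded_linear_comp_trunc bounded_linear_comp_shift)
  have "lin_comb (Suc s) (\<lambda>q. A (trunc r q))
    (\<lambda>q. (\<lambda>y. join s 0 (B y)) (d (Suc (length bs + length as)) (A (trunc r q)) (map (\<lambda>a. a q) ?cs)))"
  proof (rule lin_comb.single[where as = ?cs and B = "\<lambda>y. join s 0 (B y)"])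
    show "bounded_linear c" "c h \<in> E" if "c \<in> set ?cs" for c h
      using cs that by blast+
    show "bounded_linear (\<lambda>y. join s 0 (B y))"
      by (intro bounded_linear_join_comp bounded_linear_zero Cons.prems)
    show "join s 0 (B y) \<in> model (Suc s)" for y
      by (simp add: Cons.prems)
  qed simp
  then have 1: "lin_comb (Suc s) (\<lambda>q. A (trunc r q))
    (\<lambda>q. join s 0 (B (d (Suc (length bs + length as)) (A (trunc r q))
      (map (\<lambda>b. b (trunc r q)) bs @ a (shift r q) # map (\<lambda>b. b (trunc r q)) as))))"
    by (simp add: comp_def)
  have 2: "lin_comb (Suc s) (\<lambda>q. A (trunc r q))
    (\<lambda>q. join s 0 (B (slot_deriv d A (trunc r q) as (map (\<lambda>b. b (trunc r q)) (bs @ [a])) (shift r q))))"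
    using Cons.prems by (intro Cons.IH) auto
  have "join s 0 (B (y + z)) = join s 0 (B y) + join s 0 (B z)" for y z
    using join_add[of s 0 0 "B y" "B z"] by (simp add: B(1) linear_add bounded_linear.linear)
  then show ?case
    using lin_comb.add[OF 1 2] by simp
qed

text \<open>The derivative f' is chosen for all x at once, so that the tangent map built from it can
  be shown to lie in the class again; it is a derivative only at points whose neighbours in the
  model are sent into U0.\<close>

lemma lin_comb_has_derivative:
  fixes A :: "('e::real_normed_vector) coord \<Rightarrow> 'a"
  assumes "lin_comb s A f" "bounded_linear A" "\<And>h. A h \<in> E"
  shows "\<exists>f'. (\<forall>x\<in>model r. A x \<in> U0 \<and> (\<exists>\<delta>>0. \<forall>y\<in>model r. norm (y - x) < \<delta> \<longrightarrow> A y \<in> U0) \<longrightarrow>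
      ((\<lambda>y. f (trunc r y)) has_derivative (\<lambda>h. f' x (trunc r h))) (at x)) \<and>
    lin_comb (Suc s) (\<lambda>q. A (trunc r q)) (\<lambda>q. join s (f (trunc r q)) (f' (trunc r q) (shift r q)))"
  using assms(1)
proof (induction rule: lin_comb.induct)
  case (single as B k)
  let ?f = "\<lambda>q. B (d k (A q) (map (\<lambda>a. a q) as))"
  let ?f' = "\<lambda>x h. B (slot_deriv d A x as [] h)"
  have "((\<lambda>y. ?f (trunc r y)) has_derivative (\<lambda>h. ?f' x (trunc r h))) (at x)"
    if x: "x \<in> model r" "A x \<in> U0" and \<delta>1: "\<delta>1 > 0" "\<forall>y\<in>model r. norm (y - x) < \<delta>1 \<longrightarrow> A y \<in> U0" for x \<delta>1
  proof -
    let ?g = "\<lambda>y. d k (A (trunc r y)) (map (\<lambda>a. a (trunc r y)) as)"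
    have ad: "slot_deriv d A x as [] (h + c *\<^sub>R k) =
        slot_deriv d A x as [] h + c *\<^sub>R slot_deriv d A x as [] k" for h c k
      using single x assms by (intro slot_deriv_linear) auto
    have "\<exists>C\<ge>0. \<forall>vs h. length vs = 0 \<and> set vs \<subseteq> E \<longrightarrow>
        norm (slot_deriv d A x as vs h) \<le> C * norm h * (\<Prod>v\<leftarrow>vs. norm v)"
      using single x assms by (intro slot_deriv_bound) auto
    then obtain C where C: "norm (slot_deriv d A x as [] h) \<le> C * norm h" for h
      by auto
    have bl: "bounded_linear (slot_deriv d A x as [])"
    proof (rule bounded_linear_intro[where K = C])
      show add: "slot_deriv d A x as [] (h + k) = slot_deriv d A x as [] h + slot_deriv d A x as [] k" for h k
        using ad[of h 1 k] by simp
      show "slot_deriv d A x as [] (c *\<^sub>R k) = c *\<^sub>R slot_deriv d A x as [] k" for c k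
        using ad[of 0 c k] add[of 0 0] by simp
      show "norm (slot_deriv d A x as [] h) \<le> norm h * C" for h
        using C[of h] by (simp add: mult.commute)
    qed
    have "(?g has_derivative (\<lambda>h. slot_deriv d A x as [] (trunc r h))) (at x)"
      unfolding has_derivative_at_alt
    proof (intro conjI allI impI)
      show "bounded_linear (\<lambda>h. slot_deriv d A x as [] (trunc r h))"
        by (rule bounded_linear_compose[OF bl bounded_linear_trunc])
      fix e :: real assume "e > 0"
      then have "\<exists>\<delta>>0. \<forall>y vs. norm (y - x) < \<delta> \<and> A y \<in> U0 \<and> length vs = 0 \<and> set vs \<subseteq> E \<longrightarrow>
        norm (d (0 + length as) (A y) (vs @ map (\<lambda>a. a y) as) -
          d (0 + length as) (A x) (vs @ map (\<lambda>a. a x) as) - slot_deriv d A x as vs (y - x))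
        \<le> e * norm (y - x) * (\<Prod>v\<leftarrow>vs. norm v)"
        using single x assms by (intro slot_deriv_remainder) auto
      then obtain \<delta> where \<delta>: "\<delta> > 0" "\<And>y. norm (y - x) < \<delta> \<Longrightarrow> A y \<in> U0 \<Longrightarrow>
        norm (d k (A y) (map (\<lambda>a. a y) as) - d k (A x) (map (\<lambda>a. a x) as)
          - slot_deriv d A x as [] (y - x)) \<le> e * norm (y - x)"
        using single(5) by fastforce
      have "norm (?g y - ?g x - slot_deriv d A x as [] (trunc r (y - x))) \<le> e * norm (y - x)"
        if y: "norm (y - x) < min \<delta> \<delta>1" for y
      proof -
        have eq: "trunc r (y - x) = trunc r y - x"
          using x by (simp add: linear_diff bounded_linear.linear bounded_linear_trunc)
        \<comment> \<open>The projection has norm at most 1 and fixes x, so \<open>trunc r y\<close>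
          is at least as close to x as y.\<close>
        have le: "norm (trunc r y - x) \<le> norm (y - x)"
          using norm_trunc_le[of r "y - x"] eq by simp
        have "norm (?g y - ?g x - slot_deriv d A x as [] (trunc r (y - x))) \<le> e * norm (trunc r y - x)"
          using \<delta>(2)[of "trunc r y"] \<delta>1(2) le y x eq by simp
        also have "\<dots> \<le> e * norm (y - x)"
          using le \<open>e > 0\<close> by (simp add: mult_left_mono)
        finally show ?thesis .
      qed
      then show "\<exists>\<delta>>0. \<forall>y. norm (y - x) < \<delta> \<longrightarrow>
          norm (?g y - ?g x - slot_deriv d A x as [] (trunc r (y - x))) \<le> e * norm (y - x)"
        using \<delta>(1) \<delta>1(1) by (intro exI[of _ "min \<delta> \<delta>1"]) simp
    qed
    then show ?thesis
      by (rule bounded_linear.has_derivative[OF single(3)])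
  qed
  moreover have "lin_comb (Suc s) (\<lambda>q. A (trunc r q))
      (\<lambda>q. join s (?f (trunc r q)) (?f' (trunc r q) (shift r q)))"
  proof -
    have 1: "lin_comb (Suc s) (\<lambda>q. A (trunc r q)) (\<lambda>q. join s (?f (trunc r q)) 0)"
      using single by (intro lin_comb_trunc lin_comb.single) auto
    have 2: "lin_comb (Suc s) (\<lambda>q. A (trunc r q)) (\<lambda>q. join s 0 (?f' (trunc r q) (shift r q)))"
      using lin_comb_slot_deriv[of A as "[]" B s r] single assms by simp
    have "join s u 0 + join s 0 v = join s u v" for u v :: "'e coord"
      by (metis add.left_neutral add.right_neutral join_add)
    then show ?thesis
      using lin_comb.add[OF 1 2] by simp
  qed
  ultimately show ?case
    by (intro exI[of _ ?f']) blast
next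
  case (add f g)
  from add.IH obtain f' where f': "\<forall>x\<in>model r. A x \<in> U0 \<and> (\<exists>\<delta>>0. \<forall>y\<in>model r. norm (y - x) < \<delta> \<longrightarrow> A y \<in> U0) \<longrightarrow>
      ((\<lambda>y. f (trunc r y)) has_derivative (\<lambda>h. f' x (trunc r h))) (at x)"
    "lin_comb (Suc s) (\<lambda>q. A (trunc r q)) (\<lambda>q. join s (f (trunc r q)) (f' (trunc r q) (shift r q)))"
    by blast
  from add.IH obtain g' where g': "\<forall>x\<in>model r. A x \<in> U0 \<and> (\<exists>\<delta>>0. \<forall>y\<in>model r. norm (y - x) < \<delta> \<longrightarrow> A y \<in> U0) \<longrightarrow>
      ((\<lambda>y. g (trunc r y)) has_derivative (\<lambda>h. g' x (trunc r h))) (at x)"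
    "lin_comb (Suc s) (\<lambda>q. A (trunc r q)) (\<lambda>q. join s (g (trunc r q)) (g' (trunc r q) (shift r q)))"
    by blast
  have "lin_comb (Suc s) (\<lambda>q. A (trunc r q))
     (\<lambda>q. join s (f (trunc r q) + g (trunc r q)) (f' (trunc r q) (shift r q) + g' (trunc r q) (shift r q)))"
    using lin_comb.add[OF f'(2) g'(2)] by (simp add: join_add)
  then show ?case
  proof (intro exI[of _ "\<lambda>x h. f' x h + g' x h"] conjI ballI impI)
    fix x assume "x \<in> model r"
      and "A x \<in> U0 \<and> (\<exists>\<delta>>0. \<forall>y\<in>model r. norm (y - x) < \<delta> \<longrightarrow> A y \<in> U0)"
    then show "((\<lambda>y. f (trunc r y) + g (trunc r y)) has_derivative
        (\<lambda>h. f' x (trunc r h) + g' x (trunc r h))) (at x)"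
      using f'(1) g'(1) by (intro has_derivative_add) blast+
  qed
qed

lemma lin_comb_tsmooth:
  fixes A :: "('e::real_normed_vector) coord \<Rightarrow> 'a"
  assumes "lin_comb s A f" "bounded_linear A" "\<And>h. A h \<in> E"
    and "mopen r U" "\<And>x. x \<in> U \<Longrightarrow> A x \<in> U0"
  shows "tsmooth r s U f"
proof -
  \<comment> \<open>The substitution A belongs to the invariant, because each application of the
    tangent functor replaces it by its composition with \<open>trunc r\<close>.\<close>
  define P where "P = (\<lambda>r s U (g :: 'e coord \<Rightarrow> 'e coord). \<exists>A f. lin_comb s A f \<and> bounded_linear A \<and>
    (\<forall>h. A h \<in> E) \<and> mopen r U \<and> (\<forall>x\<in>U. A x \<in> U0 \<and> g x = f x))"
  have "P r s U f"
    unfolding P_def using assms by blast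
  then show ?thesis
  proof (rule tsmooth_coinduct)
    fix r s U g
    assume step: "P r s U g"
    then obtain A f where *: "lin_comb s A f" "bounded_linear A" "\<And>h. A h \<in> E" "mopen r U"
      "\<And>x. x \<in> U \<Longrightarrow> A x \<in> U0" "\<And>x. x \<in> U \<Longrightarrow> g x = f x"
      unfolding P_def by blast
    obtain f' where f': "\<And>x. x \<in> model r \<Longrightarrow> A x \<in> U0 \<Longrightarrow>
        \<exists>\<delta>>0. \<forall>y\<in>model r. norm (y - x) < \<delta> \<longrightarrow> A y \<in> U0 \<Longrightarrow>
        ((\<lambda>y. f (trunc r y)) has_derivative (\<lambda>h. f' x (trunc r h))) (at x)"
      "lin_comb (Suc s) (\<lambda>q. A (trunc r q)) (\<lambda>q. join s (f (trunc r q)) (f' (trunc r q) (shift r q)))"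
      using lin_comb_has_derivative[OF *(1-3)] by blast
    have der: "((\<lambda>y. g (trunc r y)) has_derivative (\<lambda>h. f' x (trunc r h))) (at x)" if x: "x \<in> U" for x
    proof (rule mopen_transform[OF *(4) x *(6)])
      have "x \<in> model r"
        using x *(4) by (auto simp: mopen_def)
      have "open {y. trunc r y \<in> U}" "x \<in> {y. trunc r y \<in> U}"
        using *(4) x \<open>x \<in> model r\<close> by (auto simp: mopen_def)
      then obtain \<delta> where "\<delta> > 0" "ball x \<delta> \<subseteq> {y. trunc r y \<in> U}"
        using open_contains_ball by blast
      then have "\<forall>y\<in>model r. norm (y - x) < \<delta> \<longrightarrow> A y \<in> U0"
        by (metis *(5) dist_commute dist_norm mem_Collect_eq mem_ball subsetD trunc_id)
      then show "((\<lambda>y. f (trunc r y)) has_derivative (\<lambda>h. f' x (trunc r h))) (at x)"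
        using \<open>\<delta> > 0\<close> by (intro f'(1) \<open>x \<in> model r\<close> *(5) x) blast
    qed
    have "tan_map r s g q = join s (f (trunc r q)) (f' (trunc r q) (shift r q))"
      if "q \<in> tan_dom r U" for q
      using that dd_eqI[OF der] *(6) by (simp add: tan_map_def tan_dom_def)
    then have "P (Suc r) (Suc s) (tan_dom r U) (tan_map r s g)"
      unfolding P_def using f'(2) bounded_linear_compose[OF *(2) bounded_linear_trunc] *(3,5) mopen_tan_dom[OF *(4)]
      by (intro exI conjI) (auto simp: tan_dom_def)
    moreover have "\<forall>x\<in>U. g x \<in> model s"
      using *(6) lin_comb_in_model[OF *(1)] by simp
    moreover have "\<forall>x\<in>U. tdiff r g x"
      using tdiffI[OF der] by blast
    ultimately show "mopen r U \<and> (\<forall>x\<in>U. g x \<in> model s) \<and> (\<forall>x\<in>U. tdiff r g x) \<and>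
      P (Suc r) (Suc s) (tan_dom r U) (tan_map r s g)"
      using *(4) by blast
  qed
qed

end

text \<open>The linear maps A and B cover both uses: coordinate changes of M, with evaluation at
  coordinate 0 and \<open>embed\<close>, and the semispray in a chart, with two truncations.\<close>

lemma smooth_on_imp_tsmooth:
  fixes A :: "('e::real_normed_vector) coord \<Rightarrow> 'a::real_normed_vector"
  assumes "smooth_on E U0 f" "subspace E" "bounded_linear A" "\<And>h. A h \<in> E"
    and "bounded_linear B" "\<And>y. B y \<in> model s"
    and "mopen r U" "\<And>x. x \<in> U \<Longrightarrow> A x \<in> U0"
  shows "tsmooth r s U (\<lambda>q. B (f (A q)))"
proof -
  obtain d where d0: "\<And>x. x \<in> U0 \<Longrightarrow> d 0 x [] = f x"
    and ml: "\<And>k x. x \<in> U0 \<Longrightarrow> bounded_multilinear_on E k (d k x)"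
    and dv: "\<And>k x e. x \<in> U0 \<Longrightarrow> e > 0 \<Longrightarrow> \<exists>\<delta>>0. \<forall>y\<in>U0. norm (y - x) < \<delta> \<longrightarrow>
          (\<forall>vs. length vs = k \<and> set vs \<subseteq> E \<longrightarrow>
            norm (d k y vs - d k x vs - d (Suc k) x ((y - x) # vs))
              \<le> e * norm (y - x) * (\<Prod>v\<leftarrow>vs. norm v))"
    using assms(1) unfolding smooth_on_def by metis
  have "lin_comb E d s A (\<lambda>q. B (d 0 (A q) (map (\<lambda>a. a q) [])))"
    by (intro lin_comb.single[OF assms(2) ml dv]) (use assms in auto)
  then have "tsmooth r s U (\<lambda>q. B (d 0 (A q) []))"
    using lin_comb_tsmooth[OF assms(2) ml dv, where A = A and s = s and r = r and U = U] assms by simp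
  then show ?thesis
    using assms d0 by (elim tsmooth_cong) auto
qed

section \<open>Second derivatives\<close>

lemma norm_diff_le_vector_derivative:
  fixes g :: "real \<Rightarrow> 'a::real_normed_vector"
  assumes "\<And>\<sigma>. \<sigma> \<in> {a..b} \<Longrightarrow> (g has_vector_derivative g' \<sigma>) (at \<sigma> within {a..b})"
    and "\<And>\<sigma>. \<sigma> \<in> {a..b} \<Longrightarrow> norm (g' \<sigma>) \<le> B" and "s \<in> {a..b}" "t \<in> {a..b}"
  shows "norm (g t - g s) \<le> B * \<bar>t - s\<bar>"
proof -
  have "norm (g t - g s) \<le> B * norm (t - s)"
  proof (rule differentiable_bound[where S = "{a..b}" and f' = "\<lambda>\<sigma> h. h *\<^sub>R g' \<sigma>"])
    show "(g has_derivative (\<lambda>h. h *\<^sub>R g' \<sigma>)) (at \<sigma> within {a..b})" if "\<sigma> \<in> {a..b}" for \<sigma>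
      using assms(1)[OF that] by (simp add: has_vector_derivative_def)
    show "onorm (\<lambda>h. h *\<^sub>R g' \<sigma>) \<le> B" if "\<sigma> \<in> {a..b}" for \<sigma>
    proof (rule onorm_le)
      show "norm (h *\<^sub>R g' \<sigma>) \<le> B * norm h" for h :: real
        using mult_right_mono[OF assms(2)[OF that], of "\<bar>h\<bar>"] by (simp add: mult.commute)
    qed
  qed (use assms in auto)
  then show ?thesis by simp
qed

text \<open>Two applications of first order information: the mean value inequality in direction u,
  and differentiability of the u-derivative at the single point x.\<close>

lemma second_difference_bound:
  fixes f :: "'a::real_normed_vector \<Rightarrow> 'b::real_normed_vector"
  assumes "open U" "x \<in> U" "\<And>y. y \<in> U \<Longrightarrow> (f has_derivative f' y) (at y)"
    and G: "((\<lambda>y. f' y u) has_derivative G) (at x)" and "e > 0"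
  shows "\<exists>\<delta>>0. \<forall>t. 0 < t \<and> t < \<delta> \<longrightarrow>
    norm (f (x + t *\<^sub>R u + t *\<^sub>R v) - f (x + t *\<^sub>R u) - f (x + t *\<^sub>R v) + f x - (t * t) *\<^sub>R G v) \<le> e * (t * t)"
proof -
  \<comment> \<open>Increments \<sigma> u + \<tau> v with coefficients in [0, t] have norm at most t
    * K; the 1 makes K positive even for u = v = 0.\<close>
  define K where "K = norm u + norm v + 1"
  have K: "K > 0"
    by (simp add: K_def add_nonneg_pos)
  then have "e / (2 * K) > 0"
    using assms by simp
  then obtain \<delta>0 where \<delta>0: "\<delta>0 > 0" "\<And>y. norm (y - x) < \<delta>0 \<Longrightarrow>
      norm (f' y u - f' x u - G (y - x)) \<le> e / (2 * K) * norm (y - x)"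
    using G unfolding has_derivative_at_alt by blast
  obtain \<delta>1 where \<delta>1: "\<delta>1 > 0" "ball x \<delta>1 \<subseteq> U"
    using assms(1,2) open_contains_ball by blast
  have Gl: "linear G"
    using G has_derivative_linear by blast
  have "norm (f (x + t *\<^sub>R u + t *\<^sub>R v) - f (x + t *\<^sub>R u) - f (x + t *\<^sub>R v) + f x - (t * t) *\<^sub>R G v) \<le> e * (t * t)"
    if t: "0 < t" "t < min \<delta>0 \<delta>1 / K" for t
  proof -
    have tK: "t * K < \<delta>0" "t * K < \<delta>1"
      using t K by (auto simp: pos_less_divide_eq)
    have small: "norm (\<sigma> *\<^sub>R u + \<tau> *\<^sub>R v) \<le> t * K" if "0 \<le> \<sigma>" "\<sigma> \<le> t" "0 \<le> \<tau>" "\<tau> \<le> t" for \<sigma> \<tau>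
    proof -
      have "norm (\<sigma> *\<^sub>R u + \<tau> *\<^sub>R v) \<le> \<sigma> * norm u + \<tau> * norm v"
        using that norm_triangle_ineq[of "\<sigma> *\<^sub>R u" "\<tau> *\<^sub>R v"] by simp
      also have "\<dots> \<le> t * norm u + t * norm v"
        using that by (intro add_mono mult_right_mono) auto
      also have "\<dots> \<le> t * K"
        using t by (simp add: K_def algebra_simps)
      finally show ?thesis .
    qed
    have mem: "x + (\<sigma> *\<^sub>R u + \<tau> *\<^sub>R v) \<in> U" if "0 \<le> \<sigma>" "\<sigma> \<le> t" "0 \<le> \<tau>" "\<tau> \<le> t" for \<sigma> \<tau>
    proof -
      have "dist x (x + (\<sigma> *\<^sub>R u + \<tau> *\<^sub>R v)) < \<delta>1"
        using small[OF that] tK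
        by (metis add_diff_cancel_left' dist_commute dist_norm le_less_trans)
      then show ?thesis
        using \<delta>1(2) by auto
    qed
    have est: "norm (f' (x + (\<sigma> *\<^sub>R u + \<tau> *\<^sub>R v)) u - f' x u - G (\<sigma> *\<^sub>R u + \<tau> *\<^sub>R v)) \<le> e / 2 * t"
      if "0 \<le> \<sigma>" "\<sigma> \<le> t" "0 \<le> \<tau>" "\<tau> \<le> t" for \<sigma> \<tau>
    proof -
      have "norm (f' (x + (\<sigma> *\<^sub>R u + \<tau> *\<^sub>R v)) u - f' x u - G (\<sigma> *\<^sub>R u + \<tau> *\<^sub>R v))
          \<le> e / (2 * K) * norm (\<sigma> *\<^sub>R u + \<tau> *\<^sub>R v)"
        using \<delta>0(2)[of "x + (\<sigma> *\<^sub>R u + \<tau> *\<^sub>R v)"] small[OF that] tK by simp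
      also have "\<dots> \<le> e / (2 * K) * (t * K)"
        using small[OF that] assms(5) K by (intro mult_left_mono) auto
      finally show ?thesis
        using K by simp
    qed
    \<comment> \<open>\<open>?g t - ?g 0\<close> is the second difference minus its expected value,
      and the derivative of \<open>?g\<close> is a difference of two values of the u-derivative,
      controlled by \<open>est\<close>.\<close>
    let ?g = "\<lambda>\<sigma>. f (x + (\<sigma> *\<^sub>R u + t *\<^sub>R v)) - f (x + (\<sigma> *\<^sub>R u + 0 *\<^sub>R v)) - \<sigma> *\<^sub>R (t *\<^sub>R G v)"
    let ?g' = "\<lambda>\<sigma>. f' (x + (\<sigma> *\<^sub>R u + t *\<^sub>R v)) u - f' (x + (\<sigma> *\<^sub>R u + 0 *\<^sub>R v)) u - t *\<^sub>R G v"
    have der: "((\<lambda>\<sigma>. f (x + (\<sigma> *\<^sub>R u + \<tau> *\<^sub>R v))) has_vector_derivative f' (x + (\<sigma> *\<^sub>R u + \<tau> *\<^sub>R v)) u) (at \<sigma> within {0..t})"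
      if "0 \<le> \<sigma>" "\<sigma> \<le> t" "0 \<le> \<tau>" "\<tau> \<le> t" for \<sigma> \<tau>
    proof -
      have "((\<lambda>\<sigma>. x + (\<sigma> *\<^sub>R u + \<tau> *\<^sub>R v)) has_derivative (\<lambda>h. h *\<^sub>R u)) (at \<sigma> within {0..t})"
        by (auto intro!: derivative_eq_intros)
      from has_derivative_compose[OF this assms(3)[OF mem[OF that]]]
      have "((\<lambda>\<sigma>. f (x + (\<sigma> *\<^sub>R u + \<tau> *\<^sub>R v))) has_derivative
          (\<lambda>h. f' (x + (\<sigma> *\<^sub>R u + \<tau> *\<^sub>R v)) (h *\<^sub>R u))) (at \<sigma> within {0..t})" .
      moreover have "linear (f' (x + (\<sigma> *\<^sub>R u + \<tau> *\<^sub>R v)))"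
        using assms(3)[OF mem[OF that]] has_derivative_linear by blast
      ultimately show ?thesis
        by (simp add: has_vector_derivative_def linear_scale)
    qed
    have "norm (?g t - ?g 0) \<le> (e * t) * \<bar>t - 0\<bar>"
    proof (rule norm_diff_le_vector_derivative[where a = 0 and b = t and g' = ?g'])
      fix \<sigma> assume \<sigma>: "\<sigma> \<in> {0..t}"
      show "(?g has_vector_derivative ?g' \<sigma>) (at \<sigma> within {0..t})"
      proof -
        have "((\<lambda>\<sigma>. \<sigma> *\<^sub>R (t *\<^sub>R G v)) has_vector_derivative t *\<^sub>R G v) (at \<sigma> within {0..t})"
          by (auto intro!: derivative_eq_intros)
        then show ?thesis
          using \<sigma> t by (intro has_vector_derivative_diff der) auto
      qed
      have "?g' \<sigma> = (f' (x + (\<sigma> *\<^sub>R u + t *\<^sub>R v)) u - f' x u - G (\<sigma> *\<^sub>R u + t *\<^sub>R v)) -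
          (f' (x + (\<sigma> *\<^sub>R u + 0 *\<^sub>R v)) u - f' x u - G (\<sigma> *\<^sub>R u + 0 *\<^sub>R v))"
        by (simp add: linear_add[OF Gl] linear_scale[OF Gl])
      also have "norm \<dots> \<le> e / 2 * t + e / 2 * t"
        using \<sigma> t by (intro order_trans[OF norm_triangle_ineq4 add_mono] est) auto
      finally show "norm (?g' \<sigma>) \<le> e * t"
        by simp
    qed (use t in auto)
    moreover have "?g t - ?g 0 = f (x + t *\<^sub>R u + t *\<^sub>R v) - f (x + t *\<^sub>R u) - f (x + t *\<^sub>R v) + f x - (t * t) *\<^sub>R G v"
      by (simp add: algebra_simps)
    ultimately show ?thesis
      using t by (simp only: abs_of_pos diff_zero mult.assoc)
  qed
  moreover have "min \<delta>0 \<delta>1 / K > 0"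
    using \<delta>0 \<delta>1 K by simp
  ultimately show ?thesis by blast
qed

text \<open>The second difference is symmetric in u and v, and both G v and H u are its limits after
  division by t * t.\<close>

lemma second_derivative_symmetric:
  fixes f :: "'a::real_normed_vector \<Rightarrow> 'b::real_normed_vector"
  assumes "open U" "x \<in> U" "\<And>y. y \<in> U \<Longrightarrow> (f has_derivative f' y) (at y)"
    and "((\<lambda>y. f' y u) has_derivative G) (at x)" "((\<lambda>y. f' y v) has_derivative H) (at x)"
  shows "G v = H u"
proof (rule ccontr)
  assume "G v \<noteq> H u"
  \<comment> \<open>The two estimates allow a distance of at most 2 e, whereas it is 3 e.\<close>
  define e where "e = norm (G v - H u) / 3"
  have e: "e > 0"
    using \<open>G v \<noteq> H u\<close> by (simp add: e_def)
  obtain \<delta>1 where \<delta>1: "\<delta>1 > 0" "\<And>t. 0 < t \<Longrightarrow> t < \<delta>1 \<Longrightarrow>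
      norm (f (x + t *\<^sub>R u + t *\<^sub>R v) - f (x + t *\<^sub>R u) - f (x + t *\<^sub>R v) + f x - (t * t) *\<^sub>R G v) \<le> e * (t * t)"
    using second_difference_bound[OF assms(1-4) e, of v] by blast
  obtain \<delta>2 where \<delta>2: "\<delta>2 > 0" "\<And>t. 0 < t \<Longrightarrow> t < \<delta>2 \<Longrightarrow>
      norm (f (x + t *\<^sub>R v + t *\<^sub>R u) - f (x + t *\<^sub>R v) - f (x + t *\<^sub>R u) + f x - (t * t) *\<^sub>R H u) \<le> e * (t * t)"
    using second_difference_bound[OF assms(1-3,5) e, of u] by blast
  define t where "t = min \<delta>1 \<delta>2 / 2"
  have t: "0 < t" "t < \<delta>1" "t < \<delta>2"
    using \<delta>1 \<delta>2 by (auto simp: t_def)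
  define A where "A = f (x + t *\<^sub>R u + t *\<^sub>R v) - f (x + t *\<^sub>R u) - f (x + t *\<^sub>R v) + f x"
  have A: "f (x + t *\<^sub>R v + t *\<^sub>R u) - f (x + t *\<^sub>R v) - f (x + t *\<^sub>R u) + f x = A"
    by (simp add: A_def algebra_simps)
  have "(t * t) * norm (G v - H u) = norm ((t * t) *\<^sub>R (G v - H u))"
    by simp
  also have "(t * t) *\<^sub>R (G v - H u) = (A - (t * t) *\<^sub>R H u) - (A - (t * t) *\<^sub>R G v)"
    by (simp add: algebra_simps)
  also have "norm \<dots> \<le> e * (t * t) + e * (t * t)"
    using \<delta>1(2)[OF t(1,2)] \<delta>2(2)[OF t(1,3)] unfolding A A_def[symmetric]
    by (intro order_trans[OF norm_triangle_ineq4 add_mono])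
  finally have "(t * t) * norm (G v - H u) \<le> (t * t) * (2 * e)"
    by (simp add: algebra_simps)
  moreover have "t * t > 0"
    using t by simp
  ultimately have "norm (G v - H u) \<le> 2 * e"
    by (rule mult_left_le_imp_le)
  then show False
    using e by (simp add: e_def)
qed

text \<open>Differentiability at points of the ambient space off the model: the mean value
  inequality on balls and the symmetry of second derivatives are applied there.\<close>

lemma has_derivative_off_model:
  assumes "tdiff r f (trunc r y)"
  shows "((\<lambda>y. f (trunc r y)) has_derivative (\<lambda>h. dd r f (trunc r y) (trunc r h))) (at y)"
proof -
  have "(trunc r has_derivative trunc r) (at y)"
    by (rule bounded_linear_imp_has_derivative[OF bounded_linear_trunc])
  from has_derivative_compose[OF this tdiffD[OF assms]] show ?thesis
    by simp
qed

lemma mopen_ball: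
  assumes "mopen r U" "x \<in> U"
  obtains \<delta> where "\<delta> > 0" "\<And>y. norm (y - x) < \<delta> \<Longrightarrow> trunc r y \<in> U"
proof -
  have "open {y. trunc r y \<in> U}" "x \<in> {y. trunc r y \<in> U}"
    using assms by (auto simp: mopen_def)
  then obtain \<delta> where "\<delta> > 0" "ball x \<delta> \<subseteq> {y. trunc r y \<in> U}"
    using open_contains_ball by blast
  then show ?thesis
    using that[of \<delta>] by (auto simp: dist_norm norm_minus_commute subset_iff)
qed

text \<open>The derivative of (x, y) |-> (f x, Df(x) y) in direction (X, Y) is (Df(x) X, D2f(x)(X,
  y) + Df(x) Y). The second derivative appears here as the \<open>shift s\<close> part of the
  derivative in direction (X, 0).\<close>

lemma dd_tan_map:
  assumes f: "tsmooth r s U f" and x: "x \<in> U" and y: "y \<in> model r"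
  shows dd_tan_map_join: "X \<in> model r \<Longrightarrow> Y \<in> model r \<Longrightarrow>
      dd (Suc r) (tan_map r s f) (join r x y) (join r X Y) = join s (dd r f x X)
        (shift s (dd (Suc r) (tan_map r s f) (join r x y) (join r X 0)) + dd r f x Y)"
    and has_derivative_dd: "((\<lambda>z. dd r f (trunc r z) y) has_derivative
      (\<lambda>h. shift s (dd (Suc r) (tan_map r s f) (join r x y) (join r h 0)))) (at x)"
proof -
  let ?F = "tan_map r s f" and ?p = "join r x y"
  note f' = tsmooth_cases[OF f] and F = tsmooth_cases[OF tsmooth_cases(4)[OF f]]
  have xm: "x \<in> model r"
    using f x by (rule tsmooth_mem)
  have p: "?p \<in> tan_dom r U"
    using x y xm by (simp add: tan_dom_def)
  have tr: "trunc (Suc r) ?p = ?p"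
    using y by simp
  have ddm: "dd r f z v \<in> model s" if "z \<in> U" for z v
    by (rule dd_in_model[OF f'(1) that f'(2) f'(3)[OF that]])
  have Fd: "((\<lambda>q. ?F (trunc (Suc r) q)) has_derivative dd (Suc r) ?F ?p) (at ?p)"
    by (rule tdiffD[OF F(3)[OF p]])
  have lin: "linear (dd (Suc r) ?F ?p)"
    using Fd has_derivative_linear by blast
  \<comment> \<open>Moving the base point with y fixed gives the second derivative.\<close>
  have "((\<lambda>z. join r z y) has_derivative (\<lambda>h. join r h 0)) (at x)"
    by (auto intro!: derivative_eq_intros)
  from has_derivative_compose[OF this Fd]
  have "((\<lambda>z. shift s (?F (trunc (Suc r) (join r z y)))) has_derivative
      (\<lambda>h. shift s (dd (Suc r) ?F ?p (join r h 0)))) (at x)"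
    by (rule has_derivative_shift)
  moreover have "open {z. trunc r z \<in> U}" "x \<in> {z. trunc r z \<in> U}"
    using f'(1) x xm by (auto simp: mopen_def)
  moreover have "shift s (?F (trunc (Suc r) (join r z y))) = dd r f (trunc r z) y"
    if "z \<in> {z. trunc r z \<in> U}" for z
    using that ddm y by (simp add: tan_map_def)
  ultimately show "((\<lambda>z. dd r f (trunc r z) y) has_derivative
      (\<lambda>h. shift s (dd (Suc r) ?F ?p (join r h 0)))) (at x)"
    by (rule has_derivative_transform_within_open)
  assume X: "X \<in> model r" and Y: "Y \<in> model r"
  \<comment> \<open>Moving y with the base point fixed: Df(x) is linear and hence its own
    derivative.\<close>
  have "((\<lambda>z. join r x z) has_derivative (\<lambda>h. join r 0 h)) (at y)"
    by (auto intro!: derivative_eq_intros)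
  from has_derivative_compose[OF this Fd]
  have "((\<lambda>z. shift s (?F (trunc (Suc r) (join r x z)))) has_derivative
      (\<lambda>h. shift s (dd (Suc r) ?F ?p (join r 0 h)))) (at y)"
    by (rule has_derivative_shift)
  moreover have "shift s (?F (trunc (Suc r) (join r x z))) = dd r f x z" for z
    using ddm[OF x] xm dd_trunc[OF f'(3)[OF x] xm] by (simp add: tan_map_def)
  ultimately have "(dd r f x has_derivative (\<lambda>h. shift s (dd (Suc r) ?F ?p (join r 0 h)))) (at y)"
    by simp
  moreover have "(dd r f x has_derivative dd r f x) (at y)"
    by (rule bounded_linear_imp_has_derivative[OF dd_linear[OF f'(3)[OF x]]])
  ultimately have 1: "shift s (dd (Suc r) ?F ?p (join r 0 Y)) = dd r f x Y"
    by (metis has_derivative_unique)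
  \<comment> \<open>The first component of the tangent map depends on the base point alone.\<close>
  have "((\<lambda>q. trunc s (?F (trunc (Suc r) q))) has_derivative (\<lambda>h. trunc s (dd (Suc r) ?F ?p h))) (at ?p)"
    by (rule has_derivative_trunc[OF Fd])
  moreover have "((\<lambda>q. trunc s (f (trunc r (trunc r q)))) has_derivative
      (\<lambda>h. trunc s (dd r f x (trunc r h)))) (at ?p)"
  proof (rule has_derivative_trunc)
    have "(trunc r has_derivative trunc r) (at ?p)"
      by (rule bounded_linear_imp_has_derivative[OF bounded_linear_trunc])
    moreover have "((\<lambda>y. f (trunc r y)) has_derivative dd r f x) (at (trunc r ?p))"
      using tdiffD[OF f'(3)[OF x]] xm by simp
    ultimately show "((\<lambda>q. f (trunc r (trunc r q))) has_derivative (\<lambda>h. dd r f x (trunc r h))) (at ?p)"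
      by (rule has_derivative_compose)
  qed
  moreover have "trunc s (?F (trunc (Suc r) q)) = trunc s (f (trunc r (trunc r q)))" for q
    by (simp add: tan_map_def)
  ultimately have "(\<lambda>h. trunc s (dd (Suc r) ?F ?p h)) = (\<lambda>h. trunc s (dd r f x (trunc r h)))"
    by (simp add: has_derivative_unique)
  then have 2: "trunc s (dd (Suc r) ?F ?p (join r X Y)) = dd r f x X"
    using ddm[OF x] X by (metis trunc_id trunc_join)
  have "join r X Y = join r X 0 + join r 0 Y"
    by (metis add.left_neutral add.right_neutral join_add)
  then have "dd (Suc r) ?F ?p (join r X Y) = dd (Suc r) ?F ?p (join r X 0) + dd (Suc r) ?F ?p (join r 0 Y)"
    by (simp add: linear_add[OF lin])
  then have 3: "shift s (dd (Suc r) ?F ?p (join r X Y)) =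
      shift s (dd (Suc r) ?F ?p (join r X 0)) + dd r f x Y"
    by (simp add: 1 linear_add bounded_linear.linear bounded_linear_shift)
  have "dd (Suc r) ?F ?p (join r X Y) \<in> model (Suc s)"
    by (rule dd_in_model[OF F(1) p F(2) F(3)[OF p]])
  then show "dd (Suc r) ?F ?p (join r X Y) = join s (dd r f x X)
      (shift s (dd (Suc r) ?F ?p (join r X 0)) + dd r f x Y)"
    using 2 3 join_trunc_shift[of s "dd (Suc r) ?F ?p (join r X Y)"] by simp
qed

text \<open>Naturality of the canonical involution: T T f sends (x, y, X, Y) to (f x, Df y, Df X,
  D2f(X, y) + Df Y), so exchanging y with X amounts to the symmetry of the second
  derivative.\<close>

lemma tan_map_flip:
  assumes f: "tsmooth r s U f" and q: "q \<in> tan_dom (Suc r) (tan_dom r U)"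
  shows "tan_map (Suc r) (Suc s) (tan_map r s f) (flip r q) =
    flip s (tan_map (Suc r) (Suc s) (tan_map r s f) q)"
proof -
  let ?F = "tan_map r s f"
  have "q \<in> model (Suc (Suc r))"
    using q by (simp add: tan_dom_def)
  then obtain x y X Y where m: "x \<in> model r" "y \<in> model r" "X \<in> model r" "Y \<in> model r"
    and qq: "q = join (Suc r) (join r x y) (join r X Y)"
    by (rule model_Suc_Suc_cases)
  have x: "x \<in> U"
  proof -
    have "trunc (Suc r) q \<in> tan_dom r U"
      using q by (simp add: tan_dom_def)
    then have "trunc r (join r x y) \<in> U"
      using m by (simp add: tan_dom_def qq)
    then show ?thesis
      using m by simp
  qed
  note f' = tsmooth_cases[OF f]
  have ddm: "dd r f z v \<in> model s" if "z \<in> U" for z v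
    by (rule dd_in_model[OF f'(1) that f'(2) f'(3)[OF that]])
  let ?G = "\<lambda>y X. shift s (dd (Suc r) ?F (join r x y) (join r X 0))"
  have eq: "tan_map (Suc r) (Suc s) ?F (join (Suc r) (join r x y) (join r X Y)) =
      join (Suc s) (join s (f x) (dd r f x y)) (join s (dd r f x X) (?G y X + dd r f x Y))"
    if "y \<in> model r" "X \<in> model r" for y X
  proof -
    have "tan_map (Suc r) (Suc s) ?F (join (Suc r) (join r x y) (join r X Y)) =
        join (Suc s) (?F (join r x y)) (dd (Suc r) ?F (join r x y) (join r X Y))"
      using that m by (intro tan_map_join join_in_model)
    also have "?F (join r x y) = join s (f x) (dd r f x y)"
      using that m by (intro tan_map_join)
    also have "dd (Suc r) ?F (join r x y) (join r X Y) = join s (dd r f x X) (?G y X + dd r f x Y)"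
      using that m by (intro dd_tan_map_join[OF f x])
    finally show ?thesis .
  qed
  \<comment> \<open>Once the components are written out, the two sides can differ only in the last
    one, by exactly these terms.\<close>
  have "?G y X = ?G X y"
  proof (rule second_derivative_symmetric[where G = "?G y" and H = "?G X" and u = y and v = X
        and f = "\<lambda>y. f (trunc r y)" and f' = "\<lambda>z h. dd r f (trunc r z) (trunc r h)"])
    show "open {y. trunc r y \<in> U}" "x \<in> {y. trunc r y \<in> U}"
      using f'(1) x m by (auto simp: mopen_def)
    show "((\<lambda>y. f (trunc r y)) has_derivative (\<lambda>h. dd r f (trunc r y) (trunc r h))) (at y)"
      if "y \<in> {y. trunc r y \<in> U}" for y
      using that f'(3) by (intro has_derivative_off_model) simp
    show "((\<lambda>z. dd r f (trunc r z) (trunc r y)) has_derivative ?G y) (at x)"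
      "((\<lambda>z. dd r f (trunc r z) (trunc r X)) has_derivative ?G X) (at x)"
      using has_derivative_dd[OF f x] m by simp_all
  qed
  moreover have "?G y X \<in> model s" for y X
    by simp
  ultimately show ?thesis
    using m ddm[OF x] by (simp add: qq eq)
qed

section \<open>Local bounds\<close>

lemma norm_join_le: "norm (join r x y) \<le> max (norm x) (norm y)"
proof (rule norm_bound)
  show "norm (apply_bcontfun (join r x y) k) \<le> max (norm x) (norm y)" for k
    using norm_apply_le[of x k] norm_apply_le[of y "k - 2 ^ r"] by (auto simp: apply_join)
qed

lemma diff_join: "join r x y - join r x' y' = join r (x - x') (y - y')"
  by (rule bcontfun_eqI) (simp add: apply_join minus_bcontfun.rep_eq)

text \<open>Continuity of (y, v) |-> Df(y) v at (x, 0) bounds Df(y) v by 1 for small v and y near x;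
  linearity in v turns this into an operator bound uniform in y.\<close>

lemma tsmooth_dd_bound:
  assumes f: "tsmooth r s U f" and x: "x \<in> U"
  shows "\<exists>\<delta>>0. \<exists>L\<ge>0. \<forall>y\<in>model r. norm (y - x) < \<delta> \<longrightarrow>
    y \<in> U \<and> (\<forall>v\<in>model r. norm (dd r f y v) \<le> L * norm v)"
proof -
  let ?F = "tan_map r s f" and ?p = "join r x 0"
  note f' = tsmooth_cases[OF f] and F = tsmooth_cases[OF tsmooth_cases(4)[OF f]]
  have xm: "x \<in> model r"
    using f x by (rule tsmooth_mem)
  obtain \<delta>0 where \<delta>0: "\<delta>0 > 0" "\<And>y. norm (y - x) < \<delta>0 \<Longrightarrow> trunc r y \<in> U"
    using mopen_ball[OF f'(1) x] by blast
  have ddm: "dd r f z v \<in> model s" if "z \<in> U" for z v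
    by (rule dd_in_model[OF f'(1) that f'(2) f'(3)[OF that]])
  have p: "?p \<in> tan_dom r U"
    using x xm by (simp add: tan_dom_def)
  have "((\<lambda>q. shift s (?F (trunc (Suc r) q))) has_derivative (\<lambda>h. shift s (dd (Suc r) ?F ?p h))) (at ?p)"
    by (intro derivative_intros tdiffD F(3) p)
  then have "isCont (\<lambda>q. shift s (?F (trunc (Suc r) q))) ?p"
    by (rule has_derivative_continuous)
  moreover have eq: "shift s (?F (trunc (Suc r) (join r y v))) = dd r f y v"
    if "y \<in> U" "y \<in> model r" "v \<in> model r" for y v
    using that ddm by (simp add: tan_map_def)
  moreover have "dd r f x 0 = 0"
    by (simp add: linear_0 bounded_linear.linear dd_linear f'(3) x)
  ultimately obtain \<delta>1 where \<delta>1: "\<delta>1 > 0"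
    "\<And>q. norm (q - ?p) < \<delta>1 \<Longrightarrow> norm (shift s (?F (trunc (Suc r) q))) < 1"
    using x xm unfolding continuous_at_eps_delta dist_norm
    by (metis diff_zero zero_in_model zero_less_one)
  have "y \<in> U \<and> (\<forall>v\<in>model r. norm (dd r f y v) \<le> 2 / \<delta>1 * norm v)"
    if y: "y \<in> model r" "norm (y - x) < min \<delta>0 \<delta>1" for y
  proof (intro conjI ballI)
    show yU: "y \<in> U"
      using \<delta>0(2)[of y] y by simp
    fix v :: "'a coord" assume v: "v \<in> model r"
    have lin: "linear (dd r f y)"
      by (simp add: bounded_linear.linear dd_linear f'(3) yU)
    show "norm (dd r f y v) \<le> 2 / \<delta>1 * norm v"
    proof (cases "v = 0")
      case True
      then show ?thesis by (simp add: linear_0[OF lin])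
    next
      case False
      \<comment> \<open>Rescales v to norm \<delta>1 / 2, inside the radius of continuity.\<close>
      let ?c = "\<delta>1 / 2 / norm v"
      have c: "?c > 0"
        using \<delta>1 False by simp
      have "norm (join r y (?c *\<^sub>R v) - ?p) < \<delta>1"
        unfolding diff_join using y \<delta>1 False
        by (intro le_less_trans[OF norm_join_le]) simp
      from \<delta>1(2)[OF this] have "norm (dd r f y (?c *\<^sub>R v)) < 1"
        using eq[OF yU y(1)] v by simp
      then have "?c * norm (dd r f y v) < 1"
        using c by (simp only: linear_scale[OF lin] norm_scaleR abs_of_pos)
      then show ?thesis
        using False \<delta>1(1) by (simp add: field_simps)
    qed
  qed
  moreover have "min \<delta>0 \<delta>1 > 0" "2 / \<delta>1 \<ge> 0"
    using \<delta>0 \<delta>1 by auto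
  ultimately show ?thesis by blast
qed

text \<open>The mean value inequality for f o trunc on a ball of the ambient space: the ball is
  convex, and truncation does not increase the distance to x.\<close>

lemma tsmooth_lipschitz:
  assumes f: "tsmooth r s U f" and x: "x \<in> U"
  shows "\<exists>\<delta>>0. \<exists>L\<ge>0. \<forall>y\<in>model r. \<forall>z\<in>model r. norm (y - x) < \<delta> \<longrightarrow> norm (z - x) < \<delta> \<longrightarrow>
    y \<in> U \<and> z \<in> U \<and> norm (f y - f z) \<le> L * norm (y - z)"
proof -
  note f' = tsmooth_cases[OF f]
  have xm: "x \<in> model r"
    using f x by (rule tsmooth_mem)
  obtain \<delta> L where \<delta>: "\<delta> > 0" "L \<ge> 0" and *: "\<And>y. y \<in> model r \<Longrightarrow> norm (y - x) < \<delta> \<Longrightarrow> y \<in> U"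
    "\<And>y v. y \<in> model r \<Longrightarrow> norm (y - x) < \<delta> \<Longrightarrow> v \<in> model r \<Longrightarrow> norm (dd r f y v) \<le> L * norm v"
    using tsmooth_dd_bound[OF f x] by blast
  have tr: "norm (trunc r y - x) \<le> norm (y - x)" for y
    using norm_trunc_le[of r "y - x"] xm by (simp add: linear_diff bounded_linear.linear bounded_linear_trunc)
  have "y \<in> U \<and> z \<in> U \<and> norm (f y - f z) \<le> L * norm (y - z)"
    if "y \<in> model r" "z \<in> model r" "norm (y - x) < \<delta>" "norm (z - x) < \<delta>" for y z
  proof -
    have "norm (f (trunc r y) - f (trunc r z)) \<le> L * norm (y - z)"
    proof (rule differentiable_bound[where f = "\<lambda>y. f (trunc r y)"])
      show "convex (ball x \<delta>)"
        by simp
      fix w assume "w \<in> ball x \<delta>"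
      then have w: "norm (trunc r w - x) < \<delta>"
        using tr[of w] by (simp add: dist_norm norm_minus_commute)
      show "((\<lambda>y. f (trunc r y)) has_derivative (\<lambda>h. dd r f (trunc r w) (trunc r h))) (at w within ball x \<delta>)"
        by (rule has_derivative_at_withinI[OF has_derivative_off_model[OF f'(3)[OF *(1)[OF trunc_in_model w]]]])
      show "onorm (\<lambda>h. dd r f (trunc r w) (trunc r h)) \<le> L"
      proof (rule onorm_bound[OF \<delta>(2)])
        fix h
        have "norm (dd r f (trunc r w) (trunc r h)) \<le> L * norm (trunc r h)"
          by (intro *(2) w trunc_in_model)
        also have "\<dots> \<le> L * norm h"
          using \<delta>(2) by (intro mult_left_mono norm_trunc_le)
        finally show "norm (dd r f (trunc r w) (trunc r h)) \<le> L * norm h" .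
      qed
    qed (use that in \<open>auto simp: dist_norm norm_minus_commute\<close>)
    moreover have "y \<in> U" "z \<in> U"
      by (intro *(1) that)+
    ultimately show ?thesis
      using that by simp
  qed
  then show ?thesis
    using \<delta> by blast
qed

section \<open>Ordinary differential equations in Banach spaces\<close>

text \<open>Integrating the weight gains the factor 1 / K, the source of the contraction constant L
  / K of the Picard operator.\<close>

lemma exp_weight_bound_pos:
  fixes D :: "real \<Rightarrow> 'a::real_normed_vector"
  assumes "0 < t" "D 0 = 0" "K > 0"
    and "\<And>s. s \<in> {0..t} \<Longrightarrow> (D has_vector_derivative D' s) (at s within {0..t})"
    and "\<And>s. s \<in> {0..t} \<Longrightarrow> norm (D' s) \<le> C * exp (K * s)" "C \<ge> 0"
  shows "norm (D t) \<le> C / K * exp (K * t)"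
proof -
  have "norm (D t - D 0) \<le> C / K * exp (K * t) - C / K * exp (K * 0)"
  proof (rule differentiable_bound_general[where \<phi> = "\<lambda>s. C / K * exp (K * s)" and f' = D'
        and \<phi>' = "\<lambda>s. C * exp (K * s)"])
    show "continuous_on {0..t} D"
      by (rule continuous_on_vector_derivative[OF assms(4)])
    show "(D has_vector_derivative D' s) (at s)" if "0 < s" "s < t" for s
      using assms(4)[of s] that by (simp add: at_within_Icc_at)
    show "((\<lambda>s. C / K * exp (K * s)) has_vector_derivative C * exp (K * s)) (at s)" for s
      using assms(3) by (auto intro!: derivative_eq_intros simp: has_real_derivative_iff_has_vector_derivative[symmetric])
    show "norm (D' s) \<le> C * exp (K * s)" if "0 < s" "s < t" for s
      using assms(5)[of s] that by simp
  qed (use assms in \<open>auto intro!: continuous_intros\<close>)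
  moreover have "C / K * exp (K * 0) \<ge> 0"
    using assms by simp
  ultimately show ?thesis
    using assms(2) by simp
qed

text \<open>Negative times reduce to positive ones by reversing time.\<close>

lemma exp_weight_bound:
  fixes D :: "real \<Rightarrow> 'a::real_normed_vector"
  assumes "t \<in> {-a..a}" "D 0 = 0" "K > 0"
    and D: "\<And>s. s \<in> {-a..a} \<Longrightarrow> (D has_vector_derivative D' s) (at s within {-a..a})"
    and D': "\<And>s. s \<in> {-a..a} \<Longrightarrow> norm (D' s) \<le> C * exp (K * \<bar>s\<bar>)" "C \<ge> 0"
  shows "norm (D t) \<le> C / K * exp (K * \<bar>t\<bar>)"
proof -
  consider "t = 0" | "t > 0" | "t < 0" by linarith
  then show ?thesis
  proof cases
    case 1
    then show ?thesis using assms by simp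
  next
    case 2
    have sub: "{0..t} \<subseteq> {-a..a}"
      using assms(1) 2 by auto
    have "norm (D t) \<le> C / K * exp (K * t)"
    proof (rule exp_weight_bound_pos[where D = D and D' = D'])
      show "(D has_vector_derivative D' s) (at s within {0..t})" if "s \<in> {0..t}" for s
        using D that sub has_vector_derivative_within_subset by blast
      show "norm (D' s) \<le> C * exp (K * s)" if "s \<in> {0..t}" for s
        using D'(1)[of s] that sub by auto
    qed (use 2 assms in auto)
    then show ?thesis using 2 by simp
  next
    case 3
    have sub: "uminus ` {0..-t} \<subseteq> {-a..a}"
      using assms(1) 3 by auto
    have "norm (D (- (- t))) \<le> C / K * exp (K * (- t))"
    proof (rule exp_weight_bound_pos[where D = "\<lambda>s. D (- s)" and D' = "\<lambda>s. - D' (- s)"])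
      fix s assume s: "s \<in> {0..-t}"
      then have "(D has_vector_derivative D' (- s)) (at (- s) within uminus ` {0..-t})"
        using D sub has_vector_derivative_within_subset by blast
      moreover have "(uminus has_vector_derivative - 1) (at s within {0..-t})"
        by (auto intro!: derivative_eq_intros)
      ultimately show "((\<lambda>s. D (- s)) has_vector_derivative - D' (- s)) (at s within {0..-t})"
        using vector_diff_chain_within[of uminus "-1" s "{0..-t}" D "D' (- s)"] by (simp add: comp_def)
      show "norm (- D' (- s)) \<le> C * exp (K * s)"
        using D'(1)[of "- s"] s sub by auto
    qed (use 3 assms in auto)
    then show ?thesis using 3 by simp
  qed
qed

text \<open>
  The Picard operator is a contraction for the supremum norm weighted by \<open>exp (- 2 L |t|)\<close>, so
  that no smallness of the interval is needed.
\<close>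

lemma ode_exists:
  fixes F :: "real \<Rightarrow> 'a::banach \<Rightarrow> 'a"
  assumes "a > 0" "closed X" "v0 \<in> X" "L \<ge> 0"
    and cont: "\<And>u. continuous_on {-a..a} u \<Longrightarrow> u ` {-a..a} \<subseteq> X \<Longrightarrow> continuous_on {-a..a} (\<lambda>t. F t (u t))"
    and lip: "\<And>t u w. t \<in> {-a..a} \<Longrightarrow> u \<in> X \<Longrightarrow> w \<in> X \<Longrightarrow> norm (F t u - F t w) \<le> L * norm (u - w)"
    and inv: "\<And>u w. u ` {-a..a} \<subseteq> X \<Longrightarrow> w 0 = v0 \<Longrightarrow>
      (\<And>t. t \<in> {-a..a} \<Longrightarrow> (w has_vector_derivative F t (u t)) (at t within {-a..a})) \<Longrightarrow> w ` {-a..a} \<subseteq> X"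
  shows "\<exists>v. v 0 = v0 \<and> (\<forall>t\<in>{-a..a}. v t \<in> X \<and> (v has_vector_derivative F t (v t)) (at t within {-a..a}))"
proof -
  let ?I = "{-a..a}"
  \<comment> \<open>The contraction constant will be L / K, at most 1 / 2; the 1 keeps K positive
    for L = 0.\<close>
  define K where "K = 2 * L + 1"
  have K: "K > 0" "2 * L \<le> K"
    using assms by (auto simp: K_def)
  \<comment> \<open>The fixed point is sought among weighted curves u, and \<open>w u\<close> is the
    actual curve. For u the weighted norm is the plain supremum norm, in which bounded continuous
    functions are complete.\<close>
  define w where "w u t = exp (K * \<bar>t\<bar>) *\<^sub>R apply_bcontfun u t" for u :: "real \<Rightarrow>\<^sub>C 'a" and t
  define G where "G u t = F t (w u t)" for u t
  \<comment> \<open>The integral from 0 to t, written with lower bound -a so that one formula is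
    differentiable on both sides of 0.\<close>
  define J where "J u t = v0 + (integral {-a..t} (G u) - integral {-a..0} (G u))" for u t
  \<comment> \<open>A closed set of curves, kept invariant by hypothesis \<open>inv\<close>. Taking
    X to be a closed ball in a model space will give local flows, the whole model space linear
    equations.\<close>
  define S where "S = {u. \<forall>t\<in>?I. w u t \<in> X}"
  \<comment> \<open>The retraction onto the interval extends curves on it to bounded continuous
    functions on the line.\<close>
  define cl where "cl t = max (-a) (min a t)" for t :: real
  have cl: "cl t \<in> ?I" "t \<in> ?I \<Longrightarrow> cl t = t" for t
    using assms(1) by (auto simp: cl_def)
  have zero: "0 \<in> ?I"
    using assms(1) by simp
  have bcont: "(\<lambda>t. h (cl t)) \<in> bcontfun" if "continuous_on ?I h" for h :: "real \<Rightarrow> 'a"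
  proof -
    have "continuous_on UNIV (\<lambda>t. h (cl t))"
      by (rule continuous_on_compose2[OF that]) (use cl in \<open>auto intro!: continuous_intros simp: cl_def\<close>)
    moreover have "bounded (range (\<lambda>t. h (cl t)))"
      by (rule bounded_subset[OF compact_imp_bounded[OF compact_continuous_image[OF that]]]) (use cl in auto)
    ultimately show ?thesis
      by (simp add: bcontfun_def)
  qed
  define T where "T u = Bcontfun (\<lambda>t. (\<lambda>t. exp (- (K * \<bar>t\<bar>)) *\<^sub>R J u t) (cl t))" for u
  have wc: "continuous_on ?I (w u)" for u
    unfolding w_def by (intro continuous_intros continuous_on_subset[OF continuous_on_apply_bcontfun]) auto
  have Jd: "(J u has_vector_derivative F t (w u t)) (at t within ?I)" if "u \<in> S" "t \<in> ?I" for u t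
  proof -
    have "continuous_on ?I (G u)"
      unfolding G_def by (rule cont[OF wc]) (use that in \<open>auto simp: S_def\<close>)
    then have "((\<lambda>t. integral {-a..t} (G u)) has_vector_derivative G u t) (at t within ?I)"
      using that by (intro integral_has_vector_derivative)
    then show ?thesis
      unfolding J_def by (auto intro!: derivative_eq_intros simp: G_def)
  qed
  have J0: "J u 0 = v0" for u
    by (simp add: J_def)
  have Tt: "apply_bcontfun (T u) t = exp (- (K * \<bar>cl t\<bar>)) *\<^sub>R J u (cl t)" if u: "u \<in> S" for u t
  proof -
    have "continuous_on ?I (J u)"
      by (rule continuous_on_vector_derivative[OF Jd[OF u]])
    then have "continuous_on ?I (\<lambda>t. exp (- (K * \<bar>t\<bar>)) *\<^sub>R J u t)"
      by (intro continuous_intros)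
    from Bcontfun_inverse[OF bcont[OF this]] show ?thesis
      by (simp add: T_def)
  qed
  have Tw: "w (T u) t = J u t" if "u \<in> S" "t \<in> ?I" for u t
    using that cl(2)[of t] by (simp add: w_def Tt exp_minus)
  have TS: "T ` S \<subseteq> S"
  proof safe
    fix u assume u: "u \<in> S"
    have "J u ` ?I \<subseteq> X"
      by (rule inv[of "w u"]) (use u Jd[OF u] J0 in \<open>auto simp: S_def\<close>)
    then show "T u \<in> S"
      using Tw[OF u] by (auto simp: S_def)
  qed
  have "\<exists>!u\<in>S. T u = u"
  proof (rule Banach_fix)
    have bl: "bounded_linear (\<lambda>u :: real \<Rightarrow>\<^sub>C 'a. apply_bcontfun u t)" for t
      by (rule bounded_linear_intro[where K = 1])
        (auto simp: plus_bcontfun.rep_eq scaleR_bcontfun.rep_eq norm_bounded)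
    have "closed ((\<lambda>u. w u t) -` X)" for t
      unfolding w_def
      by (rule closed_vimage[OF assms(2)]) (intro continuous_intros linear_continuous_on[OF bl])
    then have "closed (\<Inter>t\<in>?I. (\<lambda>u. w u t) -` X)"
      by blast
    moreover have "S = (\<Inter>t\<in>?I. (\<lambda>u. w u t) -` X)"
      by (auto simp: S_def)
    ultimately show "complete S"
      by (simp add: complete_eq_closed)
    have "continuous_on ?I (\<lambda>t. exp (- (K * \<bar>t\<bar>)) *\<^sub>R v0)"
      by (intro continuous_intros)
    from Bcontfun_inverse[OF bcont[OF this]]
    have "w (Bcontfun (\<lambda>t. exp (- (K * \<bar>cl t\<bar>)) *\<^sub>R v0)) t = v0" if "t \<in> ?I" for t
      using cl(2)[OF that] by (simp add: w_def exp_minus)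
    then have "Bcontfun (\<lambda>t. exp (- (K * \<bar>cl t\<bar>)) *\<^sub>R v0) \<in> S"
      using assms(3) by (simp add: S_def)
    then show "S \<noteq> {}"
      by blast
    show "dist (T u) (T u') \<le> 1 / 2 * dist u u'" if u: "u \<in> S" "u' \<in> S" for u u'
    proof (rule dist_bound)
      fix x
      let ?t = "cl x" and ?C = "L * dist u u'"
      have "norm (J u ?t - J u' ?t) \<le> ?C / K * exp (K * \<bar>?t\<bar>)"
      proof (rule exp_weight_bound[where D = "\<lambda>t. J u t - J u' t" and D' = "\<lambda>t. F t (w u t) - F t (w u' t)"])
        fix s assume s: "s \<in> ?I"
        show "((\<lambda>t. J u t - J u' t) has_vector_derivative F s (w u s) - F s (w u' s)) (at s within ?I)"
          by (intro has_vector_derivative_diff Jd u s)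
        have "norm (F s (w u s) - F s (w u' s)) \<le> L * norm (w u s - w u' s)"
          using u s by (intro lip) (auto simp: S_def)
        also have "w u s - w u' s = exp (K * \<bar>s\<bar>) *\<^sub>R (apply_bcontfun u s - apply_bcontfun u' s)"
          by (simp add: w_def algebra_simps)
        also have "L * norm \<dots> \<le> L * (exp (K * \<bar>s\<bar>) * dist u u')"
          using assms(4) dist_bounded[of u s u']
          by (intro mult_left_mono) (auto simp: dist_norm)
        finally show "norm (F s (w u s) - F s (w u' s)) \<le> ?C * exp (K * \<bar>s\<bar>)"
          by (simp add: ac_simps)
      qed (use cl K assms(4) J0 in auto)
      then have "exp (- (K * \<bar>?t\<bar>)) * norm (J u ?t - J u' ?t) \<le>
          exp (- (K * \<bar>?t\<bar>)) * (?C / K * exp (K * \<bar>?t\<bar>))"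
        by (intro mult_left_mono) auto
      also have "\<dots> = L / K * dist u u'"
        by (simp add: exp_minus)
      also have "\<dots> \<le> 1 / 2 * dist u u'"
        using K by (intro mult_right_mono) (auto simp: field_simps)
      finally show "dist (apply_bcontfun (T u) x) (apply_bcontfun (T u') x) \<le> 1 / 2 * dist u u'"
        by (simp add: Tt[OF u(1)] Tt[OF u(2)] dist_norm flip: scaleR_diff_right)
    qed
  qed (use TS in auto)
  then obtain u where u: "u \<in> S" "T u = u" by blast
  have wJ: "w u t = J u t" if "t \<in> ?I" for t
    using Tw[OF u(1) that] u(2) by simp
  show ?thesis
  proof (intro exI[of _ "w u"] conjI ballI)
    show "w u 0 = v0"
      using wJ[OF zero] J0 by simp
    fix t assume t: "t \<in> ?I"
    then show "w u t \<in> X"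
      using u(1) by (simp add: S_def)
    show "(w u has_vector_derivative F t (w u t)) (at t within ?I)"
      using has_vector_derivative_transform[OF t _ Jd[OF u(1) t], of "w u"] wJ by simp
  qed
qed

text \<open>
  The library has completeness of spaces of bounded functions only over a metric space; for
  \<open>coord\<close> the index set \<open>nat\<close> therefore gets its usual (discrete) metric.
\<close>

instantiation nat :: metric_space
begin

definition dist_nat_def: "dist m n = \<bar>real m - real n\<bar>"

definition uniformity_nat_def:
  "(uniformity :: (nat \<times> nat) filter) = (INF e\<in>{0<..}. principal {(m, n). dist m n < e})"

instance
proof
  fix U :: "nat set"
  have "eventually (\<lambda>(x', y). x' = x \<longrightarrow> y \<in> U) uniformity" if "x \<in> U" for x
    unfolding uniformity_nat_def
  proof (rule eventually_INF1[where i = 1])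
    have "m = n" if "\<bar>real m - real n\<bar> < 1" for m n
      using that by linarith
    then show "eventually (\<lambda>(x', y). x' = x \<longrightarrow> y \<in> U) (principal {(m, n). dist m n < 1})"
      using that by (auto simp: eventually_principal dist_nat_def)
  qed simp
  then show "open U \<longleftrightarrow> (\<forall>x\<in>U. eventually (\<lambda>(x', y). x' = x \<longrightarrow> y \<in> U) uniformity)"
    by (simp add: open_discrete)
qed (auto simp: dist_nat_def uniformity_nat_def)

end

instance bcontfun :: (metric_space, banach) banach ..

section \<open>Flows of vector fields on model spaces and of their linearizations\<close>

lemma stays_in_model:
  assumes "w 0 \<in> model r" "a \<ge> 0" "t \<in> {-a..a}"
    and "\<And>t. t \<in> {-a..a} \<Longrightarrow> (w has_vector_derivative w' t) (at t within {-a..a}) \<and> w' t \<in> model r"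
  shows "w t \<in> model r"
proof -
  \<comment> \<open>The part of w outside the model space has derivative zero.\<close>
  have "norm ((w t - trunc r (w t)) - (w 0 - trunc r (w 0))) \<le> 0 * \<bar>t - 0\<bar>"
  proof (rule norm_diff_le_vector_derivative[where a = "-a" and b = a and g' = "\<lambda>t. w' t - trunc r (w' t)"])
    fix t assume t: "t \<in> {-a..a}"
    then show "((\<lambda>t. w t - trunc r (w t)) has_vector_derivative w' t - trunc r (w' t)) (at t within {-a..a})"
      using assms(4)[OF t]
      by (intro has_vector_derivative_diff bounded_linear.has_vector_derivative[OF bounded_linear_trunc]) auto
    show "norm (w' t - trunc r (w' t)) \<le> 0"
      using assms(4)[OF t] by simp
  qed (use assms in auto)
  then have "trunc r (w t) = w t"
    using assms(1) by simp
  then show ?thesis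
    by (metis trunc_in_model)
qed

lemma closed_model: "closed (model r :: ('e::real_normed_vector) coord set)"
proof -
  have "model r = {v :: 'e coord. trunc r v = v}"
    using in_model_iff by blast
  also have "closed {v :: 'e coord. trunc r v = v}"
    by (rule closed_Collect_eq[OF linear_continuous_on[OF bounded_linear_trunc] continuous_on_id])
  finally show ?thesis .
qed

lemma tsmooth_continuous:
  assumes "tsmooth r s U f"
  shows "continuous_on U f"
proof -
  have "continuous (at x within U) f" if x: "x \<in> U" for x
  proof -
    have "continuous (at x within U) (\<lambda>y. f (trunc r y))"
      by (rule continuous_at_imp_continuous_at_within[OF has_derivative_continuous])
        (rule tdiffD[OF tsmooth_cases(3)[OF assms x]])
    then show ?thesis
      by (rule continuous_transform_within[OF _ zero_less_one x])
        (use tsmooth_mem[OF assms] x in auto)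
  qed
  then show ?thesis
    by (simp add: continuous_on_eq_continuous_within)
qed

lemma local_flow:
  fixes A :: "('e::banach) coord \<Rightarrow> 'e coord"
  assumes A: "tsmooth r r U A" and z0: "z0 \<in> U"
  shows "\<exists>a>0. \<exists>z. z 0 = z0 \<and> (\<forall>t\<in>{-a..a}. z t \<in> U \<and> (z has_vector_derivative A (z t)) (at t within {-a..a}))"
proof -
  note A' = tsmooth_cases[OF A]
  have zm: "z0 \<in> model r"
    using A z0 by (rule tsmooth_mem)
  obtain \<delta> L where \<delta>: "\<delta> > 0" "L \<ge> 0" and
    *: "\<And>y z. y \<in> model r \<Longrightarrow> z \<in> model r \<Longrightarrow> norm (y - z0) < \<delta> \<Longrightarrow> norm (z - z0) < \<delta> \<Longrightarrow>
      y \<in> U \<and> z \<in> U \<and> norm (A y - A z) \<le> L * norm (y - z)"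
    using tsmooth_lipschitz[OF A z0] by blast
  \<comment> \<open>Half the radius, so that the closed ball lies in the open one on which A is
    Lipschitz.\<close>
  define R where "R = \<delta> / 2"
  have R: "R > 0" "R < \<delta>"
    using \<delta> by (auto simp: R_def)
  define X where "X = model r \<inter> cball z0 R"
  have X: "x \<in> model r" "norm (x - z0) < \<delta>" "norm (x - z0) \<le> R" if "x \<in> X" for x
    using that R by (auto simp: X_def dist_norm norm_minus_commute)
  have XU: "X \<subseteq> U"
    using * X by blast
  \<comment> \<open>A bound for the speed on X; the 1 makes it a legitimate divisor.\<close>
  define B where "B = norm (A z0) + L * R + 1"
  have B: "B > 0"
    using \<delta> R by (simp add: B_def add_nonneg_pos)
  have AB: "norm (A x) \<le> B" if "x \<in> X" for x
  proof -
    have "norm (A x - A z0) \<le> L * norm (x - z0)"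
      using *[of x z0] X[OF that] zm \<delta> by simp
    also have "\<dots> \<le> L * R"
      using \<delta> X[OF that] by (intro mult_left_mono)
    finally show ?thesis
      using norm_triangle_sub[of "A x" "A z0"] by (simp add: B_def)
  qed
  \<comment> \<open>At speed at most B, distance R is not exceeded within this time.\<close>
  define a where "a = R / B"
  have a: "a > 0"
    using R B by (simp add: a_def)
  have "\<exists>z. z 0 = z0 \<and> (\<forall>t\<in>{-a..a}. z t \<in> X \<and> (z has_vector_derivative A (z t)) (at t within {-a..a}))"
  proof (rule ode_exists[where F = "\<lambda>_. A" and L = L])
    show "closed X"
      by (simp add: X_def closed_Int closed_model)
    show "z0 \<in> X"
      using zm R by (simp add: X_def)
    show "continuous_on {-a..a} (\<lambda>t. A (u t))" if "continuous_on {-a..a} u" "u ` {-a..a} \<subseteq> X" for u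
      by (rule continuous_on_compose2[OF tsmooth_continuous[OF A] that(1)]) (use that XU in blast)
    show "norm (A u - A w) \<le> L * norm (u - w)" if "u \<in> X" "w \<in> X" for u w
      using * X that by blast
    show "w ` {-a..a} \<subseteq> X" if u: "u ` {-a..a} \<subseteq> X" and w0: "w 0 = z0"
      and w: "\<And>t. t \<in> {-a..a} \<Longrightarrow> (w has_vector_derivative A (u t)) (at t within {-a..a})" for u w
    proof safe
      fix t assume t: "t \<in> {-a..a}"
      have "w t \<in> model r"
      proof (rule stays_in_model[where w' = "\<lambda>t. A (u t)", OF _ _ t])
        show "(w has_vector_derivative A (u t)) (at t within {-a..a}) \<and> A (u t) \<in> model r"
          if "t \<in> {-a..a}" for t
          using w[OF that] A'(2) u XU that by blast
      qed (use w0 zm a in auto)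
      moreover have "norm (w t - w 0) \<le> B * \<bar>t - 0\<bar>"
        by (rule norm_diff_le_vector_derivative[where g' = "\<lambda>t. A (u t)", OF w AB]) (use u t a in auto)
      moreover have "B * \<bar>t - 0\<bar> \<le> B * a"
        using t B by (intro mult_left_mono) auto
      moreover have "B * a = R"
        using B by (simp add: a_def)
      ultimately show "w t \<in> X"
        using w0 by (auto simp: X_def dist_norm norm_minus_commute)
    qed
  qed (use a \<delta> in auto)
  then show ?thesis
    using a XU by blast
qed

text \<open>Compactness of the interval, by bisection, merges the local bounds near the points z t
  into one bound along the curve.\<close>

lemma tsmooth_dd_bound_path:
  fixes a :: real
  assumes A: "tsmooth r s U A" and z: "continuous_on {-a..a} z" "z ` {-a..a} \<subseteq> U" and "a \<ge> 0"
  shows "\<exists>L\<ge>0. \<forall>t\<in>{-a..a}. \<forall>v\<in>model r. norm (dd r A (z t) v) \<le> L * norm v"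
proof -
  \<comment> \<open>The small intervals around t in the bisection principle may stick out of the
    domain of z, hence the intersection.\<close>
  define P where "P = (\<lambda>p q. \<exists>L\<ge>0. \<forall>t\<in>{p..q} \<inter> {-a..a}. \<forall>v\<in>model r. norm (dd r A (z t) v) \<le> L * norm v)"
  have "P (-a) a"
  proof (rule Bolzano)
    fix p q r' assume "P p q" "P q r'" "p \<le> q" "q \<le> r'"
    then obtain L L' where L: "L \<ge> 0" "\<And>t v. t \<in> {p..q} \<inter> {-a..a} \<Longrightarrow> v \<in> model r \<Longrightarrow> norm (dd r A (z t) v) \<le> L * norm v"
      and L': "L' \<ge> 0" "\<And>t v. t \<in> {q..r'} \<inter> {-a..a} \<Longrightarrow> v \<in> model r \<Longrightarrow> norm (dd r A (z t) v) \<le> L' * norm v"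
      unfolding P_def by blast
    have "norm (dd r A (z t) v) \<le> max L L' * norm v" if "t \<in> {p..r'} \<inter> {-a..a}" "v \<in> model r" for t v
    proof (cases "t \<le> q")
      case True
      then have "norm (dd r A (z t) v) \<le> L * norm v"
        using that by (intro L(2)) auto
      also have "\<dots> \<le> max L L' * norm v"
        by (intro mult_right_mono) auto
      finally show ?thesis .
    next
      case False
      then have "norm (dd r A (z t) v) \<le> L' * norm v"
        using that by (intro L'(2)) auto
      also have "\<dots> \<le> max L L' * norm v"
        by (intro mult_right_mono) auto
      finally show ?thesis .
    qed
    moreover have "max L L' \<ge> 0"
      using L(1) by simp
    ultimately show "P p r'"
      unfolding P_def by blast
  next
    fix t assume t: "-a \<le> t" "t \<le> a"
    then have "z t \<in> U"
      using z by auto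
    then obtain \<delta> L where \<delta>: "\<delta> > 0" "L \<ge> 0" and *: "\<And>y v. y \<in> model r \<Longrightarrow> norm (y - z t) < \<delta> \<Longrightarrow>
        v \<in> model r \<Longrightarrow> norm (dd r A y v) \<le> L * norm v"
      using tsmooth_dd_bound[OF A] by blast
    have "t \<in> {-a..a}"
      using t by simp
    then obtain d where d: "d > 0" "\<And>s. s \<in> {-a..a} \<Longrightarrow> dist s t < d \<Longrightarrow> dist (z s) (z t) < \<delta>"
      using z(1) \<delta>(1) unfolding continuous_on_iff by metis
    have "P p q" if "p \<le> t" "t \<le> q" "q - p < d" for p q
    proof -
      have "norm (dd r A (z s) v) \<le> L * norm v" if s: "s \<in> {p..q} \<inter> {-a..a}" and v: "v \<in> model r" for s v
      proof (rule *[OF _ _ v])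
        have "dist s t < d"
          using s \<open>p \<le> t\<close> \<open>t \<le> q\<close> \<open>q - p < d\<close> by (auto simp: dist_real_def)
        then show "norm (z s - z t) < \<delta>"
          using d(2) s by (simp add: dist_norm)
        show "z s \<in> model r"
          using s z tsmooth_mem[OF A] by blast
      qed
      then show ?thesis
        unfolding P_def using \<delta>(2) by blast
    qed
    then show "\<exists>d>0. \<forall>p q. p \<le> t \<and> t \<le> q \<and> q - p < d \<longrightarrow> P p q"
      using d(1) by blast
  qed (use assms in auto)
  then show ?thesis
    by (simp add: P_def)
qed

text \<open>A linear equation has one Lipschitz constant on the whole space, so X can be all of
  \<open>model r\<close> and the solution exists as long as z does.\<close>

lemma linear_flow:
  fixes A :: "('e::banach) coord \<Rightarrow> 'e coord"
  assumes A: "tsmooth r r U A" and z: "continuous_on {-a..a} z" "z ` {-a..a} \<subseteq> U"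
    and a: "a > 0" and v0: "v0 \<in> model r"
  shows "\<exists>v. v 0 = v0 \<and> (\<forall>t\<in>{-a..a}. v t \<in> model r \<and>
    (v has_vector_derivative dd r A (z t) (v t)) (at t within {-a..a}))"
proof -
  note A' = tsmooth_cases[OF A]
  obtain L where L: "L \<ge> 0" "\<And>t v. t \<in> {-a..a} \<Longrightarrow> v \<in> model r \<Longrightarrow> norm (dd r A (z t) v) \<le> L * norm v"
    using tsmooth_dd_bound_path[OF A z] a by auto
  have zU: "z t \<in> U" if "t \<in> {-a..a}" for t
    using z that by blast
  have ddm: "dd r A y v \<in> model r" if "y \<in> U" for y v
    by (rule dd_in_model[OF A'(1) that A'(2) A'(3)[OF that]])
  show ?thesis
  proof (rule ode_exists[where L = L and F = "\<lambda>t. dd r A (z t)"])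
    fix u :: "real \<Rightarrow> 'e coord" assume u: "continuous_on {-a..a} u" "u ` {-a..a} \<subseteq> model r"
    \<comment> \<open>Joint continuity of (y, v) |-> DA(y) v is read off from the tangent map of
      A.\<close>
    have "continuous_on {-a..a} (\<lambda>t. join r (z t) (u t))"
      using continuous_on_compose2[OF linear_continuous_on[OF bounded_linear_join[of r], of UNIV]
          continuous_on_Pair[OF z(1) u(1)]] by simp
    then have "continuous_on {-a..a} (\<lambda>t. tan_map r r A (join r (z t) (u t)))"
      by (rule continuous_on_compose2[OF tsmooth_continuous[OF A'(4)]])
        (use u zU tsmooth_mem[OF A] in \<open>auto simp: tan_dom_def\<close>)
    then have "continuous_on {-a..a} (\<lambda>t. shift r (tan_map r r A (join r (z t) (u t))))"
      by (rule continuous_on_compose2[OF linear_continuous_on[OF bounded_linear_shift, of UNIV]]) simp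
    moreover have "shift r (tan_map r r A (join r (z t) (u t))) = dd r A (z t) (u t)" if "t \<in> {-a..a}" for t
      using that u zU ddm tsmooth_mem[OF A] by (subst tan_map_join) auto
    ultimately show "continuous_on {-a..a} (\<lambda>t. dd r A (z t) (u t))"
      by (rule continuous_on_eq)
  next
    fix t and u w :: "'e coord" assume t: "t \<in> {-a..a}" and uw: "u \<in> model r" "w \<in> model r"
    have "linear (dd r A (z t))"
      using dd_linear[OF A'(3)[OF zU[OF t]]] bounded_linear.linear by blast
    then show "norm (dd r A (z t) u - dd r A (z t) w) \<le> L * norm (u - w)"
      using L(2)[OF t, of "u - w"] uw by (simp add: linear_diff)
  next
    fix u w :: "real \<Rightarrow> 'e coord" assume "w 0 = v0"
      and w: "\<And>t. t \<in> {-a..a} \<Longrightarrow> (w has_vector_derivative dd r A (z t) (u t)) (at t within {-a..a})"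
    show "w ` {-a..a} \<subseteq> model r"
    proof safe
      fix t assume t: "t \<in> {-a..a}"
      show "w t \<in> model r"
        by (rule stays_in_model[where w' = "\<lambda>t. dd r A (z t) (u t)", OF _ _ t])
          (use \<open>w 0 = v0\<close> v0 a w ddm zU in auto)
    qed
  qed (use a v0 L closed_model in auto)
qed

text \<open>On an interval of radius h with L * h at most 1 / 2, the maximum of |z - w| is at most
  half of itself. That the neighbourhood lies in I belongs to the conclusion: I will be the set of
  times at which a curve is inside a chart, and that it stays there has to be inferred.\<close>

lemma ode_unique_local:
  assumes A: "tsmooth r r U A" and I: "open I" "t0 \<in> I"
    and z: "\<And>t. t \<in> I \<Longrightarrow> z t \<in> U \<and> (z has_vector_derivative A (z t)) (at t)"
    and w: "\<And>t. t \<in> I \<Longrightarrow> w t \<in> U \<and> (w has_vector_derivative A (w t)) (at t)"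
    and eq: "z t0 = w t0"
  shows "\<exists>\<delta>>0. \<forall>t. \<bar>t - t0\<bar> < \<delta> \<longrightarrow> t \<in> I \<and> z t = w t"
proof -
  obtain \<delta>0 L where \<delta>0: "\<delta>0 > 0" "L \<ge> 0" and
    lip: "\<And>y x. y \<in> model r \<Longrightarrow> x \<in> model r \<Longrightarrow> norm (y - z t0) < \<delta>0 \<Longrightarrow> norm (x - z t0) < \<delta>0 \<Longrightarrow>
      norm (A y - A x) \<le> L * norm (y - x)"
    using tsmooth_lipschitz[OF A] z[OF I(2)] by blast
  obtain d1 where d1: "d1 > 0" "\<And>t. \<bar>t - t0\<bar> < d1 \<Longrightarrow> t \<in> I"
    using I unfolding open_dist dist_real_def by blast
  have "isCont z t0" "isCont w t0"
    using z[OF I(2)] w[OF I(2)] has_vector_derivative_continuous by blast+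
  then obtain d2 d3 where d2: "d2 > 0" "\<And>t. \<bar>t - t0\<bar> < d2 \<Longrightarrow> norm (z t - z t0) < \<delta>0"
    and d3: "d3 > 0" "\<And>t. \<bar>t - t0\<bar> < d3 \<Longrightarrow> norm (w t - z t0) < \<delta>0"
    using \<delta>0(1) unfolding continuous_at_eps_delta dist_real_def dist_norm eq by metis
  \<comment> \<open>The bound 1 / (L + 1) gives the contraction, and halving makes the other
    inequalities strict.\<close>
  define h where "h = min (min d1 d2) (min d3 (1 / (L + 1))) / 2"
  have h: "h > 0" "h < d1" "h < d2" "h < d3"
    using d1 d2 d3 \<delta>0 by (auto simp: h_def min_def)
  have Lh: "L * h \<le> 1 / 2"
  proof -
    define q where "q = 1 / (L + 1)"
    have q: "(L + 1) * q = 1" "q > 0"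
      using \<delta>0(2) by (auto simp: q_def)
    have "h \<le> q / 2"
      unfolding h_def q_def[symmetric] by (auto simp: min_def)
    then have "L * h \<le> (L + 1) * (q / 2)"
      using \<delta>0(2) h by (intro mult_mono) auto
    then show ?thesis
      using q by simp
  qed
  let ?J = "{t0 - h..t0 + h}"
  have J: "\<bar>t - t0\<bar> \<le> h" if "t \<in> ?J" for t
    using that by auto
  have JI: "t \<in> I" if "t \<in> ?J" for t
    using J[OF that] h d1 by simp
  have der: "((\<lambda>t. z t - w t) has_vector_derivative A (z t) - A (w t)) (at t within ?J)" if "t \<in> ?J" for t
    by (rule has_vector_derivative_at_within[OF has_vector_derivative_diff[OF
          z[OF JI[OF that], THEN conjunct2] w[OF JI[OF that], THEN conjunct2]]])
  have "continuous_on ?J (\<lambda>t. norm (z t - w t))"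
    by (rule continuous_on_norm[OF continuous_on_vector_derivative[OF der]])
  then obtain m where m: "m \<in> ?J" "\<And>t. t \<in> ?J \<Longrightarrow> norm (z t - w t) \<le> norm (z m - w m)"
    using continuous_attains_sup[of ?J "\<lambda>t. norm (z t - w t)"] h by auto
  have "norm ((z m - w m) - (z t0 - w t0)) \<le> (L * norm (z m - w m)) * \<bar>m - t0\<bar>"
  proof (rule norm_diff_le_vector_derivative[OF der])
    fix t assume t: "t \<in> ?J"
    have "norm (A (z t) - A (w t)) \<le> L * norm (z t - w t)"
      using z[OF JI[OF t]] w[OF JI[OF t]] J[OF t] h d2 d3 tsmooth_mem[OF A] by (intro lip) auto
    also have "\<dots> \<le> L * norm (z m - w m)"
      using m(2)[OF t] \<delta>0 by (intro mult_left_mono) auto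
    finally show "norm (A (z t) - A (w t)) \<le> L * norm (z m - w m)" .
  qed (use m h in auto)
  also have "\<dots> \<le> (L * norm (z m - w m)) * h"
    using J[OF m(1)] \<delta>0 by (intro mult_left_mono) auto
  also have "\<dots> = (L * h) * norm (z m - w m)"
    by simp
  also have "\<dots> \<le> 1 / 2 * norm (z m - w m)"
    using Lh by (intro mult_right_mono) auto
  finally have m0: "norm (z m - w m) \<le> 0"
    using eq by simp
  have "t \<in> I \<and> z t = w t" if "\<bar>t - t0\<bar> < h" for t
  proof -
    have "t \<in> ?J"
      using that by auto
    then show ?thesis
      using m(2)[of t] m0 JI by (metis eq_iff_diff_eq_0 norm_le_zero_iff order_trans)
  qed
  then show ?thesis
    using h(1) by blast
qed

section \<open>Connectedness of the interval and global uniqueness\<close>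

lemma interval_clopen:
  fixes P :: "real \<Rightarrow> bool"
  assumes "P 0" "\<epsilon> > 0"
    and "\<And>t. t \<in> {-\<epsilon><..<\<epsilon>} \<Longrightarrow> P t \<Longrightarrow> \<exists>\<delta>>0. \<forall>s. \<bar>s - t\<bar> < \<delta> \<longrightarrow> P s"
    and "\<And>t. t \<in> {-\<epsilon><..<\<epsilon>} \<Longrightarrow> \<not> P t \<Longrightarrow> \<exists>\<delta>>0. \<forall>s. \<bar>s - t\<bar> < \<delta> \<longrightarrow> \<not> P s"
    and "t \<in> {-\<epsilon><..<\<epsilon>}"
  shows "P t"
proof (rule ccontr)
  assume n: "\<not> P t"
  let ?I = "{-\<epsilon><..<\<epsilon>}"
  have op: "open ({s \<in> ?I. Q s})"
    if Q: "\<And>t. t \<in> ?I \<Longrightarrow> Q t \<Longrightarrow> \<exists>\<delta>>0. \<forall>s. \<bar>s - t\<bar> < \<delta> \<longrightarrow> Q s" for Q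
    unfolding open_dist
  proof
    fix t assume "t \<in> {s \<in> ?I. Q s}"
    then have t: "t \<in> ?I" "Q t" by auto
    obtain \<delta> where \<delta>: "\<delta> > 0" "\<And>s. \<bar>s - t\<bar> < \<delta> \<Longrightarrow> Q s"
      using Q[OF t] by blast
    have "open ?I" by simp
    then obtain e where "e > 0" "\<And>s. dist s t < e \<Longrightarrow> s \<in> ?I"
      using t(1) unfolding open_dist by blast
    then show "\<exists>e>0. \<forall>y. dist y t < e \<longrightarrow> y \<in> {s \<in> ?I. Q s}"
      using \<delta> by (intro exI[of _ "min \<delta> e"]) (auto simp: dist_real_def)
  qed
  have "connected ?I" by simp
  moreover have "open {s \<in> ?I. P s}" "open {s \<in> ?I. \<not> P s}"
    by (rule op, use assms in blast)+
  moreover have "{s \<in> ?I. P s} \<inter> {s \<in> ?I. \<not> P s} \<inter> ?I = {}"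
    "?I \<subseteq> {s \<in> ?I. P s} \<union> {s \<in> ?I. \<not> P s}"
    by auto
  ultimately have "{s \<in> ?I. P s} \<inter> ?I = {} \<or> {s \<in> ?I. \<not> P s} \<inter> ?I = {}"
    by (rule connectedD)
  moreover have "0 \<in> {s \<in> ?I. P s} \<inter> ?I" "t \<in> {s \<in> ?I. \<not> P s} \<inter> ?I"
    using assms n by simp_all
  ultimately show False
    by blast
qed

text \<open>The set of agreement is open by local uniqueness and closed by continuity.\<close>

lemma ode_unique:
  assumes A: "tsmooth r r U A" and \<epsilon>: "\<epsilon> > 0"
    and z: "\<And>t. t \<in> {-\<epsilon><..<\<epsilon>} \<Longrightarrow> z t \<in> U \<and> (z has_vector_derivative A (z t)) (at t)"
    and w: "\<And>t. t \<in> {-\<epsilon><..<\<epsilon>} \<Longrightarrow> w t \<in> U \<and> (w has_vector_derivative A (w t)) (at t)"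
    and eq: "z 0 = w 0" and t: "t \<in> {-\<epsilon><..<\<epsilon>}"
  shows "z t = w t"
proof (rule interval_clopen[where P = "\<lambda>t. z t = w t", OF eq \<epsilon> _ _ t])
  fix t assume t: "t \<in> {-\<epsilon><..<\<epsilon>}"
  show "\<exists>\<delta>>0. \<forall>s. \<bar>s - t\<bar> < \<delta> \<longrightarrow> z s = w s" if "z t = w t"
    using ode_unique_local[OF A _ t z w that] by auto
  show "\<exists>\<delta>>0. \<forall>s. \<bar>s - t\<bar> < \<delta> \<longrightarrow> z s \<noteq> w s" if "z t \<noteq> w t"
  proof -
    have "isCont z t" "isCont w t"
      using z[OF t] w[OF t] has_vector_derivative_continuous by blast+
    then have "isCont (\<lambda>s. z s - w s) t"
      by (rule continuous_diff)
    moreover have "norm (z t - w t) > 0"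
      using that by simp
    ultimately obtain \<delta> where "\<delta> > 0" "\<And>s. dist s t < \<delta> \<Longrightarrow> dist (z s - w s) (z t - w t) < norm (z t - w t)"
      unfolding continuous_at_eps_delta by blast
    moreover from this have "z s \<noteq> w s" if "\<bar>s - t\<bar> < \<delta>" for s
      using that by (metis cancel_comm_monoid_add_class.diff_cancel diff_0 dist_norm dist_real_def
          less_irrefl norm_minus_cancel)
    ultimately show ?thesis
      by blast
  qed
qed

section \<open>Smooth curves in the model spaces\<close>

definition curve_lift :: "nat \<Rightarrow> (real \<Rightarrow> ('e::real_normed_vector) coord) \<Rightarrow> real \<Rightarrow> 'e coord"
  where "curve_lift r c t = join r (c t) (vector_derivative c (at t))"

text \<open>The counterpart of \<open>tsmooth\<close> for curves: all iterated velocity curves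
  exist, as curves in the model spaces of the iterated tangent bundles.\<close>

coinductive csmooth :: "nat \<Rightarrow> real set \<Rightarrow> (real \<Rightarrow> ('e::real_normed_vector) coord) \<Rightarrow> bool"
  where "open I \<Longrightarrow> (\<And>t. t \<in> I \<Longrightarrow> c t \<in> model r) \<Longrightarrow> (\<And>t. t \<in> I \<Longrightarrow> c differentiable (at t)) \<Longrightarrow>
    csmooth (Suc r) I (curve_lift r c) \<Longrightarrow> csmooth r I c"

lemma csmooth_coinduct:
  assumes "P r I c"
    and "\<And>r I c. P r I c \<Longrightarrow> open I \<and> (\<forall>t\<in>I. c t \<in> model r) \<and> (\<forall>t\<in>I. c differentiable (at t)) \<and>
      P (Suc r) I (curve_lift r c)"
  shows "csmooth r I c"
  by (rule csmooth.coinduct[of P, OF assms(1)]) (drule assms(2), simp)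

lemma csmooth_cases:
  assumes "csmooth r I c"
  shows "open I" "\<And>t. t \<in> I \<Longrightarrow> c t \<in> model r" "\<And>t. t \<in> I \<Longrightarrow> c differentiable (at t)"
    "csmooth (Suc r) I (curve_lift r c)"
  using assms by (auto elim: csmooth.cases)

lemma vector_derivative_in_model:
  assumes "(c has_vector_derivative c') (at t)" "open I" "t \<in> I" "\<And>s. s \<in> I \<Longrightarrow> c s \<in> model r"
  shows "c' \<in> model r"
proof -
  have "((\<lambda>s. trunc r (c s)) has_vector_derivative trunc r c') (at t)"
    by (rule bounded_linear.has_vector_derivative[OF bounded_linear_trunc assms(1)])
  then have "(c has_vector_derivative trunc r c') (at t)"
    by (rule has_vector_derivative_transform_within_open[OF _ assms(2,3)]) (simp add: assms(4))
  then have "c' = trunc r c'"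
    using assms(1) vector_derivative_unique_at by blast
  then show ?thesis
    by (metis trunc_in_model)
qed

lemma has_vector_derivative_comp:
  assumes c: "(c has_vector_derivative c') (at t)" and I: "open I" "t \<in> I"
    and m: "\<And>s. s \<in> I \<Longrightarrow> c s \<in> model r" and f: "tdiff r f (c t)"
  shows "((\<lambda>s. f (c s)) has_vector_derivative dd r f (c t) c') (at t)"
proof -
  have "(c has_derivative (\<lambda>h. h *\<^sub>R c')) (at t)"
    using c by (simp add: has_vector_derivative_def)
  from has_derivative_compose[OF this tdiffD[OF f]]
  have "((\<lambda>s. f (trunc r (c s))) has_derivative (\<lambda>h. dd r f (c t) (h *\<^sub>R c'))) (at t)" .
  then have "((\<lambda>s. f (trunc r (c s))) has_vector_derivative dd r f (c t) c') (at t)"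
    using dd_linear[OF f] by (simp add: has_vector_derivative_def bounded_linear.linear linear_scale)
  then show ?thesis
    by (rule has_vector_derivative_transform_within_open[OF _ I]) (simp add: m)
qed

text \<open>The lift of f o c is the tangent map of f applied to the lift of c, so this form
  survives each passage to velocities. The restriction to I' is built in because curves are later
  cut to the times at which they lie in another chart.\<close>

lemma csmooth_comp:
  assumes f: "tsmooth r s U f" and c: "csmooth r I c" and cU: "c ` I \<subseteq> U"
    and I': "open I'" "I' \<subseteq> I" and k: "\<And>t. t \<in> I' \<Longrightarrow> k t = f (c t)"
  shows "csmooth s I' k"
proof -
  define P where "P = (\<lambda>s I k. open I \<and> (\<exists>r U f c. tsmooth r s U f \<and> csmooth r I c \<and> c ` I \<subseteq> U \<and>
    (\<forall>t\<in>I. k t = (f (c t) :: 'a coord))))"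
  have restrict: "csmooth r I' c"
  proof -
    have "csmooth r I c \<and> open I' \<and> I' \<subseteq> I"
      using c I' by blast
    then show ?thesis
    proof (rule csmooth_coinduct[of "\<lambda>r I' c. csmooth r I c \<and> open I' \<and> I' \<subseteq> I"])
      fix r I' and c :: "real \<Rightarrow> 'a coord"
      assume *: "csmooth r I c \<and> open I' \<and> I' \<subseteq> I"
      then show "open I' \<and> (\<forall>t\<in>I'. c t \<in> model r) \<and> (\<forall>t\<in>I'. c differentiable (at t)) \<and>
          csmooth (Suc r) I (curve_lift r c) \<and> open I' \<and> I' \<subseteq> I"
        using csmooth_cases[of r I c] by auto
    qed
  qed
  have "P s I' k"
    unfolding P_def using f restrict cU I' k by blast
  then show ?thesis
  proof (rule csmooth_coinduct)
    fix s I k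
    assume step: "P s I k"
    from step obtain r U f c where *: "tsmooth r s U f" "csmooth r I c" "c ` I \<subseteq> U"
      "\<And>t. t \<in> I \<Longrightarrow> k t = f (c t)" and I: "open I"
      unfolding P_def by blast
    note f = tsmooth_cases[OF *(1)] and c = csmooth_cases[OF *(2)]
    have cd: "(c has_vector_derivative vector_derivative c (at t)) (at t)" if "t \<in> I" for t
      using c(3)[OF that] vector_derivative_works by blast
    have kd: "(k has_vector_derivative dd r f (c t) (vector_derivative c (at t))) (at t)" if t: "t \<in> I" for t
    proof -
      have "((\<lambda>t. f (c t)) has_vector_derivative dd r f (c t) (vector_derivative c (at t))) (at t)"
        using *(3) t by (intro has_vector_derivative_comp[OF cd[OF t] I t c(2)] f(3)) auto
      then show ?thesis
        by (rule has_vector_derivative_transform_within_open[OF _ I t]) (simp add: *(4))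
    qed
    have vm: "vector_derivative c (at t) \<in> model r" if "t \<in> I" for t
      using vector_derivative_in_model[OF cd[OF that] I that c(2)] .
    have "curve_lift s k t = tan_map r s f (curve_lift r c t)" if "t \<in> I" for t
      using vector_derivative_at[OF kd[OF that]] *(4)[OF that] c(2)[OF that] vm[OF that]
      by (simp add: curve_lift_def tan_map_join)
    moreover have "curve_lift r c ` I \<subseteq> tan_dom r U"
      using *(3) vm c(2) by (auto simp: curve_lift_def tan_dom_def)
    ultimately have "P (Suc s) I (curve_lift s k)"
      unfolding P_def using f(4) c(4) I by blast
    moreover have "k t \<in> model s" if "t \<in> I" for t
      using f(2) *(3,4) that by auto
    moreover have "k differentiable (at t)" if "t \<in> I" for t
      using kd[OF that] by (rule differentiableI_vector)
    ultimately show "open I \<and> (\<forall>t\<in>I. k t \<in> model s) \<and> (\<forall>t\<in>I. k differentiable (at t)) \<and>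
        P (Suc s) I (curve_lift s k)"
      using I by blast
  qed
qed

text \<open>If c' = A(c), then the lift (c, A(c)) has derivative (A(c), DA(c) A(c)), which is the
  tangent map of A at the lift. Being an integral curve of some smooth field is thus itself a
  coinductive invariant.\<close>

lemma csmooth_ode:
  assumes "tsmooth r r U A" "open I" "\<And>t. t \<in> I \<Longrightarrow> c t \<in> U \<and> (c has_vector_derivative A (c t)) (at t)"
  shows "csmooth r I c"
proof -
  define P where "P = (\<lambda>r I c. open I \<and> (\<exists>U A. tsmooth r r U A \<and>
    (\<forall>t\<in>I. c t \<in> U \<and> (c has_vector_derivative (A (c t) :: 'a coord)) (at t))))"
  have "P r I c"
    unfolding P_def using assms by blast
  then show ?thesis
  proof (rule csmooth_coinduct)
    fix r I c
    assume step: "P r I c"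
    from step obtain U A where A: "tsmooth r r U A" and c: "\<And>t. t \<in> I \<Longrightarrow> c t \<in> U"
      "\<And>t. t \<in> I \<Longrightarrow> (c has_vector_derivative A (c t)) (at t)" and I: "open I"
      unfolding P_def by blast
    note A' = tsmooth_cases[OF A]
    have cm: "c t \<in> model r" if "t \<in> I" for t
      using tsmooth_mem[OF A c(1)[OF that]] .
    have lift: "curve_lift r c t = join r (c t) (A (c t))" if "t \<in> I" for t
      using vector_derivative_at[OF c(2)[OF that]] by (simp add: curve_lift_def)
    have "(curve_lift r c has_vector_derivative tan_map r r A (curve_lift r c t)) (at t)" if t: "t \<in> I" for t
    proof -
      have 1: "((\<lambda>t. A (c t)) has_vector_derivative dd r A (c t) (A (c t))) (at t)"
        by (rule has_vector_derivative_comp[OF c(2)[OF t] I t cm A'(3)[OF c(1)[OF t]]])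
      have "((\<lambda>t. join r (c t) (A (c t))) has_vector_derivative join r (A (c t)) (dd r A (c t) (A (c t)))) (at t)"
        using bounded_linear.has_vector_derivative[OF bounded_linear_join
            has_vector_derivative_Pair[OF c(2)[OF t] 1]] by simp
      then have "(curve_lift r c has_vector_derivative join r (A (c t)) (dd r A (c t) (A (c t)))) (at t)"
        by (rule has_vector_derivative_transform_within_open[OF _ I t]) (simp add: lift)
      then show ?thesis
        using cm[OF t] A'(2)[OF c(1)[OF t]] by (simp add: lift[OF t] tan_map_join)
    qed
    moreover have "curve_lift r c t \<in> tan_dom r U" if "t \<in> I" for t
      using c(1)[OF that] cm[OF that] A'(2)[OF c(1)[OF that]] by (simp add: lift[OF that] tan_dom_def)
    ultimately have "P (Suc r) I (curve_lift r c)"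
      unfolding P_def using A'(4) I by blast
    moreover have "c differentiable (at t)" if "t \<in> I" for t
      using c(2)[OF that] by (rule differentiableI_vector)
    ultimately show "open I \<and> (\<forall>t\<in>I. c t \<in> model r) \<and> (\<forall>t\<in>I. c differentiable (at t)) \<and>
        P (Suc r) I (curve_lift r c)"
      using I cm by blast
  qed
qed

text \<open>The derivative is a linear image of the lift.\<close>

lemma csmooth_vector_derivative:
  assumes "csmooth r I c"
  shows "csmooth r I (\<lambda>t. vector_derivative c (at t))"
proof (rule csmooth_comp)
  note c = csmooth_cases[OF assms]
  show "csmooth (Suc r) I (curve_lift r c)" "open I"
    by (fact c)+
  show "tsmooth (Suc r) r (model (Suc r)) (shift r)"
    by (rule tsmooth_linear[OF bounded_linear_shift]) (auto simp: mopen_def)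
  show "curve_lift r c ` I \<subseteq> model (Suc r)"
    using csmooth_cases(2)[OF c(4)] by blast
  show "vector_derivative c (at t) = shift r (curve_lift r c t)" if "t \<in> I" for t
    using vector_derivative_in_model[OF vector_derivative_works[THEN iffD1, OF c(3)[OF that]] c(1) that c(2)]
    by (simp add: curve_lift_def)
qed auto

lemma csmooth_derivs:
  assumes "csmooth r I c"
  obtains d where "d 0 = c" "\<And>k t. t \<in> I \<Longrightarrow> (d k has_vector_derivative d (Suc k) t) (at t)"
proof -
  define d where "d k = ((\<lambda>c t. vector_derivative c (at t)) ^^ k) c" for k
  have cs: "csmooth r I (d k)" for k
    by (induction k) (auto simp: d_def assms csmooth_vector_derivative)
  have "(d k has_vector_derivative d (Suc k) t) (at t)" if "t \<in> I" for k t
  proof -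
    have "d (Suc k) t = vector_derivative (d k) (at t)"
      by (simp add: d_def)
    then show ?thesis
      using csmooth_cases(3)[OF cs that] by (simp add: vector_derivative_works)
  qed
  moreover have "d 0 = c"
    by (simp add: d_def)
  ultimately show ?thesis
    using that by blast
qed

lemma bounded_multilinear_on_prod_list:
  "bounded_multilinear_on UNIV k (\<lambda>vs. prod_list vs *\<^sub>R (w :: 'a::real_normed_vector))"
  unfolding bounded_multilinear_on_def
proof (intro conjI allI impI ballI exI[of _ "norm w"])
  fix vs :: "real list" and j and u v a :: real
  assume "length vs = k \<and> set vs \<subseteq> UNIV" "j < k"
  then have j: "j < length vs" by simp
  then show "prod_list (vs[j := u + a *\<^sub>R v]) *\<^sub>R w =
      prod_list (vs[j := u]) *\<^sub>R w + a *\<^sub>R prod_list (vs[j := v]) *\<^sub>R w"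
    by (simp add: upd_conv_take_nth_drop algebra_simps)
next
  fix vs :: "real list"
  have "\<bar>prod_list vs\<bar> = (\<Prod>v\<leftarrow>vs. norm v)" for vs :: "real list"
    by (induction vs) (auto simp: abs_mult)
  then show "norm (prod_list vs *\<^sub>R w) \<le> norm w * (\<Prod>v\<leftarrow>vs. norm v)"
    by simp
qed

text \<open>A k-linear map on the line is determined by one vector, so the k-th derivative in the
  sense of \<open>smooth_on\<close> is the product of the arguments times the k-fold derivative
  vector.\<close>

lemma csmooth_imp_smooth_on:
  assumes "csmooth r I c"
  shows "smooth_on UNIV I c"
proof -
  obtain d where d: "d 0 = c" "\<And>k t. t \<in> I \<Longrightarrow> (d k has_vector_derivative d (Suc k) t) (at t)"
    using csmooth_derivs[OF assms] by blast
  have abs_prod: "\<bar>prod_list vs\<bar> = (\<Prod>v\<leftarrow>vs. norm v)" for vs :: "real list"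
    by (induction vs) (auto simp: abs_mult)
  show ?thesis
    unfolding smooth_on_def
  proof (intro exI[of _ "\<lambda>k t vs. prod_list vs *\<^sub>R d k t"] conjI ballI allI impI bounded_multilinear_on_prod_list)
    show "prod_list [] *\<^sub>R d 0 t = c t" for t
      by (simp add: d)
    fix k and t e :: real assume t: "t \<in> I" and e: "e > 0"
    have "(d k has_derivative (\<lambda>h. h *\<^sub>R d (Suc k) t)) (at t)"
      using d(2)[OF t] by (simp add: has_vector_derivative_def)
    then obtain \<delta> where \<delta>: "\<delta> > 0" "\<And>s. norm (s - t) < \<delta> \<Longrightarrow>
        norm (d k s - d k t - (s - t) *\<^sub>R d (Suc k) t) \<le> e * norm (s - t)"
      using e unfolding has_derivative_at_alt by blast
    have "norm (prod_list vs *\<^sub>R d k s - prod_list vs *\<^sub>R d k t - prod_list ((s - t) # vs) *\<^sub>R d (Suc k) t)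
        \<le> e * norm (s - t) * (\<Prod>v\<leftarrow>vs. norm v)" if "norm (s - t) < \<delta>" for s vs
    proof -
      have "prod_list vs *\<^sub>R d k s - prod_list vs *\<^sub>R d k t - prod_list ((s - t) # vs) *\<^sub>R d (Suc k) t =
          prod_list vs *\<^sub>R (d k s - d k t - (s - t) *\<^sub>R d (Suc k) t)"
        by (simp add: algebra_simps)
      also have "norm \<dots> \<le> \<bar>prod_list vs\<bar> * (e * norm (s - t))"
        unfolding norm_scaleR by (intro mult_left_mono \<delta>(2) that) simp
      finally show ?thesis
        by (simp add: abs_prod mult.commute)
    qed
    then show "\<exists>\<delta>>0. \<forall>s\<in>I. norm (s - t) < \<delta> \<longrightarrow> (\<forall>vs. length vs = k \<and> set vs \<subseteq> UNIV \<longrightarrow>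
        norm (prod_list vs *\<^sub>R d k s - prod_list vs *\<^sub>R d k t - prod_list ((s - t) # vs) *\<^sub>R d (Suc k) t)
          \<le> e * norm (s - t) * (\<Prod>v\<leftarrow>vs. norm v))"
      using \<delta>(1) by blast
  qed
qed

section \<open>Curves in the limit of the model spaces\<close>

lemma has_vector_derivative_iff_quotient:
  fixes f :: "real \<Rightarrow> 'a::real_normed_vector"
  shows "(f has_vector_derivative D) (at t) \<longleftrightarrow> ((\<lambda>s. (f s - f t) /\<^sub>R (s - t)) \<longlongrightarrow> D) (at t)"
proof -
  have "norm (f s - f t - (s - t) *\<^sub>R D) / norm (s - t) = norm ((f s - f t) /\<^sub>R (s - t) - D)"
    if "s \<noteq> t" for s
  proof -
    have "(f s - f t) /\<^sub>R (s - t) - D = (f s - f t - (s - t) *\<^sub>R D) /\<^sub>R (s - t)"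
      using that by (simp add: scaleR_diff_right)
    then show ?thesis
      by (simp add: divide_inverse mult.commute)
  qed
  then have "\<forall>\<^sub>F s in at t. norm (f s - f t - (s - t) *\<^sub>R D) / norm (s - t) =
      norm ((f s - f t) /\<^sub>R (s - t) - D)"
    by (simp add: eventually_at_filter)
  from tendsto_cong[OF this, of 0] show ?thesis
    by (simp add: has_vector_derivative_def has_derivative_iff_norm bounded_linear_scaleR_left
        tendsto_norm_zero_iff LIM_zero_iff)
qed

text \<open>The limit in \<open>smooth_frechet_curve\<close> is taken in the product topology; this
  splits it into one condition for each level.\<close>

lemma tendsto_product_iff:
  fixes f :: "'a \<Rightarrow> 'b \<Rightarrow> 'c::topological_space"
  shows "(f \<longlongrightarrow> l) F \<longleftrightarrow> (\<forall>i. ((\<lambda>x. f x i) \<longlongrightarrow> l i) F)"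
  using limitin_componentwise[of "\<lambda>_. euclidean" UNIV f l F]
  by (simp add: euclidean_product_topology limitin_canonical_iff)

lemma smooth_frechet_curveI:
  assumes "\<And>i. csmooth (r i) I (\<lambda>t. c t i)"
  shows "smooth_frechet_curve I c"
proof -
  have "\<exists>d. d 0 = (\<lambda>t. c t i) \<and> (\<forall>k. \<forall>t\<in>I. (d k has_vector_derivative d (Suc k) t) (at t))" for i
    using csmooth_derivs[OF assms[of i]] by metis
  then obtain d where d: "\<And>i. d i 0 = (\<lambda>t. c t i)"
    "\<And>i k t. t \<in> I \<Longrightarrow> (d i k has_vector_derivative d i (Suc k) t) (at t)"
    by metis
  show ?thesis
    unfolding smooth_frechet_curve_def
  proof (intro exI[of _ "\<lambda>k t i. d i k t"] ballI conjI allI)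
    fix t assume t: "t \<in> I"
    show "(\<lambda>i. d i 0 t) = c t"
      by (simp add: d)
    show "((\<lambda>s. (\<lambda>i. (d i k s - d i k t) /\<^sub>R (s - t))) \<longlongrightarrow> (\<lambda>i. d i (Suc k) t)) (at t)" for k
      using d(2)[OF t] by (simp add: tendsto_product_iff has_vector_derivative_iff_quotient)
  qed
qed

lemma smooth_frechet_curveD:
  assumes "smooth_frechet_curve I c"
  obtains d where "\<And>t. t \<in> I \<Longrightarrow> d 0 t = c t"
    "\<And>t k i. t \<in> I \<Longrightarrow> ((\<lambda>s. d k s i) has_vector_derivative d (Suc k) t i) (at t)"
proof -
  obtain d where d: "\<And>t. t \<in> I \<Longrightarrow> d 0 t = c t"
    "\<And>t k. t \<in> I \<Longrightarrow> ((\<lambda>s. (\<lambda>i. (d k s i - d k t i) /\<^sub>R (s - t))) \<longlongrightarrow> d (Suc k) t) (at t)"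
    using assms unfolding smooth_frechet_curve_def by blast
  have "((\<lambda>s. d k s i) has_vector_derivative d (Suc k) t i) (at t)" if "t \<in> I" for t k i
    using d(2)[OF that, of k] by (simp add: tendsto_product_iff has_vector_derivative_iff_quotient)
  with d(1) show ?thesis
    using that by blast
qed

section \<open>Charts of the iterated tangent bundles\<close>

text \<open>The image of a chart of T^r M over the base set V: coordinate 0 is the base point in E,
  and the other 2^r - 1 coordinates are free fibre coordinates.\<close>

definition cyl :: "nat \<Rightarrow> 'e set \<Rightarrow> ('e::real_normed_vector) coord set"
  where "cyl r V = {v \<in> model r. apply_bcontfun v 0 \<in> V}"

text \<open>The case \<alpha> = \<beta> is the full image of the chart.\<close>

definition overlap :: "('m, 'i, 'e::real_normed_vector) atlas \<Rightarrow> 'i \<Rightarrow> 'i \<Rightarrow> 'e set"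
  where "overlap M \<alpha> \<beta> = chart M \<alpha> ` (chart_dom M \<alpha> \<inter> chart_dom M \<beta>)"

text \<open>The r-th tangent map of the coordinate change from \<alpha> to \<beta>. That it really
  changes coordinates on T^r M is part of \<open>good_charts\<close>.\<close>

primrec trans_map ::
    "('m, 'i, 'e::real_normed_vector) atlas \<Rightarrow> 'i \<Rightarrow> 'i \<Rightarrow> nat \<Rightarrow> 'e coord \<Rightarrow> 'e coord"
  where
    "trans_map M \<alpha> \<beta> 0 = (\<lambda>v. embed ((chart M \<beta> \<circ> chart_inv M \<alpha>) (apply_bcontfun v 0)))"
  | "trans_map M \<alpha> \<beta> (Suc r) = tan_map r r (trans_map M \<alpha> \<beta> r)"

lemma apply_join_0 [simp]: "apply_bcontfun (join r x y) 0 = apply_bcontfun x 0"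
  by (simp add: apply_join)

lemma apply_trunc_0 [simp]: "apply_bcontfun (trunc r x) 0 = apply_bcontfun x 0"
  by (simp add: apply_trunc)

lemma apply_flip_0 [simp]: "apply_bcontfun (flip r x) 0 = apply_bcontfun x 0"
  by (simp add: flip_def)

lemma mopen_cyl: "open V \<Longrightarrow> mopen r (cyl r V)"
  using open_vimage[OF _ linear_continuous_on[OF bounded_linear_apply_0], of V]
  by (auto simp: mopen_def cyl_def vimage_def)

lemma tan_dom_cyl: "tan_dom r (cyl r V) = cyl (Suc r) V"
  by (auto simp: tan_dom_def cyl_def)

lemma join_in_cyl: "y \<in> model r \<Longrightarrow> join r x y \<in> cyl (Suc r) V \<longleftrightarrow> apply_bcontfun x 0 \<in> V"
  by (simp add: cyl_def)

lemma overlap_subset: "overlap M \<alpha> \<beta> \<subseteq> overlap M \<alpha> \<alpha>"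
  by (auto simp: overlap_def)

lemma banach_manifold_overlap:
  assumes "banach_manifold M"
  shows "open (overlap M \<alpha> \<beta>)" "inj_on (chart M \<alpha>) (chart_dom M \<alpha>)"
    "smooth_on UNIV (overlap M \<alpha> \<beta>) (chart M \<beta> \<circ> chart_inv M \<alpha>)"
  using assms unfolding banach_manifold_def overlap_def Let_def by blast+

lemma trans_map_tsmooth:
  assumes "banach_manifold M"
  shows "tsmooth r r (cyl r (overlap M \<alpha> \<beta>)) (trans_map M \<alpha> \<beta> r)"
proof (induction r)
  case 0
  have "tsmooth 0 0 (cyl 0 (overlap M \<alpha> \<beta>))
      (\<lambda>q. embed ((chart M \<beta> \<circ> chart_inv M \<alpha>) (apply_bcontfun q 0)))"
    by (rule smooth_on_imp_tsmooth[OF banach_manifold_overlap(3)[OF assms] _ bounded_linear_apply_0 _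
          bounded_linear_embed _ mopen_cyl[OF banach_manifold_overlap(1)[OF assms]]])
      (auto simp: cyl_def model_def apply_embed)
  then show ?case by simp
next
  case (Suc r)
  from tsmooth_cases(4)[OF Suc] show ?case
    by (simp add: tan_dom_cyl)
qed

text \<open>Manifold notions are stated with derivatives within the subspace; this passes to
  derivatives on the whole space, which are unique. The two are compared only on directions in the
  subspace.\<close>

lemma within_model_derivative:
  assumes "mopen r U" "x \<in> U" "\<And>y. y \<in> U \<Longrightarrow> g y = f y"
    and g: "(g has_derivative L) (at x within model r)"
  shows "tdiff r f x" "v \<in> model r \<Longrightarrow> dd r f x v = L v"
proof -
  have x: "trunc r x = x"
    using assms(1,2) by (auto simp: mopen_def)
  have "(trunc r has_derivative trunc r) (at x)"
    by (rule bounded_linear_imp_has_derivative[OF bounded_linear_trunc])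
  moreover have "(g has_derivative L) (at (trunc r x) within range (trunc r))"
    using g unfolding x by (rule has_derivative_subset) auto
  ultimately have "((\<lambda>y. g (trunc r y)) has_derivative (\<lambda>v. L (trunc r v))) (at x)"
    by (rule has_derivative_in_compose)
  then have *: "((\<lambda>y. f (trunc r y)) has_derivative (\<lambda>v. L (trunc r v))) (at x)"
    by (rule mopen_transform[OF assms(1,2), rotated]) (simp add: assms(3))
  then show "tdiff r f x"
    by (rule tdiffI)
  show "v \<in> model r \<Longrightarrow> dd r f x v = L v"
    using dd_eqI[OF *] by simp
qed

lemma has_derivative_within_model:
  assumes "mopen r U" "x \<in> U" "\<And>y. y \<in> U \<Longrightarrow> g y = f y" "tdiff r f x"
  shows "(g has_derivative dd r f x) (at x within model r)"
proof -
  obtain \<delta> where \<delta>: "\<delta> > 0" "\<And>y. norm (y - x) < \<delta> \<Longrightarrow> trunc r y \<in> U"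
    using mopen_ball[OF assms(1,2)] by blast
  have "((\<lambda>y. f (trunc r y)) has_derivative dd r f x) (at x within model r)"
    by (rule has_derivative_at_withinI[OF tdiffD[OF assms(4)]])
  then show ?thesis
  proof (rule has_derivative_transform_within[OF _ \<delta>(1)])
    show "x \<in> model r"
      using assms(1,2) by (auto simp: mopen_def)
    show "f (trunc r y) = g y" if "y \<in> model r" "dist y x < \<delta>" for y
      using \<delta>(2)[of y] that assms(3) by (simp add: dist_norm)
  qed
qed

text \<open>The invariant for the induction over r. The tangent spaces of level r + 1 are defined by
  derivatives of the coordinate changes of level r, so these changes must already be identified with
  the smooth maps \<open>trans_map\<close>, on domains determined by the base point.\<close>

definition good_charts :: "('m, 'i, 'e::real_normed_vector) atlas \<Rightarrow> nat \<Rightarrow> bool"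
  where "good_charts M r \<longleftrightarrow>
    (\<forall>\<alpha>. bij_betw (chart (Tpow M r) \<alpha>) (chart_dom (Tpow M r) \<alpha>) (cyl r (overlap M \<alpha> \<alpha>))) \<and>
    (\<forall>\<alpha> \<beta>. \<forall>p\<in>chart_dom (Tpow M r) \<alpha>.
      (p \<in> chart_dom (Tpow M r) \<beta> \<longleftrightarrow> chart (Tpow M r) \<alpha> p \<in> cyl r (overlap M \<alpha> \<beta>)) \<and>
      (p \<in> chart_dom (Tpow M r) \<beta> \<longrightarrow>
        chart (Tpow M r) \<beta> p = trans_map M \<alpha> \<beta> r (chart (Tpow M r) \<alpha> p)))"

lemma good_chartsD:
  assumes "good_charts M r"
  shows "inj_on (chart (Tpow M r) \<alpha>) (chart_dom (Tpow M r) \<alpha>)"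
    "p \<in> chart_dom (Tpow M r) \<alpha> \<Longrightarrow> chart (Tpow M r) \<alpha> p \<in> cyl r (overlap M \<alpha> \<alpha>)"
    "v \<in> cyl r (overlap M \<alpha> \<alpha>) \<Longrightarrow> chart_inv (Tpow M r) \<alpha> v \<in> chart_dom (Tpow M r) \<alpha>"
    "v \<in> cyl r (overlap M \<alpha> \<alpha>) \<Longrightarrow> chart (Tpow M r) \<alpha> (chart_inv (Tpow M r) \<alpha> v) = v"
    "p \<in> chart_dom (Tpow M r) \<alpha> \<Longrightarrow> chart_inv (Tpow M r) \<alpha> (chart (Tpow M r) \<alpha> p) = p"
    "p \<in> chart_dom (Tpow M r) \<alpha> \<Longrightarrow>
      p \<in> chart_dom (Tpow M r) \<beta> \<longleftrightarrow> chart (Tpow M r) \<alpha> p \<in> cyl r (overlap M \<alpha> \<beta>)"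
    "p \<in> chart_dom (Tpow M r) \<alpha> \<Longrightarrow> p \<in> chart_dom (Tpow M r) \<beta> \<Longrightarrow>
      chart (Tpow M r) \<beta> p = trans_map M \<alpha> \<beta> r (chart (Tpow M r) \<alpha> p)"
proof -
  have b: "bij_betw (chart (Tpow M r) \<alpha>) (chart_dom (Tpow M r) \<alpha>) (cyl r (overlap M \<alpha> \<alpha>))"
    using assms unfolding good_charts_def by blast
  show "inj_on (chart (Tpow M r) \<alpha>) (chart_dom (Tpow M r) \<alpha>)"
    using b by (simp add: bij_betw_def)
  then show "p \<in> chart_dom (Tpow M r) \<alpha> \<Longrightarrow> chart_inv (Tpow M r) \<alpha> (chart (Tpow M r) \<alpha> p) = p"
    by (simp add: chart_inv_def)
  show "p \<in> chart_dom (Tpow M r) \<alpha> \<Longrightarrow> chart (Tpow M r) \<alpha> p \<in> cyl r (overlap M \<alpha> \<alpha>)"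
    using b bij_betwE by blast
  have im: "chart (Tpow M r) \<alpha> ` chart_dom (Tpow M r) \<alpha> = cyl r (overlap M \<alpha> \<alpha>)"
    using b by (simp add: bij_betw_def)
  show "v \<in> cyl r (overlap M \<alpha> \<alpha>) \<Longrightarrow> chart_inv (Tpow M r) \<alpha> v \<in> chart_dom (Tpow M r) \<alpha>"
    unfolding chart_inv_def im[symmetric] by (rule inv_into_into)
  show "v \<in> cyl r (overlap M \<alpha> \<alpha>) \<Longrightarrow> chart (Tpow M r) \<alpha> (chart_inv (Tpow M r) \<alpha> v) = v"
    unfolding chart_inv_def im[symmetric] by (rule f_inv_into_f)
  show "p \<in> chart_dom (Tpow M r) \<alpha> \<Longrightarrow>
      p \<in> chart_dom (Tpow M r) \<beta> \<longleftrightarrow> chart (Tpow M r) \<alpha> p \<in> cyl r (overlap M \<alpha> \<beta>)"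
    "p \<in> chart_dom (Tpow M r) \<alpha> \<Longrightarrow> p \<in> chart_dom (Tpow M r) \<beta> \<Longrightarrow>
      chart (Tpow M r) \<beta> p = trans_map M \<alpha> \<beta> r (chart (Tpow M r) \<alpha> p)"
    using assms unfolding good_charts_def by blast+
qed

lemma local_trans:
  assumes g: "good_charts M r" and v: "v \<in> cyl r (overlap M \<alpha> \<beta>)"
  shows "chart_inv (Tpow M r) \<alpha> v \<in> chart_dom (Tpow M r) \<alpha> \<inter> chart_dom (Tpow M r) \<beta>"
    "(chart (Tpow M r) \<beta> \<circ> chart_inv (Tpow M r) \<alpha>) v = trans_map M \<alpha> \<beta> r v"
proof -
  have v': "v \<in> cyl r (overlap M \<alpha> \<alpha>)"
    using v overlap_subset[of M \<alpha> \<beta>] by (auto simp: cyl_def)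
  show *: "chart_inv (Tpow M r) \<alpha> v \<in> chart_dom (Tpow M r) \<alpha> \<inter> chart_dom (Tpow M r) \<beta>"
    using good_chartsD(3)[OF g v'] good_chartsD(6)[OF g good_chartsD(3)[OF g v'], of \<beta>]
      good_chartsD(4)[OF g v'] v by simp
  show "(chart (Tpow M r) \<beta> \<circ> chart_inv (Tpow M r) \<alpha>) v = trans_map M \<alpha> \<beta> r v"
    using good_chartsD(7)[OF g, of "chart_inv (Tpow M r) \<alpha> v" \<alpha> \<beta>] * good_chartsD(4)[OF g v'] by simp
qed

section \<open>Tangent vectors and their components\<close>

lemma trans_map_cocycle:
  assumes M: "banach_manifold M" and g: "good_charts M r"
    and p: "p \<in> chart_dom (Tpow M r) \<alpha>" "p \<in> chart_dom (Tpow M r) \<beta>" "p \<in> chart_dom (Tpow M r) \<gamma>"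
  shows "dd r (trans_map M \<alpha> \<gamma> r) (chart (Tpow M r) \<alpha> p) v =
    dd r (trans_map M \<beta> \<gamma> r) (chart (Tpow M r) \<beta> p) (dd r (trans_map M \<alpha> \<beta> r) (chart (Tpow M r) \<alpha> p) v)"
proof -
  let ?x = "chart (Tpow M r) \<alpha> p"
  \<comment> \<open>The triple overlap seen in the chart \<alpha>, where the coordinate changes
    compose.\<close>
  let ?U = "cyl r (overlap M \<alpha> \<beta>) \<inter> cyl r (overlap M \<alpha> \<gamma>)"
  note ts = trans_map_tsmooth[OF M]
  have U: "mopen r ?U"
    by (intro mopen_Int mopen_cyl banach_manifold_overlap(1)[OF M])
  have x: "?x \<in> ?U"
    using good_chartsD(6)[OF g p(1), of \<beta>] good_chartsD(6)[OF g p(1), of \<gamma>] p by simp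
  have b: "trans_map M \<alpha> \<beta> r ?x = chart (Tpow M r) \<beta> p"
    using good_chartsD(7)[OF g p(1,2)] by simp
  have c: "trans_map M \<alpha> \<beta> r y \<in> cyl r (overlap M \<beta> \<gamma>) \<and>
      trans_map M \<alpha> \<gamma> r y = trans_map M \<beta> \<gamma> r (trans_map M \<alpha> \<beta> r y)" if "y \<in> ?U" for y
  proof -
    let ?p = "chart_inv (Tpow M r) \<alpha> y"
    have p: "?p \<in> chart_dom (Tpow M r) \<alpha>" "?p \<in> chart_dom (Tpow M r) \<beta>" "?p \<in> chart_dom (Tpow M r) \<gamma>"
      using local_trans(1)[OF g] that by blast+
    have e: "chart (Tpow M r) \<beta> ?p = trans_map M \<alpha> \<beta> r y" "chart (Tpow M r) \<gamma> ?p = trans_map M \<alpha> \<gamma> r y"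
      using local_trans(2)[OF g] that by auto
    show ?thesis
      using good_chartsD(6)[OF g p(2), of \<gamma>] good_chartsD(7)[OF g p(2,3)] p(3) e by simp
  qed
  have tb: "tdiff r (trans_map M \<alpha> \<beta> r) ?x"
    using tsmooth_cases(3)[OF ts] x by blast
  have tc: "tdiff r (trans_map M \<beta> \<gamma> r) (trans_map M \<alpha> \<beta> r ?x)"
    using tsmooth_cases(3)[OF ts] c[OF x] by blast
  have im: "trans_map M \<alpha> \<beta> r ` ?U \<subseteq> cyl r (overlap M \<beta> \<gamma>)" "cyl r (overlap M \<beta> \<gamma>) \<subseteq> model r"
    using c by (auto simp: cyl_def)
  have "dd r (trans_map M \<alpha> \<gamma> r) ?x = dd r (\<lambda>y. trans_map M \<beta> \<gamma> r (trans_map M \<alpha> \<beta> r y)) ?x"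
    using c by (intro tdiff_cong(2)[OF U x _ dd_comp(1)[OF U x im tb tc]]) auto
  then show ?thesis
    using dd_comp(2)[OF U x im tb tc, of v] b by simp
qed

lemma dd_trans_map_self:
  assumes M: "banach_manifold M" and g: "good_charts M r"
    and p: "p \<in> chart_dom (Tpow M r) \<alpha>" and v: "v \<in> model r"
  shows "dd r (trans_map M \<alpha> \<alpha> r) (chart (Tpow M r) \<alpha> p) v = v"
proof -
  let ?x = "chart (Tpow M r) \<alpha> p"
  let ?U = "cyl r (overlap M \<alpha> \<alpha>)"
  have U: "mopen r ?U"
    by (intro mopen_cyl banach_manifold_overlap(1)[OF M])
  have x: "?x \<in> ?U"
    by (rule good_chartsD(2)[OF g p])
  have "trans_map M \<alpha> \<alpha> r y = y" if "y \<in> ?U" for y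
    using local_trans(2)[OF g that] good_chartsD(4)[OF g that] by simp
  then have "dd r (trans_map M \<alpha> \<alpha> r) ?x = dd r (\<lambda>y. y) ?x"
    by (intro tdiff_cong(2)[OF U x _ tan_map_linear(1)]) (auto simp: bounded_linear_ident)
  then show ?thesis
    using tan_map_linear(2)[OF bounded_linear_ident, of r ?x v] v by simp
qed

lemma tangent_spaceD:
  assumes M: "banach_manifold M" and g: "good_charts M r" and q: "q \<in> tangent_space r (Tpow M r) p"
  shows "proj q = p" "q = Tan p (vcomp q)" "p \<in> chart_dom (Tpow M r) \<alpha> \<Longrightarrow> vcomp q \<alpha> \<in> model r"
    "p \<notin> chart_dom (Tpow M r) \<alpha> \<Longrightarrow> vcomp q \<alpha> = 0"
    "p \<in> chart_dom (Tpow M r) \<alpha> \<Longrightarrow> p \<in> chart_dom (Tpow M r) \<beta> \<Longrightarrow>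
      vcomp q \<beta> = dd r (trans_map M \<alpha> \<beta> r) (chart (Tpow M r) \<alpha> p) (vcomp q \<alpha>)"
proof -
  obtain w where w: "q = Tan p w"
    "\<And>\<alpha>. if p \<in> chart_dom (Tpow M r) \<alpha> then w \<alpha> \<in> model r else w \<alpha> = 0"
    "\<And>\<alpha> \<beta>. p \<in> chart_dom (Tpow M r) \<alpha> \<inter> chart_dom (Tpow M r) \<beta> \<Longrightarrow>
      \<exists>L. ((chart (Tpow M r) \<beta> \<circ> chart_inv (Tpow M r) \<alpha>) has_derivative L)
        (at (chart (Tpow M r) \<alpha> p) within model r) \<and> w \<beta> = L (w \<alpha>)"
    using q unfolding tangent_space_def by blast
  show "proj q = p" "q = Tan p (vcomp q)"
    by (simp_all add: w(1))
  show m: "p \<in> chart_dom (Tpow M r) \<alpha> \<Longrightarrow> vcomp q \<alpha> \<in> model r"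
    "p \<notin> chart_dom (Tpow M r) \<alpha> \<Longrightarrow> vcomp q \<alpha> = 0"
    using w(2)[of \<alpha>] by (simp_all add: w(1))
  assume p: "p \<in> chart_dom (Tpow M r) \<alpha>" "p \<in> chart_dom (Tpow M r) \<beta>"
  then obtain L where L: "((chart (Tpow M r) \<beta> \<circ> chart_inv (Tpow M r) \<alpha>) has_derivative L)
        (at (chart (Tpow M r) \<alpha> p) within model r)" "w \<beta> = L (w \<alpha>)"
    using w(3) by blast
  have x: "chart (Tpow M r) \<alpha> p \<in> cyl r (overlap M \<alpha> \<beta>)"
    using good_chartsD(6)[OF g p(1), of \<beta>] p by simp
  have "dd r (trans_map M \<alpha> \<beta> r) (chart (Tpow M r) \<alpha> p) (w \<alpha>) = L (w \<alpha>)"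
    by (rule within_model_derivative(2)[OF mopen_cyl[OF banach_manifold_overlap(1)[OF M]] x local_trans(2)[OF g] L(1)])
      (use m(1) p w(1) in auto)
  then show "vcomp q \<beta> = dd r (trans_map M \<alpha> \<beta> r) (chart (Tpow M r) \<alpha> p) (vcomp q \<alpha>)"
    using L(2) by (simp add: w(1))
qed

text \<open>One component determines a consistent family: transport by the derivatives of the
  coordinate changes satisfies the transformation rule by the cocycle identity.\<close>

lemma tangent_vector_exists:
  assumes M: "banach_manifold M" and g: "good_charts M r"
    and p: "p \<in> chart_dom (Tpow M r) \<alpha>" and y: "y \<in> model r"
  shows "\<exists>q\<in>tangent_space r (Tpow M r) p. vcomp q \<alpha> = y"
proof -
  \<comment> \<open>The value 0 away from p is the normalization in
    \<open>tangent_space\<close>.\<close>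
  let ?w = "\<lambda>\<beta>. if p \<in> chart_dom (Tpow M r) \<beta> then dd r (trans_map M \<alpha> \<beta> r) (chart (Tpow M r) \<alpha> p) y else 0"
  note ts = trans_map_tsmooth[OF M]
  have x: "chart (Tpow M r) \<beta> p \<in> cyl r (overlap M \<beta> \<gamma>)"
    if "p \<in> chart_dom (Tpow M r) \<beta>" "p \<in> chart_dom (Tpow M r) \<gamma>" for \<beta> \<gamma>
    using good_chartsD(6)[OF g that(1), of \<gamma>] that by simp
  have "Tan p ?w \<in> tangent_space r (Tpow M r) p"
    unfolding tangent_space_def
  proof (intro CollectI exI[of _ ?w] conjI refl allI impI)
    fix \<beta>
    show "if p \<in> chart_dom (Tpow M r) \<beta> then ?w \<beta> \<in> model r else ?w \<beta> = 0"
      using dd_in_model[OF tsmooth_cases(1)[OF ts] x[OF p] tsmooth_cases(2)[OF ts]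
          tsmooth_cases(3)[OF ts x[OF p]]] by simp
  next
    fix \<beta> \<gamma> assume q: "p \<in> chart_dom (Tpow M r) \<beta> \<inter> chart_dom (Tpow M r) \<gamma>"
    have "((chart (Tpow M r) \<gamma> \<circ> chart_inv (Tpow M r) \<beta>) has_derivative
        dd r (trans_map M \<beta> \<gamma> r) (chart (Tpow M r) \<beta> p)) (at (chart (Tpow M r) \<beta> p) within model r)"
      using q by (intro has_derivative_within_model[OF tsmooth_cases(1)[OF ts] x local_trans(2)[OF g]
            tsmooth_cases(3)[OF ts x]]) auto
    moreover have "?w \<gamma> = dd r (trans_map M \<beta> \<gamma> r) (chart (Tpow M r) \<beta> p) (?w \<beta>)"
      using q trans_map_cocycle[OF M g p, of \<beta> \<gamma> y] by simp
    ultimately show "\<exists>L. ((chart (Tpow M r) \<gamma> \<circ> chart_inv (Tpow M r) \<beta>) has_derivative L)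
        (at (chart (Tpow M r) \<beta> p) within model r) \<and> ?w \<gamma> = L (?w \<beta>)"
      by blast
  qed
  moreover have "vcomp (Tan p ?w) \<alpha> = y"
    using p dd_trans_map_self[OF M g p y] by simp
  ultimately show ?thesis by blast
qed

lemma chart_dom_Suc: "q \<in> chart_dom (Tpow M (Suc r)) \<alpha> \<longleftrightarrow>
    proj q \<in> chart_dom (Tpow M r) \<alpha> \<and> q \<in> tangent_space r (Tpow M r) (proj q)"
  by (auto simp: tangent_bundle_def tangent_space_def)

lemma chart_Suc: "chart (Tpow M (Suc r)) \<alpha> q = join r (chart (Tpow M r) \<alpha> (proj q)) (vcomp q \<alpha>)"
  by (simp add: tangent_bundle_def)

lemma good_charts:
  fixes M :: "('m, 'i, 'e::banach) atlas"
  assumes M: "banach_manifold M"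
  shows "good_charts M r"
proof (induction r)
  case 0
  have inj: "inj_on (chart M \<alpha>) (chart_dom M \<alpha>)" for \<alpha>
    by (rule banach_manifold_overlap(2)[OF M])
  have cyl0: "embed e \<in> cyl 0 V \<longleftrightarrow> e \<in> V" for e :: 'e and V
    by (simp add: cyl_def model_def apply_embed)
  have "bij_betw (chart (Tpow M 0) \<alpha>) (chart_dom (Tpow M 0) \<alpha>) (cyl 0 (overlap M \<alpha> \<alpha>))" for \<alpha>
    unfolding bij_betw_def
  proof
    show "inj_on (chart (Tpow M 0) \<alpha>) (chart_dom (Tpow M 0) \<alpha>)"
      using inj[of \<alpha>] bij_betw_imp_inj_on[OF bij_betw_embed] by (auto simp: inj_on_def)
    have "v \<in> chart (Tpow M 0) \<alpha> ` chart_dom (Tpow M 0) \<alpha>" if v: "v \<in> cyl 0 (overlap M \<alpha> \<alpha>)" for v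
    proof -
      have "v \<in> range embed"
        using v bij_betw_embed[where 'a = 'e] by (simp add: cyl_def bij_betw_def)
      then obtain e where e: "v = embed e"
        by blast
      then obtain m where "m \<in> chart_dom M \<alpha>" "e = chart M \<alpha> m"
        using v cyl0 by (auto simp: overlap_def)
      then show ?thesis
        using e by (auto intro!: image_eqI[of _ _ "Base m"])
    qed
    then show "chart (Tpow M 0) \<alpha> ` chart_dom (Tpow M 0) \<alpha> = cyl 0 (overlap M \<alpha> \<alpha>)"
      by (auto simp: cyl0 overlap_def)
  qed
  moreover have "Base m \<in> chart_dom (Tpow M 0) \<beta> \<longleftrightarrow> chart (Tpow M 0) \<alpha> (Base m) \<in> cyl 0 (overlap M \<alpha> \<beta>)"
    "Base m \<in> chart_dom (Tpow M 0) \<beta> \<Longrightarrow>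
        chart (Tpow M 0) \<beta> (Base m) = trans_map M \<alpha> \<beta> 0 (chart (Tpow M 0) \<alpha> (Base m))"
    if "m \<in> chart_dom M \<alpha>" for m \<alpha> \<beta>
    using that inj[of \<alpha>] by (auto simp: cyl0 overlap_def apply_embed chart_inv_def inj_on_def image_iff)
  ultimately show ?case
    unfolding good_charts_def by auto
next
  case (Suc r)
  note g = Suc
  note tD = tangent_spaceD[OF M g]
  have bij: "bij_betw (chart (Tpow M (Suc r)) \<alpha>) (chart_dom (Tpow M (Suc r)) \<alpha>) (cyl (Suc r) (overlap M \<alpha> \<alpha>))" for \<alpha>
    unfolding bij_betw_def
  proof
    show "inj_on (chart (Tpow M (Suc r)) \<alpha>) (chart_dom (Tpow M (Suc r)) \<alpha>)"
    proof (rule inj_onI)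
      fix q q' assume q: "q \<in> chart_dom (Tpow M (Suc r)) \<alpha>" "q' \<in> chart_dom (Tpow M (Suc r)) \<alpha>"
        and eq: "chart (Tpow M (Suc r)) \<alpha> q = chart (Tpow M (Suc r)) \<alpha> q'"
      have m: "proj q \<in> chart_dom (Tpow M r) \<alpha>" "q \<in> tangent_space r (Tpow M r) (proj q)"
        "proj q' \<in> chart_dom (Tpow M r) \<alpha>" "q' \<in> tangent_space r (Tpow M r) (proj q')"
        using q unfolding chart_dom_Suc by blast+
      have "chart (Tpow M r) \<alpha> (proj q) = chart (Tpow M r) \<alpha> (proj q')" and v: "vcomp q \<alpha> = vcomp q' \<alpha>"
        using eq tD(3)[OF m(2,1)] tD(3)[OF m(4,3)] good_chartsD(2)[OF g m(1)] good_chartsD(2)[OF g m(3)]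
        unfolding chart_Suc by (auto simp: join_eq_iff cyl_def)
      then have p: "proj q = proj q'"
        using good_chartsD(1)[OF g] m(1,3) by (auto simp: inj_on_def)
      \<comment> \<open>Components in charts around the base point follow from the component in
        \<alpha>; all others equal 0, so agreement in one chart is equality of vectors.\<close>
      have "vcomp q \<beta> = vcomp q' \<beta>" for \<beta>
      proof (cases "proj q \<in> chart_dom (Tpow M r) \<beta>")
        case True
        then show ?thesis
          using tD(5)[OF m(2,1) True] tD(5)[OF m(4,3), of \<beta>] p v by simp
      next
        case False
        then show ?thesis
          using tD(4)[OF m(2) False] tD(4)[OF m(4), of \<beta>] p by simp
      qed
      then show "q = q'"
        using tD(2)[OF m(2)] tD(2)[OF m(4)] p by (metis ext)
    qed
    show "chart (Tpow M (Suc r)) \<alpha> ` chart_dom (Tpow M (Suc r)) \<alpha> = cyl (Suc r) (overlap M \<alpha> \<alpha>)"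
    proof (intro equalityI subsetI)
      fix v assume "v \<in> chart (Tpow M (Suc r)) \<alpha> ` chart_dom (Tpow M (Suc r)) \<alpha>"
      then obtain q where q: "v = chart (Tpow M (Suc r)) \<alpha> q" and "q \<in> chart_dom (Tpow M (Suc r)) \<alpha>"
        by blast
      then have q': "proj q \<in> chart_dom (Tpow M r) \<alpha>" "q \<in> tangent_space r (Tpow M r) (proj q)"
        unfolding chart_dom_Suc by simp_all
      then show "v \<in> cyl (Suc r) (overlap M \<alpha> \<alpha>)"
        using tD(3)[OF q'(2,1)] good_chartsD(2)[OF g q'(1)] unfolding q chart_Suc by (simp add: cyl_def)
    next
      fix v assume v: "v \<in> cyl (Suc r) (overlap M \<alpha> \<alpha>)"
      then obtain x y where xy: "x \<in> model r" "y \<in> model r" "v = join r x y"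
        using model_Suc_cases[of v r] unfolding cyl_def by blast
      then have x: "x \<in> cyl r (overlap M \<alpha> \<alpha>)"
        using v by (simp add: cyl_def)
      let ?p = "chart_inv (Tpow M r) \<alpha> x"
      obtain q where q: "q \<in> tangent_space r (Tpow M r) ?p" "vcomp q \<alpha> = y"
        using tangent_vector_exists[OF M g good_chartsD(3)[OF g x] xy(2)] by blast
      then have "proj q = ?p"
        using tD(1) by blast
      then have "q \<in> chart_dom (Tpow M (Suc r)) \<alpha>" "chart (Tpow M (Suc r)) \<alpha> q = v"
        using q good_chartsD(3,4)[OF g x] xy unfolding chart_dom_Suc chart_Suc by simp_all
      then show "v \<in> chart (Tpow M (Suc r)) \<alpha> ` chart_dom (Tpow M (Suc r)) \<alpha>"
        by blast
    qed
  qed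
  have "(q \<in> chart_dom (Tpow M (Suc r)) \<beta> \<longleftrightarrow> chart (Tpow M (Suc r)) \<alpha> q \<in> cyl (Suc r) (overlap M \<alpha> \<beta>)) \<and>
      (q \<in> chart_dom (Tpow M (Suc r)) \<beta> \<longrightarrow>
        chart (Tpow M (Suc r)) \<beta> q = trans_map M \<alpha> \<beta> (Suc r) (chart (Tpow M (Suc r)) \<alpha> q))"
    if q: "q \<in> chart_dom (Tpow M (Suc r)) \<alpha>" for q \<alpha> \<beta>
  proof -
    have m: "proj q \<in> chart_dom (Tpow M r) \<alpha>" "q \<in> tangent_space r (Tpow M r) (proj q)"
      using q unfolding chart_dom_Suc by blast+
    have vm: "vcomp q \<alpha> \<in> model r"
      by (rule tD(3)[OF m(2,1)])
    have xm: "chart (Tpow M r) \<alpha> (proj q) \<in> model r"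
      using good_chartsD(2)[OF g m(1)] by (simp add: cyl_def)
    have iff: "q \<in> chart_dom (Tpow M (Suc r)) \<beta> \<longleftrightarrow> proj q \<in> chart_dom (Tpow M r) \<beta>"
      unfolding chart_dom_Suc using m(2) by blast
    show ?thesis
    proof (intro conjI impI)
      show "q \<in> chart_dom (Tpow M (Suc r)) \<beta> \<longleftrightarrow> chart (Tpow M (Suc r)) \<alpha> q \<in> cyl (Suc r) (overlap M \<alpha> \<beta>)"
        unfolding iff chart_Suc join_in_cyl[OF vm] good_chartsD(6)[OF g m(1), of \<beta>]
        using xm by (simp add: cyl_def)
      assume "q \<in> chart_dom (Tpow M (Suc r)) \<beta>"
      then have b: "proj q \<in> chart_dom (Tpow M r) \<beta>"
        using iff by blast
      show "chart (Tpow M (Suc r)) \<beta> q = trans_map M \<alpha> \<beta> (Suc r) (chart (Tpow M (Suc r)) \<alpha> q)"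
        unfolding chart_Suc trans_map.simps tan_map_join[OF xm vm]
          good_chartsD(7)[OF g m(1) b, symmetric] tD(5)[OF m(2,1) b] by simp
    qed
  qed
  with bij show ?case
    unfolding good_charts_def by blast
qed

section \<open>Geometric operations in charts\<close>

lemma points_iff: "p \<in> points N \<longleftrightarrow> (\<exists>\<alpha>. p \<in> chart_dom N \<alpha>)"
  by (auto simp: points_def)

lemma tangent_eqI:
  assumes M: "banach_manifold M" and p: "p \<in> chart_dom (Tpow M r) \<alpha>"
    and "q \<in> tangent_space r (Tpow M r) p" "q' \<in> tangent_space r (Tpow M r) p" "vcomp q \<alpha> = vcomp q' \<alpha>"
  shows "q = q'"
proof -
  note g = good_charts[OF M]
  have "proj q = p" "proj q' = p"
    using tangent_spaceD(1)[OF M g] assms by blast+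
  then have "q \<in> chart_dom (Tpow M (Suc r)) \<alpha>" "q' \<in> chart_dom (Tpow M (Suc r)) \<alpha>"
    "chart (Tpow M (Suc r)) \<alpha> q = chart (Tpow M (Suc r)) \<alpha> q'"
    using assms unfolding chart_dom_Suc chart_Suc by simp_all
  then show ?thesis
    using good_chartsD(1)[OF g[of "Suc r"], of \<alpha>] by (simp add: inj_on_def)
qed

lemma mopen_preimage:
  assumes "tsmooth r s U f" "mopen s V"
  shows "mopen r {x \<in> U. f x \<in> V}"
proof -
  note f = tsmooth_cases[OF assms(1)]
  have "openin (top_of_set U) (U \<inter> f -` V)"
  proof (rule continuous_openin_preimage[OF tsmooth_continuous[OF assms(1)]])
    show "f \<in> U \<rightarrow> model s"
      using f(2) by blast
    show "openin (top_of_set (model s)) V"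
      using assms(2) by (simp add: mopen_iff)
  qed
  then have "openin (top_of_set (model r)) (U \<inter> f -` V)"
    using openin_trans f(1) by (auto simp: mopen_iff)
  moreover have "U \<inter> f -` V = {x \<in> U. f x \<in> V}"
    by auto
  ultimately show ?thesis
    by (simp add: mopen_iff)
qed

text \<open>The description in the definition of \<open>tmap\<close> is satisfied by the vector with
  component DF in the chart \<alpha>, and the chain rule verifies it for all other pairs of charts.
  One index \<alpha> on both sides suffices because the maps used later cover the identity of
  M.\<close>

lemma tmap_eq:
  assumes M: "banach_manifold M"
    and F: "tsmooth a b (cyl a (overlap M \<alpha> \<alpha>)) F"
    and f: "\<And>p. p \<in> chart_dom (Tpow M a) \<alpha> \<Longrightarrow> f p \<in> chart_dom (Tpow M b) \<alpha> \<and>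
      chart (Tpow M b) \<alpha> (f p) = F (chart (Tpow M a) \<alpha> p)"
    and q: "q \<in> chart_dom (Tpow M (Suc a)) \<alpha>"
  shows "tmap M a b f q \<in> chart_dom (Tpow M (Suc b)) \<alpha>" "proj (tmap M a b f q) = f (proj q)"
    "chart (Tpow M (Suc b)) \<alpha> (tmap M a b f q) = tan_map a b F (chart (Tpow M (Suc a)) \<alpha> q)"
proof -
  note g = good_charts[OF M] and ts = trans_map_tsmooth[OF M] and tD = tangent_spaceD[OF M good_charts[OF M]]
  let ?C = "cyl a (overlap M \<alpha> \<alpha>)" and ?p = "proj q"
  have p: "?p \<in> chart_dom (Tpow M a) \<alpha>" "q \<in> tangent_space a (Tpow M a) ?p"
    using q unfolding chart_dom_Suc by blast+
  let ?x = "chart (Tpow M a) \<alpha> ?p"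
  have x: "?x \<in> ?C"
    by (rule good_chartsD(2)[OF g p(1)])
  note F' = tsmooth_cases[OF F]
  have fp: "f ?p \<in> chart_dom (Tpow M b) \<alpha>" "chart (Tpow M b) \<alpha> (f ?p) = F ?x"
    using f[OF p(1)] by blast+
  have "dd a F ?x (vcomp q \<alpha>) \<in> model b"
    by (rule dd_in_model[OF F'(1) x F'(2) F'(3)[OF x]])
  then obtain q0 where q0: "q0 \<in> tangent_space b (Tpow M b) (f ?p)" "vcomp q0 \<alpha> = dd a F ?x (vcomp q \<alpha>)"
    using tangent_vector_exists[OF M g fp(1)] by blast
  have local: "local_rep (Tpow M a) (Tpow M b) f \<beta> \<gamma> y =
      trans_map M \<alpha> \<gamma> b (F (trans_map M \<beta> \<alpha> a y))"
    and local_mem: "F (trans_map M \<beta> \<alpha> a y) \<in> cyl b (overlap M \<alpha> \<gamma>) \<Longrightarrow> True"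
    if y: "y \<in> cyl a (overlap M \<beta> \<alpha>)" "F (trans_map M \<beta> \<alpha> a y) \<in> cyl b (overlap M \<alpha> \<gamma>)" for \<beta> \<gamma> y
  proof -
    let ?r = "chart_inv (Tpow M a) \<beta> y"
    have r: "?r \<in> chart_dom (Tpow M a) \<alpha>" "chart (Tpow M a) \<alpha> ?r = trans_map M \<beta> \<alpha> a y"
      using local_trans[OF g y(1)] by auto
    have fr: "f ?r \<in> chart_dom (Tpow M b) \<alpha>" "chart (Tpow M b) \<alpha> (f ?r) = F (trans_map M \<beta> \<alpha> a y)"
      using f[OF r(1)] r(2) by auto
    then have "f ?r \<in> chart_dom (Tpow M b) \<gamma>"
      using good_chartsD(6)[OF g fr(1), of \<gamma>] y(2) by simp
    then show "local_rep (Tpow M a) (Tpow M b) f \<beta> \<gamma> y = trans_map M \<alpha> \<gamma> b (F (trans_map M \<beta> \<alpha> a y))"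
      using good_chartsD(7)[OF g fr(1), of \<gamma>] fr(2) by (simp add: local_rep_def)
  qed simp
  have spec: "\<exists>L. (local_rep (Tpow M a) (Tpow M b) f \<beta> \<gamma> has_derivative L)
        (at (chart (Tpow M a) \<beta> ?p) within model a) \<and> vcomp q0 \<gamma> = L (vcomp q \<beta>)"
    if pb: "?p \<in> chart_dom (Tpow M a) \<beta>" and pc: "f ?p \<in> chart_dom (Tpow M b) \<gamma>" for \<beta> \<gamma>
  proof -
    let ?y = "chart (Tpow M a) \<beta> ?p"
    \<comment> \<open>On \<open>?V\<close> and \<open>?U\<close> the local representative in
      \<beta>, \<gamma> factors through the chart \<alpha>.\<close>
    let ?V = "{z \<in> ?C. F z \<in> cyl b (overlap M \<alpha> \<gamma>)}"
    let ?U = "{y \<in> cyl a (overlap M \<beta> \<alpha>). trans_map M \<beta> \<alpha> a y \<in> ?V}"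
    have V: "mopen a ?V"
      by (rule mopen_preimage[OF F mopen_cyl[OF banach_manifold_overlap(1)[OF M]]])
    have U: "mopen a ?U"
      by (rule mopen_preimage[OF ts V])
    have ty: "trans_map M \<beta> \<alpha> a ?y = ?x"
      using good_chartsD(7)[OF g pb p(1)] by simp
    have "F ?x \<in> cyl b (overlap M \<alpha> \<gamma>)"
      using good_chartsD(6)[OF g fp(1), of \<gamma>] fp(2) pc by simp
    moreover have yo: "?y \<in> cyl a (overlap M \<beta> \<alpha>)"
      using good_chartsD(6)[OF g pb, of \<alpha>] p(1) by simp
    ultimately have y: "?y \<in> ?U"
      using x ty by simp
    have Fx: "F ?x \<in> cyl b (overlap M \<alpha> \<gamma>)"
      by fact
    have Vm: "?V \<subseteq> model a" "cyl b (overlap M \<alpha> \<gamma>) \<subseteq> model b"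
      by (auto simp: cyl_def)
    have t1: "tdiff a (trans_map M \<beta> \<alpha> a) ?y"
      by (rule tsmooth_cases(3)[OF ts yo])
    have t3: "tdiff b (trans_map M \<alpha> \<gamma> b) (F ?x)"
      by (rule tsmooth_cases(3)[OF ts Fx])
    have xV: "?x \<in> ?V"
      using x Fx by simp
    have c1: "tdiff a (\<lambda>z. trans_map M \<alpha> \<gamma> b (F z)) ?x"
      "\<And>v. dd a (\<lambda>z. trans_map M \<alpha> \<gamma> b (F z)) ?x v = dd b (trans_map M \<alpha> \<gamma> b) (F ?x) (dd a F ?x v)"
      by (rule dd_comp[OF V xV _ Vm(2) F'(3)[OF x] t3]; auto)+
    have c2: "tdiff a (\<lambda>y. trans_map M \<alpha> \<gamma> b (F (trans_map M \<beta> \<alpha> a y))) ?y"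
      "\<And>v. dd a (\<lambda>y. trans_map M \<alpha> \<gamma> b (F (trans_map M \<beta> \<alpha> a y))) ?y v =
        dd a (\<lambda>z. trans_map M \<alpha> \<gamma> b (F z)) ?x (dd a (trans_map M \<beta> \<alpha> a) ?y v)"
      using dd_comp[OF U y _ Vm(1) t1, of "\<lambda>z. trans_map M \<alpha> \<gamma> b (F z)"] c1(1) unfolding ty by auto
    let ?L = "dd a (\<lambda>y. trans_map M \<alpha> \<gamma> b (F (trans_map M \<beta> \<alpha> a y))) ?y"
    have "(local_rep (Tpow M a) (Tpow M b) f \<beta> \<gamma> has_derivative ?L) (at ?y within model a)"
      by (rule has_derivative_within_model[OF U y _ c2(1)]) (use local in auto)
    moreover have "vcomp q0 \<gamma> = ?L (vcomp q \<beta>)"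
      using tD(5)[OF q0(1) fp(1) pc] tD(5)[OF p(2) pb p(1)] q0(2) fp(2) c1(2) c2(2) by simp
    ultimately show ?thesis by blast
  qed
  have "tmap M a b f q = q0"
    unfolding tmap_def
  proof (rule the_equality)
    show "q0 \<in> tangent_space b (Tpow M b) (f ?p) \<and>
      (\<forall>\<alpha> \<beta>. ?p \<in> chart_dom (Tpow M a) \<alpha> \<and> f ?p \<in> chart_dom (Tpow M b) \<beta> \<longrightarrow>
        (\<exists>L. (local_rep (Tpow M a) (Tpow M b) f \<alpha> \<beta> has_derivative L)
             (at (chart (Tpow M a) \<alpha> ?p) within model a) \<and> vcomp q0 \<beta> = L (vcomp q \<alpha>)))"
      using q0(1) spec by blast
    fix q' assume q': "q' \<in> tangent_space b (Tpow M b) (f ?p) \<and>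
      (\<forall>\<alpha> \<beta>. ?p \<in> chart_dom (Tpow M a) \<alpha> \<and> f ?p \<in> chart_dom (Tpow M b) \<beta> \<longrightarrow>
        (\<exists>L. (local_rep (Tpow M a) (Tpow M b) f \<alpha> \<beta> has_derivative L)
             (at (chart (Tpow M a) \<alpha> ?p) within model a) \<and> vcomp q' \<beta> = L (vcomp q \<alpha>)))"
    then obtain L where L: "(local_rep (Tpow M a) (Tpow M b) f \<alpha> \<alpha> has_derivative L) (at ?x within model a)"
      "vcomp q' \<alpha> = L (vcomp q \<alpha>)"
      using p(1) fp(1) by blast
    \<comment> \<open>The single pair (\<alpha>, \<alpha>) already pins down any candidate.\<close>
    have "local_rep (Tpow M a) (Tpow M b) f \<alpha> \<alpha> y = F y" if "y \<in> ?C" for y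
      using f[OF good_chartsD(3)[OF g that]] good_chartsD(4)[OF g that] by (simp add: local_rep_def)
    from within_model_derivative(2)[OF F'(1) x this L(1) tD(3)[OF p(2,1)]]
    have "vcomp q' \<alpha> = vcomp q0 \<alpha>"
      using L(2) q0(2) by simp
    then show "q' = q0"
      using tangent_eqI[OF M fp(1)] q' q0(1) by blast
  qed
  moreover have "proj q0 = f ?p"
    by (rule tD(1)[OF q0(1)])
  ultimately show "tmap M a b f q \<in> chart_dom (Tpow M (Suc b)) \<alpha>" "proj (tmap M a b f q) = f ?p"
    "chart (Tpow M (Suc b)) \<alpha> (tmap M a b f q) = tan_map a b F (chart (Tpow M (Suc a)) \<alpha> q)"
    using q0 fp x tD(3)[OF p(2,1)] unfolding chart_dom_Suc chart_Suc
    by (simp_all add: tan_map_join cyl_def)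
qed

text \<open>A derivative in one chart decides: the chain rule carries it to the other charts in the
  way components of a tangent vector transform.\<close>

lemma velocity_eq:
  assumes M: "banach_manifold M" and I: "open I" "t \<in> I"
    and c: "\<And>s. s \<in> I \<Longrightarrow> \<gamma> s \<in> chart_dom (Tpow M r) \<alpha> \<and> chart (Tpow M r) \<alpha> (\<gamma> s) = c s"
    and c': "(c has_vector_derivative c') (at t)"
  shows "velocity M r \<gamma> t \<in> chart_dom (Tpow M (Suc r)) \<alpha>" "proj (velocity M r \<gamma> t) = \<gamma> t"
    "chart (Tpow M (Suc r)) \<alpha> (velocity M r \<gamma> t) = join r (c t) c'"
proof -
  note g = good_charts[OF M] and ts = trans_map_tsmooth[OF M] and tD = tangent_spaceD[OF M good_charts[OF M]]
  have p: "\<gamma> t \<in> chart_dom (Tpow M r) \<alpha>" "chart (Tpow M r) \<alpha> (\<gamma> t) = c t"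
    using c I by auto
  have cm: "c s \<in> model r" if "s \<in> I" for s
    using good_chartsD(2)[OF g] c[OF that] unfolding cyl_def by fastforce
  have c'm: "c' \<in> model r"
    by (rule vector_derivative_in_model[OF c' I cm])
  obtain q0 where q0: "q0 \<in> tangent_space r (Tpow M r) (\<gamma> t)" "vcomp q0 \<alpha> = c'"
    using tangent_vector_exists[OF M g p(1) c'm] by blast
  have spec: "((\<lambda>s. chart (Tpow M r) \<beta> (\<gamma> s)) has_vector_derivative vcomp q0 \<beta>) (at t)"
    if b: "\<gamma> t \<in> chart_dom (Tpow M r) \<beta>" for \<beta>
  proof -
    have o: "c t \<in> cyl r (overlap M \<alpha> \<beta>)"
      using good_chartsD(6)[OF g p(1), of \<beta>] b p(2) by simp
    obtain \<delta> where \<delta>: "\<delta> > 0" "\<And>y. norm (y - c t) < \<delta> \<Longrightarrow> trunc r y \<in> cyl r (overlap M \<alpha> \<beta>)"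
      using mopen_ball[OF tsmooth_cases(1)[OF ts] o] by blast
    have "isCont c t"
      using c' has_vector_derivative_continuous by blast
    then obtain d where d: "d > 0" "\<And>s. dist s t < d \<Longrightarrow> norm (c s - c t) < \<delta>"
      using \<delta>(1) unfolding continuous_at_eps_delta dist_norm by blast
    \<comment> \<open>At these times the curve is still in the chart \<beta>, by continuity of
      c.\<close>
    have J: "open (I \<inter> ball t d)" "t \<in> I \<inter> ball t d"
      using I d by auto
    have "((\<lambda>s. trans_map M \<alpha> \<beta> r (c s)) has_vector_derivative dd r (trans_map M \<alpha> \<beta> r) (c t) c') (at t)"
      by (rule has_vector_derivative_comp[OF c' I cm tsmooth_cases(3)[OF ts o]])
    then have "((\<lambda>s. chart (Tpow M r) \<beta> (\<gamma> s)) has_vector_derivative dd r (trans_map M \<alpha> \<beta> r) (c t) c') (at t)"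
    proof (rule has_vector_derivative_transform_within_open[OF _ J])
      fix s assume s: "s \<in> I \<inter> ball t d"
      then have "c s \<in> cyl r (overlap M \<alpha> \<beta>)"
        using \<delta>(2)[of "c s"] d(2)[of s] cm by (simp add: dist_commute)
      then have "\<gamma> s \<in> chart_dom (Tpow M r) \<beta>"
        using good_chartsD(6)[OF g[of r], of "\<gamma> s" \<alpha> \<beta>] c s by auto
      then show "trans_map M \<alpha> \<beta> r (c s) = chart (Tpow M r) \<beta> (\<gamma> s)"
        using good_chartsD(7)[OF g[of r], of "\<gamma> s" \<alpha> \<beta>] c s by auto
    qed
    then show ?thesis
      using tD(5)[OF q0(1) p(1) b] q0(2) p(2) by simp
  qed
  have "velocity M r \<gamma> t = q0"
    unfolding velocity_def
  proof (rule the_equality)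
    show "q0 \<in> tangent_space r (Tpow M r) (\<gamma> t) \<and> (\<forall>\<alpha>. \<gamma> t \<in> chart_dom (Tpow M r) \<alpha> \<longrightarrow>
        ((\<lambda>s. chart (Tpow M r) \<alpha> (\<gamma> s)) has_vector_derivative vcomp q0 \<alpha>) (at t))"
      using q0(1) spec by blast
    fix q' assume q': "q' \<in> tangent_space r (Tpow M r) (\<gamma> t) \<and> (\<forall>\<alpha>. \<gamma> t \<in> chart_dom (Tpow M r) \<alpha> \<longrightarrow>
        ((\<lambda>s. chart (Tpow M r) \<alpha> (\<gamma> s)) has_vector_derivative vcomp q' \<alpha>) (at t))"
    then have "vcomp q' \<alpha> = vcomp q0 \<alpha>"
      using spec[OF p(1)] p(1) vector_derivative_unique_at by blast
    then show "q' = q0"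
      using tangent_eqI[OF M p(1)] q' q0(1) by blast
  qed
  moreover have "proj q0 = \<gamma> t"
    by (rule tD(1)[OF q0(1)])
  ultimately show "velocity M r \<gamma> t \<in> chart_dom (Tpow M (Suc r)) \<alpha>" "proj (velocity M r \<gamma> t) = \<gamma> t"
    "chart (Tpow M (Suc r)) \<alpha> (velocity M r \<gamma> t) = join r (c t) c'"
    using q0 p unfolding chart_dom_Suc chart_Suc by simp_all
qed

text \<open>A point obtained by flipping coordinates in \<alpha> is flipped in every other chart
  too, since coordinate changes on this level are second tangent maps and commute with
  \<open>flip\<close>.\<close>

lemma kappa_eq:
  assumes M: "banach_manifold M" and p: "p \<in> chart_dom (Tpow M (Suc (Suc r))) \<alpha>"
  shows "kappa M (Suc (Suc r)) p \<in> chart_dom (Tpow M (Suc (Suc r))) \<alpha>"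
    "chart (Tpow M (Suc (Suc r))) \<alpha> (kappa M (Suc (Suc r)) p) = flip r (chart (Tpow M (Suc (Suc r))) \<alpha> p)"
proof -
  let ?R = "Suc (Suc r)"
  let ?N = "Tpow M ?R"
  note g = good_charts[OF M, of ?R]
  let ?v = "chart ?N \<alpha> p"
  have v: "?v \<in> cyl ?R (overlap M \<alpha> \<alpha>)"
    by (rule good_chartsD(2)[OF g p])
  then have fv: "flip r ?v \<in> cyl ?R (overlap M \<alpha> \<alpha>)"
    by (simp add: cyl_def)
  let ?q = "chart_inv ?N \<alpha> (flip r ?v)"
  have q: "?q \<in> chart_dom ?N \<alpha>" "chart ?N \<alpha> ?q = flip r ?v"
    using good_chartsD(3,4)[OF g fv] by auto
  have spec: "?q \<in> chart_dom ?N \<beta>" "chart ?N \<beta> ?q = flip r (chart ?N \<beta> p)"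
    if b: "p \<in> chart_dom ?N \<beta>" for \<beta>
  proof -
    have o: "?v \<in> cyl ?R (overlap M \<alpha> \<beta>)"
      using good_chartsD(6)[OF g p, of \<beta>] b by simp
    then show qb: "?q \<in> chart_dom ?N \<beta>"
      unfolding good_chartsD(6)[OF g q(1), of \<beta>] q(2) by (simp add: cyl_def)
    have "chart ?N \<beta> ?q = trans_map M \<alpha> \<beta> ?R (flip r ?v)"
      using good_chartsD(7)[OF g q(1) qb] q(2) by simp
    also have "\<dots> = flip r (trans_map M \<alpha> \<beta> ?R ?v)"
      using tan_map_flip[OF trans_map_tsmooth[OF M, of r \<alpha> \<beta>], of ?v] o by (simp add: tan_dom_cyl)
    also have "trans_map M \<alpha> \<beta> ?R ?v = chart ?N \<beta> p"
      using good_chartsD(7)[OF g p b] by simp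
    finally show "chart ?N \<beta> ?q = flip r (chart ?N \<beta> p)" .
  qed
  \<comment> \<open>The quadruple in the definition of \<open>kappa\<close> only decomposes u, so
    the condition there is an equation for w.\<close>
  have flip_form: "(\<exists>x\<in>model (?R - 2). \<exists>y\<in>model (?R - 2). \<exists>X\<in>model (?R - 2). \<exists>Y\<in>model (?R - 2).
          u = join (?R - 1) (join (?R - 2) x y) (join (?R - 2) X Y) \<and>
          w = join (?R - 1) (join (?R - 2) x X) (join (?R - 2) y Y)) \<longleftrightarrow> w = flip r u"
    if u: "u \<in> model ?R" for u w :: "'c coord"
  proof
    assume "w = flip r u"
    moreover obtain x y X Y where "x \<in> model r" "y \<in> model r" "X \<in> model r" "Y \<in> model r"
      "u = join (Suc r) (join r x y) (join r X Y)"
      using u by (rule model_Suc_Suc_cases)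
    ultimately show "\<exists>x\<in>model (?R - 2). \<exists>y\<in>model (?R - 2). \<exists>X\<in>model (?R - 2). \<exists>Y\<in>model (?R - 2).
          u = join (?R - 1) (join (?R - 2) x y) (join (?R - 2) X Y) \<and>
          w = join (?R - 1) (join (?R - 2) x X) (join (?R - 2) y Y)"
      by (intro bexI[of _ x] bexI[of _ y] bexI[of _ X] bexI[of _ Y]) simp_all
  qed auto
  have um: "chart ?N \<beta> p \<in> model ?R" if "p \<in> chart_dom ?N \<beta>" for \<beta>
    using good_chartsD(2)[OF g that] by (simp add: cyl_def)
  have "kappa M ?R p = (THE q. q \<in> points ?N \<and> (\<forall>\<alpha>. p \<in> chart_dom ?N \<alpha> \<longrightarrow> q \<in> chart_dom ?N \<alpha> \<and>
      chart ?N \<alpha> q = flip r (chart ?N \<alpha> p)))"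
    unfolding kappa_def using flip_form[OF um] by (simp cong: imp_cong conj_cong del: Tpow.simps)
  also have "\<dots> = ?q"
  proof (rule the_equality)
    show "?q \<in> points ?N \<and> (\<forall>\<alpha>. p \<in> chart_dom ?N \<alpha> \<longrightarrow> ?q \<in> chart_dom ?N \<alpha> \<and>
        chart ?N \<alpha> ?q = flip r (chart ?N \<alpha> p))"
      using spec q(1) unfolding points_iff by blast
    fix q' assume "q' \<in> points ?N \<and> (\<forall>\<alpha>. p \<in> chart_dom ?N \<alpha> \<longrightarrow> q' \<in> chart_dom ?N \<alpha> \<and>
        chart ?N \<alpha> q' = flip r (chart ?N \<alpha> p))"
    then have "q' \<in> chart_dom ?N \<alpha>" "chart ?N \<alpha> q' = chart ?N \<alpha> ?q"
      using p q(2) by auto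
    then show "q' = ?q"
      using good_chartsD(1)[OF g, of \<alpha>] q(1) by (simp add: inj_on_def)
  qed
  finally have k: "kappa M ?R p = ?q" .
  show "kappa M ?R p \<in> chart_dom ?N \<alpha>" "chart ?N \<alpha> (kappa M ?R p) = flip r ?v"
    unfolding k by (fact q)+
qed

section \<open>The iterated complete lifts of a semispray in a chart\<close>

declare Tpow.simps(2) [simp del]

text \<open>Mirrors \<open>complete_lift\<close> factor by factor: \<open>flip j\<close> and its
  tangent map stand for the involution of T^(j+2) M, and \<open>flip (Suc j)\<close> for that of
  T^(j+3) M.\<close>

primrec lift_rep ::
    "('m, 'i, 'e::real_normed_vector) atlas \<Rightarrow> (('m, 'i, 'e) tp \<Rightarrow> ('m, 'i, 'e) tp) \<Rightarrow> 'i \<Rightarrow> nat \<Rightarrow>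
     'e coord \<Rightarrow> 'e coord"
  where
    "lift_rep M S \<alpha> 0 = (\<lambda>v. chart (Tpow M (Suc (Suc 0))) \<alpha> (S (chart_inv (Tpow M (Suc 0)) \<alpha> v)))"
  | "lift_rep M S \<alpha> (Suc j) = (\<lambda>v. tan_map (Suc (Suc j)) (Suc (Suc j)) (flip j)
      (flip (Suc j) (tan_map (Suc j) (Suc (Suc j)) (lift_rep M S \<alpha> j) (flip j v))))"

text \<open>The principal part: \<open>S\<^sup>c\<^sub>j\<close> is \<open>v \<mapsto> (v, spray_field M S \<alpha> j v)\<close> in the chart \<open>\<alpha>\<close>.\<close>

definition spray_field ::
    "('m, 'i, 'e::real_normed_vector) atlas \<Rightarrow> (('m, 'i, 'e) tp \<Rightarrow> ('m, 'i, 'e) tp) \<Rightarrow> 'i \<Rightarrow> nat \<Rightarrow>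
     'e coord \<Rightarrow> 'e coord"
  where "spray_field M S \<alpha> j v = shift (Suc j) (lift_rep M S \<alpha> j v)"

lemma dd_linear_comp:
  assumes "bounded_linear l" "tdiff r f x"
  shows "tdiff r (\<lambda>y. l (f y)) x" "dd r (\<lambda>y. l (f y)) x v = l (dd r f x v)"
proof -
  have *: "((\<lambda>y. l (f (trunc r y))) has_derivative (\<lambda>v. l (dd r f x v))) (at x)"
    by (rule bounded_linear.has_derivative[OF assms(1) tdiffD[OF assms(2)]])
  show "tdiff r (\<lambda>y. l (f y)) x"
    by (rule tdiffI[OF *])
  show "dd r (\<lambda>y. l (f y)) x v = l (dd r f x v)"
    using dd_eqI[OF *] by simp
qed

lemma mopen_model: "mopen r (model r)"
  by (simp add: mopen_def)

lemma tan_dom_model: "tan_dom r (model r) = model (Suc r)"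
  by (auto simp: tan_dom_def)

lemma tsmooth_flip: "mopen (Suc (Suc r)) U \<Longrightarrow> tsmooth (Suc (Suc r)) (Suc (Suc r)) U (flip r)"
  by (rule tsmooth_linear[OF bounded_linear_flip]) simp_all

lemma tsmooth_tan_flip:
  "tsmooth (Suc (Suc (Suc r))) (Suc (Suc (Suc r))) (model (Suc (Suc (Suc r))))
    (tan_map (Suc (Suc r)) (Suc (Suc r)) (flip r))"
  using tsmooth_cases(4)[OF tsmooth_flip[OF mopen_model]] by (simp add: tan_dom_model)

text \<open>
  For \<open>F = (id, A)\<close> the recursion defining \<open>lift_rep\<close> amounts to \<open>A \<mapsto> flip \<circ> T A \<circ> flip\<close>: the outer
  \<open>tan_map (flip j)\<close> only restores the base point.
\<close>

lemma lift_step: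
  assumes F: "tsmooth (Suc j) (Suc (Suc j)) (cyl (Suc j) V) F" and V: "mopen (Suc j) (cyl (Suc j) V)"
    and F1: "\<And>v. v \<in> cyl (Suc j) V \<Longrightarrow> trunc (Suc j) (F v) = v"
    and F2: "\<And>v. v \<in> cyl (Suc j) V \<Longrightarrow> trunc j (shift (Suc j) (F v)) = shift j v"
    and v: "v \<in> cyl (Suc (Suc j)) V"
  defines "G \<equiv> \<lambda>v. tan_map (Suc (Suc j)) (Suc (Suc j)) (flip j)
      (flip (Suc j) (tan_map (Suc j) (Suc (Suc j)) F (flip j v)))"
  shows "trunc (Suc (Suc j)) (G v) = v"
    "shift (Suc (Suc j)) (G v) =
      flip j (tan_map (Suc j) (Suc j) (\<lambda>v. shift (Suc j) (F v)) (flip j v))"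
    "trunc (Suc j) (shift (Suc (Suc j)) (G v)) = shift (Suc j) v"
proof -
  let ?A = "\<lambda>v. shift (Suc j) (F v)"
  note F' = tsmooth_cases[OF F]
  have vm: "v \<in> model (Suc (Suc j))"
    using v by (simp add: cyl_def)
  then obtain x y X Y where m: "x \<in> model j" "y \<in> model j" "X \<in> model j" "Y \<in> model j"
    and v_eq: "v = join (Suc j) (join j x y) (join j X Y)"
    by (rule model_Suc_Suc_cases)
  let ?z = "join j x X" and ?Z = "join j y Y"
  have fv: "flip j v = join (Suc j) ?z ?Z"
    using m by (simp add: v_eq)
  have zm: "?z \<in> model (Suc j)" "?Z \<in> model (Suc j)"
    using m by simp_all
  have z: "?z \<in> cyl (Suc j) V"
    using v m by (simp add: v_eq cyl_def)
  note td = F'(3)[OF z]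
  have dA: "dd (Suc j) ?A ?z ?Z = shift (Suc j) (dd (Suc j) F ?z ?Z)"
    by (rule dd_linear_comp(2)[OF bounded_linear_shift td])
  have tA: "tdiff (Suc j) ?A ?z"
    by (rule dd_linear_comp(1)[OF bounded_linear_shift td])
  \<comment> \<open>The section property \<open>F1\<close>, differentiated: the first half of DF is
    the identity.\<close>
  have "dd (Suc j) (\<lambda>v. trunc (Suc j) (F v)) ?z = dd (Suc j) (\<lambda>v. v) ?z"
    using F1 by (intro tdiff_cong(2)[OF V z _ tan_map_linear(1)]) (auto simp: bounded_linear_ident)
  then have d1: "trunc (Suc j) (dd (Suc j) F ?z ?Z) = ?Z"
    using dd_linear_comp(2)[OF bounded_linear_trunc td, of "Suc j" ?Z]
      tan_map_linear(2)[OF bounded_linear_ident, of "Suc j" ?z ?Z] zm m by simp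
  \<comment> \<open>The semispray property \<open>F2\<close>, differentiated, is what carries it to
    the next level.\<close>
  have "dd (Suc j) (\<lambda>v. trunc j (?A v)) ?z = dd (Suc j) (shift j) ?z"
    using F2 by (intro tdiff_cong(2)[OF V z _ tan_map_linear(1)[OF bounded_linear_shift]]) auto
  then have d2: "trunc j (dd (Suc j) ?A ?z ?Z) = Y"
    using dd_linear_comp(2)[OF bounded_linear_trunc tA, of j ?Z]
      tan_map_linear(2)[OF bounded_linear_shift, of "Suc j" j ?z ?Z] zm m by simp
  have Fz: "F ?z = join (Suc j) ?z (?A ?z)"
    using F1[OF z] F'(2)[OF z] by (metis join_trunc_shift trunc_id)
  have "dd (Suc j) F ?z ?Z \<in> model (Suc (Suc j))"
    by (rule dd_in_model[OF F'(1) z F'(2) td])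
  then have dF: "dd (Suc j) F ?z ?Z = join (Suc j) ?Z (dd (Suc j) ?A ?z ?Z)"
    using d1 unfolding dA by (metis join_trunc_shift trunc_id)
  have Am: "?A ?z \<in> model (Suc j)" "dd (Suc j) ?A ?z ?Z \<in> model (Suc j)"
    unfolding dA by simp_all
  have "flip (Suc j) (tan_map (Suc j) (Suc (Suc j)) F (flip j v)) =
      flip (Suc j) (join (Suc (Suc j)) (join (Suc j) ?z (?A ?z)) (join (Suc j) ?Z (dd (Suc j) ?A ?z ?Z)))"
    unfolding fv tan_map_join[OF zm] Fz[symmetric] dF[symmetric] ..
  \<comment> \<open>The involution exchanges A(z) with Z, so the base point becomes (z, Z) =
    \<open>flip j v\<close>; the tangent map of \<open>flip j\<close> then turns it back into v and
    flips the fibre part.\<close>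
  also have "\<dots> = join (Suc (Suc j)) (flip j v) (join (Suc j) (?A ?z) (dd (Suc j) ?A ?z ?Z))"
    using zm Am m unfolding fv by simp
  finally have G: "G v = join (Suc (Suc j)) v (flip j (join (Suc j) (?A ?z) (dd (Suc j) ?A ?z ?Z)))"
    using vm Am by (simp add: G_def tan_map_linear(3)[OF bounded_linear_flip])
  then show "trunc (Suc (Suc j)) (G v) = v"
    using vm by simp
  have s: "shift (Suc (Suc j)) (G v) = flip j (join (Suc j) (?A ?z) (dd (Suc j) ?A ?z ?Z))"
    unfolding G by simp
  then show "shift (Suc (Suc j)) (G v) = flip j (tan_map (Suc j) (Suc j) ?A (flip j v))"
    unfolding fv tan_map_join[OF zm] .
  have "trunc j (?A ?z) = X"
    using F2[OF z] m by simp
  then have "trunc (Suc j) (flip j (join (Suc j) (?A ?z) (dd (Suc j) ?A ?z ?Z))) = join j X Y"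
    using d2 Am m by (simp add: flip_def)
  then show "trunc (Suc j) (shift (Suc (Suc j)) (G v)) = shift (Suc j) v"
    unfolding s using m by (simp add: v_eq)
qed

lemma pointsI: "p \<in> chart_dom N \<alpha> \<Longrightarrow> p \<in> points N"
  by (auto simp: points_def)

text \<open>One simultaneous induction: the tangent map of a lift is computed in the chart only if
  its representative is smooth, and \<open>lift_step\<close> needs the section and semispray
  identities of the previous level.\<close>

lemma lift_rep:
  fixes M :: "('m, 'i, 'e::banach) atlas"
  assumes M: "banach_manifold M" and S: "semispray M 0 S"
  shows "tsmooth (Suc j) (Suc (Suc j)) (cyl (Suc j) (overlap M \<alpha> \<alpha>)) (lift_rep M S \<alpha> j) \<and>
    (\<forall>v\<in>cyl (Suc j) (overlap M \<alpha> \<alpha>). trunc (Suc j) (lift_rep M S \<alpha> j v) = v \<and>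
      trunc j (shift (Suc j) (lift_rep M S \<alpha> j v)) = shift j v) \<and>
    (\<forall>p\<in>chart_dom (Tpow M (Suc j)) \<alpha>. iter_lift M S j p \<in> chart_dom (Tpow M (Suc (Suc j))) \<alpha> \<and>
      chart (Tpow M (Suc (Suc j))) \<alpha> (iter_lift M S j p) = lift_rep M S \<alpha> j (chart (Tpow M (Suc j)) \<alpha> p))"
proof (induction j)
  case 0
  note g = good_charts[OF M]
  let ?C = "cyl (Suc 0) (overlap M \<alpha> \<alpha>)" and ?F = "lift_rep M S \<alpha> 0"
  have sm: "smooth_map (model (Suc 0)) (Tpow M (Suc 0)) (Tpow M (Suc (Suc 0))) S"
    and pr: "\<And>p. p \<in> points (Tpow M (Suc 0)) \<Longrightarrow> proj (S p) = p"
    and kap: "\<And>p. p \<in> points (Tpow M (Suc 0)) \<Longrightarrow> kappa M (Suc (Suc 0)) (S p) = S p"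
    using S by (auto simp: semispray_def vector_field_def numeral_2_eq_2)
  have C: "mopen (Suc 0) ?C"
    by (rule mopen_cyl[OF banach_manifold_overlap(1)[OF M]])
  have dom: "S p \<in> chart_dom (Tpow M (Suc (Suc 0))) \<alpha>" if p: "p \<in> chart_dom (Tpow M (Suc 0)) \<alpha>" for p
  proof -
    have "S ` points (Tpow M (Suc 0)) \<subseteq> points (Tpow M (Suc (Suc 0)))"
      using sm by (simp add: smooth_map_def)
    then have "S p \<in> points (Tpow M (Suc (Suc 0)))"
      using pointsI[OF p] by blast
    moreover have "proj (S p) = p"
      by (rule pr[OF pointsI[OF p]])
    ultimately show ?thesis
      using p unfolding points_iff chart_dom_Suc[of _ _ "Suc 0"] by auto
  qed
  have rep: "chart (Tpow M (Suc (Suc 0))) \<alpha> (S p) = ?F (chart (Tpow M (Suc 0)) \<alpha> p)"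
    if "p \<in> chart_dom (Tpow M (Suc 0)) \<alpha>" for p
    using good_chartsD(5)[OF g that] by simp
  have F1: "trunc (Suc 0) (?F v) = v" if v: "v \<in> ?C" for v
  proof -
    let ?p = "chart_inv (Tpow M (Suc 0)) \<alpha> v"
    have p: "?p \<in> chart_dom (Tpow M (Suc 0)) \<alpha>" "chart (Tpow M (Suc 0)) \<alpha> ?p = v"
      using good_chartsD(3,4)[OF g v] by auto
    have "proj (S ?p) = ?p"
      by (rule pr[OF pointsI[OF p(1)]])
    then show ?thesis
      using p v by (simp add: chart_Suc[of _ "Suc 0"] cyl_def)
  qed
  have Fm: "?F v \<in> model (Suc (Suc 0))" if v: "v \<in> ?C" for v
    using good_chartsD(2)[OF g dom[OF good_chartsD(3)[OF g v]]] by (simp add: cyl_def)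
  have F2: "trunc 0 (shift (Suc 0) (?F v)) = shift 0 v" if v: "v \<in> ?C" for v
  proof -
    let ?p = "chart_inv (Tpow M (Suc 0)) \<alpha> v"
    have p: "?p \<in> chart_dom (Tpow M (Suc 0)) \<alpha>"
      using good_chartsD(3)[OF g v] .
    have "kappa M (Suc (Suc 0)) (S ?p) = S ?p"
      by (rule kap[OF pointsI[OF p]])
    then have "flip 0 (?F v) = ?F v"
      using kappa_eq(2)[OF M dom[OF p]] by simp
    moreover obtain x y X Y where m: "x \<in> model 0" "y \<in> model 0" "X \<in> model 0" "Y \<in> model 0"
      and e: "?F v = join (Suc 0) (join 0 x y) (join 0 X Y)"
      using model_Suc_Suc_cases[OF Fm[OF v]] by blast
    \<comment> \<open>Invariance under the exchange of the two middle components forces them to be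
      equal.\<close>
    ultimately have "join 0 x X = join 0 x y"
      using join_eq_iff[of "join 0 y Y" "Suc 0" "join 0 X Y" "join 0 x X" "join 0 x y"] by simp
    then have "X = y"
      using m by (simp add: join_eq_iff)
    moreover have "v = join 0 x y"
      using F1[OF v] m unfolding e by simp
    ultimately show ?thesis
      using m unfolding e by simp
  qed
  \<comment> \<open>S covers the identity of M, so its local representative is defined on the whole
    image of the chart.\<close>
  have W: "chart (Tpow M (Suc 0)) \<alpha> ` {p \<in> chart_dom (Tpow M (Suc 0)) \<alpha>. S p \<in> chart_dom (Tpow M (Suc (Suc 0))) \<alpha>} = ?C"
  proof -
    have "{p \<in> chart_dom (Tpow M (Suc 0)) \<alpha>. S p \<in> chart_dom (Tpow M (Suc (Suc 0))) \<alpha>} =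
        chart_dom (Tpow M (Suc 0)) \<alpha>"
      using dom by blast
    moreover have "chart (Tpow M (Suc 0)) \<alpha> ` chart_dom (Tpow M (Suc 0)) \<alpha> = ?C"
      using g[of "Suc 0"] unfolding good_charts_def bij_betw_def by blast
    ultimately show ?thesis
      by (simp only:)
  qed
  have "smooth_on (model (Suc 0)) ?C (local_rep (Tpow M (Suc 0)) (Tpow M (Suc (Suc 0))) S \<alpha> \<alpha>)"
    using sm[unfolded smooth_map_def Let_def, THEN conjunct2, THEN spec, THEN spec, of \<alpha> \<alpha>, unfolded W]
    by (rule conjunct2)
  from smooth_on_imp_tsmooth[OF this subspace_model bounded_linear_trunc trunc_in_model
      bounded_linear_trunc trunc_in_model C]
  have "tsmooth (Suc 0) (Suc (Suc 0)) ?C (\<lambda>q. trunc (Suc (Suc 0))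
      (local_rep (Tpow M (Suc 0)) (Tpow M (Suc (Suc 0))) S \<alpha> \<alpha> (trunc (Suc 0) q)))"
    by (auto simp: cyl_def)
  then have "tsmooth (Suc 0) (Suc (Suc 0)) ?C ?F"
    using Fm by (elim tsmooth_cong[OF _ C]) (auto simp: cyl_def local_rep_def)
  then show ?case
    using F1 F2 dom rep by auto
next
  case (Suc j)
  let ?F = "lift_rep M S \<alpha> j" and ?C = "cyl (Suc j) (overlap M \<alpha> \<alpha>)" and ?C' = "cyl (Suc (Suc j)) (overlap M \<alpha> \<alpha>)"
  have F: "tsmooth (Suc j) (Suc (Suc j)) ?C ?F"
    and F1: "\<And>v. v \<in> ?C \<Longrightarrow> trunc (Suc j) (?F v) = v"
    and F2: "\<And>v. v \<in> ?C \<Longrightarrow> trunc j (shift (Suc j) (?F v)) = shift j v"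
    and IH: "\<And>p. p \<in> chart_dom (Tpow M (Suc j)) \<alpha> \<Longrightarrow> iter_lift M S j p \<in> chart_dom (Tpow M (Suc (Suc j))) \<alpha> \<and>
      chart (Tpow M (Suc (Suc j))) \<alpha> (iter_lift M S j p) = ?F (chart (Tpow M (Suc j)) \<alpha> p)"
    using Suc by blast+
  have C': "mopen (Suc (Suc j)) ?C'"
    by (rule mopen_cyl[OF banach_manifold_overlap(1)[OF M]])
  have "tsmooth (Suc (Suc j)) (Suc (Suc (Suc j))) ?C' (tan_map (Suc j) (Suc (Suc j)) ?F)"
    using tsmooth_cases(4)[OF F] by (simp add: tan_dom_cyl)
  then have 1: "tsmooth (Suc (Suc j)) (Suc (Suc (Suc j))) ?C' (\<lambda>v. tan_map (Suc j) (Suc (Suc j)) ?F (flip j v))"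
    by (rule tsmooth_comp[OF tsmooth_flip[OF C']]) (auto simp: cyl_def)
  have "tsmooth (Suc (Suc j)) (Suc (Suc (Suc j))) ?C'
      (\<lambda>v. flip (Suc j) (tan_map (Suc j) (Suc (Suc j)) ?F (flip j v)))"
    by (rule tsmooth_comp[OF 1 tsmooth_flip[OF mopen_model]]) (use tsmooth_cases(2)[OF 1] in blast)
  then have "tsmooth (Suc (Suc j)) (Suc (Suc (Suc j))) ?C' (lift_rep M S \<alpha> (Suc j))"
    unfolding lift_rep.simps by (rule tsmooth_comp[OF _ tsmooth_tan_flip]) auto
  moreover have "trunc (Suc (Suc j)) (lift_rep M S \<alpha> (Suc j) v) = v"
    "trunc (Suc j) (shift (Suc (Suc j)) (lift_rep M S \<alpha> (Suc j) v)) = shift (Suc j) v" if "v \<in> ?C'" for v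
    using lift_step(1,3)[OF F tsmooth_cases(1)[OF F] F1 F2 that] by simp_all
  moreover have "iter_lift M S (Suc j) p \<in> chart_dom (Tpow M (Suc (Suc (Suc j)))) \<alpha> \<and>
      chart (Tpow M (Suc (Suc (Suc j)))) \<alpha> (iter_lift M S (Suc j) p) =
        lift_rep M S \<alpha> (Suc j) (chart (Tpow M (Suc (Suc j))) \<alpha> p)"
    if p: "p \<in> chart_dom (Tpow M (Suc (Suc j))) \<alpha>" for p
  proof -
    note k = kappa_eq[OF M]
    let ?q1 = "kappa M (Suc (Suc j)) p"
    let ?q2 = "tmap M (Suc j) (Suc (Suc j)) (iter_lift M S j) ?q1"
    let ?q3 = "kappa M (Suc (Suc (Suc j))) ?q2"
    note q2 = tmap_eq[OF M F IH k(1)[OF p]]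
    note q3 = k[OF q2(1)]
    note q4 = tmap_eq[OF M tsmooth_flip[OF C'] conjI[OF k[where r = j]] q3(1)]
    have "iter_lift M S (Suc j) p = tmap M (Suc (Suc j)) (Suc (Suc j)) (kappa M (Suc (Suc j))) ?q3"
      by (simp add: complete_lift_def)
    then show ?thesis
      using q4(1,3) q3(2) q2(3) k(2)[OF p] by simp
  qed
  ultimately show ?case by blast
qed

text \<open>By \<open>trunc_spray_field\<close> an integral curve (c, v) satisfies c' = v, so it is
  the velocity curve of c.\<close>

lemma spray_field:
  fixes M :: "('m, 'i, 'e::banach) atlas"
  assumes M: "banach_manifold M" and S: "semispray M 0 S"
  shows spray_field_tsmooth: "tsmooth (Suc j) (Suc j) (cyl (Suc j) (overlap M \<alpha> \<alpha>)) (spray_field M S \<alpha> j)"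
    and iter_lift_chart: "p \<in> chart_dom (Tpow M (Suc j)) \<alpha> \<Longrightarrow>
      iter_lift M S j p \<in> chart_dom (Tpow M (Suc (Suc j))) \<alpha> \<and>
      chart (Tpow M (Suc (Suc j))) \<alpha> (iter_lift M S j p) = join (Suc j) (chart (Tpow M (Suc j)) \<alpha> p)
        (spray_field M S \<alpha> j (chart (Tpow M (Suc j)) \<alpha> p))"
    and spray_field_Suc: "v \<in> cyl (Suc (Suc j)) (overlap M \<alpha> \<alpha>) \<Longrightarrow> spray_field M S \<alpha> (Suc j) v =
      flip j (tan_map (Suc j) (Suc j) (spray_field M S \<alpha> j) (flip j v))"
    and trunc_spray_field: "v \<in> cyl (Suc j) (overlap M \<alpha> \<alpha>) \<Longrightarrow> trunc j (spray_field M S \<alpha> j v) = shift j v"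
proof -
  let ?F = "lift_rep M S \<alpha> j" and ?C = "cyl (Suc j) (overlap M \<alpha> \<alpha>)"
  have F: "tsmooth (Suc j) (Suc (Suc j)) ?C ?F"
    and F1: "\<And>v. v \<in> ?C \<Longrightarrow> trunc (Suc j) (?F v) = v"
    and F2: "\<And>v. v \<in> ?C \<Longrightarrow> trunc j (shift (Suc j) (?F v)) = shift j v"
    and IH: "\<And>p. p \<in> chart_dom (Tpow M (Suc j)) \<alpha> \<Longrightarrow> iter_lift M S j p \<in> chart_dom (Tpow M (Suc (Suc j))) \<alpha> \<and>
      chart (Tpow M (Suc (Suc j))) \<alpha> (iter_lift M S j p) = ?F (chart (Tpow M (Suc j)) \<alpha> p)"
    using lift_rep[OF M S, of j \<alpha>] by blast+
  have A: "spray_field M S \<alpha> j = (\<lambda>v. shift (Suc j) (?F v))"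
    by (rule ext) (simp add: spray_field_def)
  have "tsmooth (Suc (Suc j)) (Suc j) (model (Suc (Suc j))) (shift (Suc j))"
    by (rule tsmooth_linear[OF bounded_linear_shift _ mopen_model]) simp
  then show "tsmooth (Suc j) (Suc j) ?C (spray_field M S \<alpha> j)"
    unfolding A using tsmooth_cases(2)[OF F] by (intro tsmooth_comp[OF F]) auto
  show "trunc j (spray_field M S \<alpha> j v) = shift j v" if "v \<in> ?C"
    using F2[OF that] by (simp add: A)
  show "spray_field M S \<alpha> (Suc j) v = flip j (tan_map (Suc j) (Suc j) (spray_field M S \<alpha> j) (flip j v))"
    if "v \<in> cyl (Suc (Suc j)) (overlap M \<alpha> \<alpha>)"
    using lift_step(2)[OF F tsmooth_cases(1)[OF F] F1 F2 that] unfolding A by (simp add: spray_field_def)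
  show "iter_lift M S j p \<in> chart_dom (Tpow M (Suc (Suc j))) \<alpha> \<and>
      chart (Tpow M (Suc (Suc j))) \<alpha> (iter_lift M S j p) = join (Suc j) (chart (Tpow M (Suc j)) \<alpha> p)
        (spray_field M S \<alpha> j (chart (Tpow M (Suc j)) \<alpha> p))"
    if p: "p \<in> chart_dom (Tpow M (Suc j)) \<alpha>"
  proof -
    let ?v = "chart (Tpow M (Suc j)) \<alpha> p"
    have v: "?v \<in> ?C"
      by (rule good_chartsD(2)[OF good_charts[OF M] p])
    have "?F ?v = join (Suc j) ?v (spray_field M S \<alpha> j ?v)"
      using F1[OF v] tsmooth_cases(2)[OF F v] unfolding A by (metis join_trunc_shift trunc_id)
    then show ?thesis
      using IH[OF p] by simp
  qed
qed

text \<open>Both sides lie over the velocity vector at t, so only the fibre halves have to be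
  compared. The first derivative is required on all of I because the second velocity differentiates
  the velocity curve.\<close>

lemma geodesic_equation_chart:
  fixes M :: "('m, 'i, 'e::banach) atlas"
  assumes M: "banach_manifold M" and S: "semispray M 0 S" and I: "open I" "t \<in> I"
    and c: "\<And>s. s \<in> I \<Longrightarrow> \<gamma> s \<in> chart_dom (Tpow M i) \<alpha> \<and> chart (Tpow M i) \<alpha> (\<gamma> s) = c s"
    and c1: "\<And>s. s \<in> I \<Longrightarrow> (c has_vector_derivative c1 s) (at s)"
    and c2: "(c1 has_vector_derivative c2) (at t)"
  shows "velocity M (Suc i) (velocity M i \<gamma>) t = iter_lift M S i (velocity M i \<gamma> t) \<longleftrightarrow>
    join i (c1 t) c2 = spray_field M S \<alpha> i (join i (c t) (c1 t))"
proof -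
  note g = good_charts[OF M]
  have v: "velocity M i \<gamma> s \<in> chart_dom (Tpow M (Suc i)) \<alpha> \<and>
      chart (Tpow M (Suc i)) \<alpha> (velocity M i \<gamma> s) = join i (c s) (c1 s)" if "s \<in> I" for s
    using velocity_eq(1,3)[OF M I(1) that c c1[OF that]] by blast
  have "((\<lambda>s. join i (c s) (c1 s)) has_vector_derivative join i (c1 t) c2) (at t)"
    using bounded_linear.has_vector_derivative[OF bounded_linear_join
        has_vector_derivative_Pair[OF c1[OF I(2)] c2]] by simp
  note vv = velocity_eq[OF M I v this]
  have c1m: "c1 s \<in> model i" if "s \<in> I" for s
  proof (rule vector_derivative_in_model[OF c1[OF that] I(1) that])
    show "c s \<in> model i" if "s \<in> I" for s
      using good_chartsD(2)[OF g, of "\<gamma> s" i \<alpha>] c[OF that] by (auto simp: cyl_def)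
  qed
  have "c2 \<in> model i"
    by (rule vector_derivative_in_model[OF c2 I c1m])
  moreover have "spray_field M S \<alpha> i u \<in> model (Suc i)" for u
    by (simp add: spray_field_def)
  moreover note l = iter_lift_chart[OF M S, of "velocity M i \<gamma> t" i \<alpha>]
  have "velocity M (Suc i) (velocity M i \<gamma>) t = iter_lift M S i (velocity M i \<gamma> t) \<longleftrightarrow>
      join (Suc i) (join i (c t) (c1 t)) (join i (c1 t) c2) =
      join (Suc i) (join i (c t) (c1 t)) (spray_field M S \<alpha> i (join i (c t) (c1 t)))"
    using inj_on_eq_iff[OF good_chartsD(1)[OF g, of "Suc (Suc i)" \<alpha>] vv(1)] l v[OF I(2)] vv(3) by metis
  ultimately show ?thesis
    by (simp add: join_eq_iff)
qed

section \<open>Curves in a chart\<close>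

lemma csmooth_cong:
  assumes c: "csmooth r I c" and I': "open I'" "I' \<subseteq> I" and k: "\<And>t. t \<in> I' \<Longrightarrow> k t = c t"
  shows "csmooth r I' k"
  by (rule csmooth_comp[OF tsmooth_linear[OF bounded_linear_ident _ mopen_model] c _ I' k])
    (use csmooth_cases(2)[OF c] in auto)

text \<open>Smoothness of curves in a manifold is demanded in all charts; a curve known in \<alpha>
  reaches the others by the coordinate changes.\<close>

lemma curve_other_chart:
  fixes M :: "('m, 'i, 'e::banach) atlas"
  assumes M: "banach_manifold M" and c: "csmooth r I c"
    and \<gamma>: "\<And>s. s \<in> I \<Longrightarrow> \<gamma> s \<in> chart_dom (Tpow M r) \<alpha> \<and> chart (Tpow M r) \<alpha> (\<gamma> s) = c s"
  shows "{t \<in> I. \<gamma> t \<in> chart_dom (Tpow M r) \<beta>} = {t \<in> I. apply_bcontfun (c t) 0 \<in> overlap M \<alpha> \<beta>}"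
    "open {t \<in> I. \<gamma> t \<in> chart_dom (Tpow M r) \<beta>}"
    "csmooth r {t \<in> I. \<gamma> t \<in> chart_dom (Tpow M r) \<beta>} (\<lambda>t. chart (Tpow M r) \<beta> (\<gamma> t))"
proof -
  note g = good_charts[OF M]
  let ?J = "{t \<in> I. \<gamma> t \<in> chart_dom (Tpow M r) \<beta>}"
  show J: "?J = {t \<in> I. apply_bcontfun (c t) 0 \<in> overlap M \<alpha> \<beta>}"
    using good_chartsD(6)[OF g, of "\<gamma> _" r \<alpha> \<beta>] \<gamma> csmooth_cases(2)[OF c] by (auto simp: cyl_def)
  have "continuous_on I c"
    using csmooth_cases(3)[OF c] by (meson continuous_at_imp_continuous_on differentiable_imp_continuous_within)
  then have "continuous_on I (\<lambda>t. apply_bcontfun (c t) 0)"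
    using bounded_linear.continuous_on[OF bounded_linear_apply_0] by blast
  then have "open (I \<inter> (\<lambda>t. apply_bcontfun (c t) 0) -` overlap M \<alpha> \<beta>)"
    using banach_manifold_overlap(1)[OF M] csmooth_cases(1)[OF c] continuous_open_preimage by blast
  then show o: "open ?J"
    unfolding J by (simp add: Int_def vimage_def)
  have "csmooth r ?J c"
    by (rule csmooth_cong[OF c o]) auto
  then show "csmooth r ?J (\<lambda>t. chart (Tpow M r) \<beta> (\<gamma> t))"
  proof (rule csmooth_comp[OF trans_map_tsmooth[OF M, of r \<alpha> \<beta>] _ _ o order_refl])
    show "c ` ?J \<subseteq> cyl r (overlap M \<alpha> \<beta>)"
      unfolding J using csmooth_cases(2)[OF c] by (auto simp: cyl_def)
    show "chart (Tpow M r) \<beta> (\<gamma> t) = trans_map M \<alpha> \<beta> r (c t)" if "t \<in> ?J" for t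
      using good_chartsD(7)[OF g, of "\<gamma> t" r \<alpha> \<beta>] \<gamma>[of t] that by auto
  qed
qed

lemma smooth_map_curveI:
  fixes M :: "('m, 'i, 'e::banach) atlas"
  assumes M: "banach_manifold M" and c: "csmooth r {-\<epsilon><..<\<epsilon>} c"
    and \<gamma>: "\<And>s. s \<in> {-\<epsilon><..<\<epsilon>} \<Longrightarrow> \<gamma> s \<in> chart_dom (Tpow M r) \<alpha> \<and> chart (Tpow M r) \<alpha> (\<gamma> s) = c s"
  shows "smooth_map UNIV (real_atlas {-\<epsilon><..<\<epsilon>}) (Tpow M r) \<gamma>"
proof -
  let ?I = "{-\<epsilon><..<\<epsilon>}"
  have "smooth_on UNIV {t \<in> ?I. \<gamma> t \<in> chart_dom (Tpow M r) \<beta>}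
      (local_rep (real_atlas ?I) (Tpow M r) \<gamma> u \<beta>)" for u \<beta>
  proof (rule csmooth_imp_smooth_on[where r = r])
    let ?J = "{t \<in> ?I. \<gamma> t \<in> chart_dom (Tpow M r) \<beta>}"
    have "chart_inv (real_atlas ?I) u t = t" if "t \<in> ?I" for t
      using that inv_into_f_f[of "\<lambda>t. t" ?I t] by (simp add: chart_inv_def real_atlas_def)
    then have "local_rep (real_atlas ?I) (Tpow M r) \<gamma> u \<beta> t = chart (Tpow M r) \<beta> (\<gamma> t)" if "t \<in> ?J" for t
      using that by (simp add: local_rep_def)
    then show "csmooth r ?J (local_rep (real_atlas ?I) (Tpow M r) \<gamma> u \<beta>)"
      using csmooth_cong[OF curve_other_chart(3)[OF M c \<gamma>, of \<beta>] curve_other_chart(2)[OF M c \<gamma>, of \<beta>] order_refl,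
          of "local_rep (real_atlas ?I) (Tpow M r) \<gamma> u \<beta>"] by blast
  qed
  moreover have "\<gamma> ` ?I \<subseteq> points (Tpow M r)"
    using \<gamma> pointsI by fast
  moreover have "open {t \<in> ?I. \<gamma> t \<in> chart_dom (Tpow M r) \<beta>}" for \<beta>
    by (rule curve_other_chart(2)[OF M c \<gamma>])
  ultimately show ?thesis
    by (simp add: smooth_map_def real_atlas_def points_def)
qed

section \<open>Chart domains and curves in the projective limit\<close>

lemma Tinf_chart_dom:
  assumes "y \<in> Tinf M" "y 0 \<in> chart_dom (Tpow M 0) \<alpha>"
  shows "y i \<in> chart_dom (Tpow M i) \<alpha>"
proof (induction i)
  case (Suc i)
  have "y (Suc i) \<in> points (Tpow M (Suc i))" "proj (y (Suc i)) = y i"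
    using assms(1) by (auto simp: Tinf_def)
  then show ?case
    using Suc unfolding points_iff chart_dom_Suc by auto
qed (use assms in simp)

text \<open>A limit chart domain imposes infinitely many conditions, one for each level. They all
  reduce to the base point in M, so the set of times in it is the same for every level and therefore
  open.\<close>

lemma smooth_curve_infI:
  fixes M :: "('m, 'i, 'e::banach) atlas"
  assumes M: "banach_manifold M" and c: "\<And>i. csmooth i {-\<epsilon><..<\<epsilon>} (c i)"
    and \<gamma>: "\<And>s i. s \<in> {-\<epsilon><..<\<epsilon>} \<Longrightarrow> \<gamma> s i \<in> chart_dom (Tpow M i) \<alpha> \<and> chart (Tpow M i) \<alpha> (\<gamma> s i) = c i s"
    and proj: "\<And>s i. s \<in> {-\<epsilon><..<\<epsilon>} \<Longrightarrow> trunc i (c (Suc i) s) = c i s"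
  shows "smooth_curve_inf M \<epsilon> \<gamma>"
proof -
  note g = good_charts[OF M]
  let ?I = "{-\<epsilon><..<\<epsilon>}"
  have T: "\<gamma> s \<in> Tinf M" if s: "s \<in> ?I" for s
  proof -
    have "proj (\<gamma> s (Suc i)) = \<gamma> s i" for i
    proof (rule inj_onD[OF good_chartsD(1)[OF g, of i \<alpha>]])
      have d: "\<gamma> s (Suc i) \<in> chart_dom (Tpow M (Suc i)) \<alpha>" "\<gamma> s i \<in> chart_dom (Tpow M i) \<alpha>"
        using \<gamma>[OF s] by auto
      then show p: "proj (\<gamma> s (Suc i)) \<in> chart_dom (Tpow M i) \<alpha>" "\<gamma> s i \<in> chart_dom (Tpow M i) \<alpha>"
        by (auto simp: chart_dom_Suc)
      have "chart (Tpow M i) \<alpha> (proj (\<gamma> s (Suc i))) \<in> model i"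
        using good_chartsD(2)[OF g p(1)] by (simp add: cyl_def)
      then have "chart (Tpow M i) \<alpha> (proj (\<gamma> s (Suc i))) = trunc i (chart (Tpow M (Suc i)) \<alpha> (\<gamma> s (Suc i)))"
        by (simp add: chart_Suc)
      then show "chart (Tpow M i) \<alpha> (proj (\<gamma> s (Suc i))) = chart (Tpow M i) \<alpha> (\<gamma> s i)"
        using \<gamma>[OF s] proj[OF s] by simp
    qed
    then show ?thesis
      using \<gamma>[OF s] pointsI by (auto simp: Tinf_def) fast
  qed
  have "{t \<in> ?I. \<gamma> t \<in> chart_dom (Tinf_atlas M) \<beta>} = {t \<in> ?I. \<gamma> t i \<in> chart_dom (Tpow M i) \<beta>}" for \<beta> i
  proof -
    \<comment> \<open>Projection preserves coordinate 0, the base point.\<close>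
    have h: "apply_bcontfun (c i t) 0 = apply_bcontfun (c 0 t) 0" if "t \<in> ?I" for t i
      using that by (induction i) (metis proj apply_trunc_0)+
    have "\<gamma> t i \<in> chart_dom (Tpow M i) \<beta> \<longleftrightarrow> apply_bcontfun (c 0 t) 0 \<in> overlap M \<alpha> \<beta>" if "t \<in> ?I" for t i
    proof -
      have "t \<in> {t \<in> ?I. \<gamma> t i \<in> chart_dom (Tpow M i) \<beta>} \<longleftrightarrow> t \<in> {t \<in> ?I. apply_bcontfun (c i t) 0 \<in> overlap M \<alpha> \<beta>}"
        by (simp only: curve_other_chart(1)[OF M c \<gamma>])
      then show ?thesis
        using that h[OF that, of i] by simp
    qed
    then show ?thesis
      using T by (auto simp: Tinf_atlas_def)
  qed
  note eq = this
  show ?thesis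
    unfolding smooth_curve_inf_def Let_def
  proof (intro conjI ballI allI)
    fix \<beta>
    show "open {t \<in> ?I. \<gamma> t \<in> chart_dom (Tinf_atlas M) \<beta>}"
      unfolding eq[of \<beta> 0] by (rule curve_other_chart(2)[OF M c \<gamma>])
    show "smooth_frechet_curve {t \<in> ?I. \<gamma> t \<in> chart_dom (Tinf_atlas M) \<beta>}
        (\<lambda>t. chart (Tinf_atlas M) \<beta> (\<gamma> t))"
    proof (rule smooth_frechet_curveI[where r = "\<lambda>i. i"])
      show "csmooth i {t \<in> ?I. \<gamma> t \<in> chart_dom (Tinf_atlas M) \<beta>} (\<lambda>t. chart (Tinf_atlas M) \<beta> (\<gamma> t) i)" for i
        unfolding eq[of \<beta> i] using curve_other_chart(3)[OF M c \<gamma>] by (simp add: Tinf_atlas_def)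
    qed
  qed (rule T)
qed

text \<open>Brings continuity in a chart of T^0 M to the topology of M, in which the Hausdorff
  property is stated.\<close>

lemma curve_foot_continuous:
  fixes M :: "('m, 'i, 'e::banach) atlas"
  assumes M: "banach_manifold M" and W: "openin (atlas_topology M) W" and J: "open J" "t \<in> J"
    and p: "\<And>s. s \<in> J \<Longrightarrow> p s \<in> chart_dom (Tpow M 0) \<beta> \<and> chart (Tpow M 0) \<beta> (p s) = c s"
    and c: "continuous (at t) c" and t: "foot (p t) \<in> W"
  shows "\<forall>\<^sub>F s in at t. foot (p s) \<in> W"
proof -
  have inj: "inj_on (chart M \<beta>) (chart_dom M \<beta>)" for \<beta>
    by (rule banach_manifold_overlap(2)[OF M])
  have o: "open (chart M \<beta> ` (W \<inter> chart_dom M \<beta>))"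
    using W openin_atlas_topology[OF inj] by blast
  have f: "foot (p s) \<in> chart_dom M \<beta> \<and> chart M \<beta> (foot (p s)) = apply_bcontfun (c s) 0" if "s \<in> J" for s
  proof -
    have "p s \<in> Base ` chart_dom M \<beta>" "embed (chart M \<beta> (foot (p s))) = c s"
      using p[OF that] by auto
    then show ?thesis
      using apply_embed[of "chart M \<beta> (foot (p s))" 0] by auto
  qed
  have "((\<lambda>s. apply_bcontfun (c s) 0) \<longlongrightarrow> apply_bcontfun (c t) 0) (at t)"
    using bounded_linear.tendsto[OF bounded_linear_apply_0] c unfolding continuous_at by blast
  moreover have "apply_bcontfun (c t) 0 \<in> chart M \<beta> ` (W \<inter> chart_dom M \<beta>)"
    using f[OF J(2)] t by (metis IntI imageI)
  ultimately have "\<forall>\<^sub>F s in at t. apply_bcontfun (c s) 0 \<in> chart M \<beta> ` (W \<inter> chart_dom M \<beta>)"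
    using o topological_tendstoD by blast
  moreover have "\<forall>\<^sub>F s in at t. s \<in> J"
    using J eventually_at_in_open' by blast
  ultimately show ?thesis
  proof eventually_elim
    case (elim s)
    then show ?case
      using f[of s] inj_onD[OF inj[of \<beta>], of "foot (p s)"] by force
  qed
qed


section \<open>Geodesics\<close>

declare Tpow.simps(1) [simp del]

text \<open>Nothing is assumed about where the geodesic runs: J collects the times inside the chart,
  and only there is w the coordinate curve of the velocity. It is the same set for all levels, since
  membership at level 0 implies membership at each.\<close>

lemma geodesic_inf_chart:
  fixes M :: "('m, 'i, 'e::banach) atlas" and \<alpha> :: 'i
  assumes M: "banach_manifold M" and S: "semispray M 0 S" and geo: "geodesic_inf M (lift_inf M S) \<epsilon> \<eta>"
  defines "J \<equiv> {t \<in> {-\<epsilon><..<\<epsilon>}. \<eta> t 0 \<in> chart_dom (Tpow M 0) \<alpha>}"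
    and "w \<equiv> \<lambda>i t. chart (Tpow M (Suc i)) \<alpha> (velocity M i (\<lambda>s. \<eta> s i) t)"
  shows "open J"
    "t \<in> J \<Longrightarrow> \<eta> t i \<in> chart_dom (Tpow M i) \<alpha> \<and> velocity M i (\<lambda>s. \<eta> s i) t \<in> chart_dom (Tpow M (Suc i)) \<alpha>
      \<and> chart (Tpow M i) \<alpha> (\<eta> t i) = trunc i (w i t)"
    "t \<in> J \<Longrightarrow> w i t \<in> cyl (Suc i) (overlap M \<alpha> \<alpha>) \<and>
      (w i has_vector_derivative spray_field M S \<alpha> i (w i t)) (at t)"
proof -
  note g = good_charts[OF M]
  have sm: "smooth_curve_inf M \<epsilon> \<eta>"
    and eq: "\<And>t. t \<in> {-\<epsilon><..<\<epsilon>} \<Longrightarrow>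
      velocity_inf M 1 (velocity_inf M 0 \<eta>) t = lift_inf M S (velocity_inf M 0 \<eta> t)"
    using geo by (auto simp: geodesic_inf_def)
  have T: "\<And>t. t \<in> {-\<epsilon><..<\<epsilon>} \<Longrightarrow> \<eta> t \<in> Tinf M"
    using sm by (auto simp: smooth_curve_inf_def)
  have dom: "\<eta> s i \<in> chart_dom (Tpow M i) \<alpha>" if "s \<in> J" for s i
    using Tinf_chart_dom[OF T] that by (auto simp: J_def)
  have J: "J = {t \<in> {-\<epsilon><..<\<epsilon>}. \<eta> t \<in> chart_dom (Tinf_atlas M) \<alpha>}"
    using dom T by (auto simp: J_def Tinf_atlas_def)
  have o: "open J" and "smooth_frechet_curve J (\<lambda>t. chart (Tinf_atlas M) \<alpha> (\<eta> t))"
    using sm unfolding J smooth_curve_inf_def Let_def by blast+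
  then obtain d where d0: "\<And>t. t \<in> J \<Longrightarrow> d 0 t = chart (Tinf_atlas M) \<alpha> (\<eta> t)"
    and d: "\<And>t k i. t \<in> J \<Longrightarrow> ((\<lambda>s. d k s i) has_vector_derivative d (Suc k) t i) (at t)"
    using smooth_frechet_curveD by blast
  show "open J" by (rule o)
  have c: "\<eta> s i \<in> chart_dom (Tpow M i) \<alpha> \<and> chart (Tpow M i) \<alpha> (\<eta> s i) = d 0 s i" if "s \<in> J" for s i
    using dom[OF that] d0[OF that] by (simp add: Tinf_atlas_def)
  have d1: "((\<lambda>s. d 0 s i) has_vector_derivative d 1 t i) (at t)"
    and d2: "((\<lambda>s. d 1 s i) has_vector_derivative d 2 t i) (at t)" if "t \<in> J" for t i
    using d[OF that, of 0] d[OF that, of 1] by (simp_all add: numeral_2_eq_2)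
  have v: "velocity M i (\<lambda>s. \<eta> s i) t \<in> chart_dom (Tpow M (Suc i)) \<alpha>" "w i t = join i (d 0 t i) (d 1 t i)"
    if "t \<in> J" for t i
    using velocity_eq(1,3)[OF M o that c d1[OF that]] by (simp_all add: w_def)
  show "\<eta> t i \<in> chart_dom (Tpow M i) \<alpha> \<and> velocity M i (\<lambda>s. \<eta> s i) t \<in> chart_dom (Tpow M (Suc i)) \<alpha>
      \<and> chart (Tpow M i) \<alpha> (\<eta> t i) = trunc i (w i t)" if t: "t \<in> J"
  proof -
    have "d 0 t i \<in> model i"
      using good_chartsD(2)[OF g dom[OF t, of i]] c[OF t, of i] by (simp add: cyl_def)
    then show ?thesis
      using c[OF t, of i] v[OF t, of i] by simp
  qed
  show "w i t \<in> cyl (Suc i) (overlap M \<alpha> \<alpha>) \<and>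
      (w i has_vector_derivative spray_field M S \<alpha> i (w i t)) (at t)" if t: "t \<in> J"
  proof
    show "w i t \<in> cyl (Suc i) (overlap M \<alpha> \<alpha>)"
      unfolding w_def by (rule good_chartsD(2)[OF g v(1)[OF t]])
    have "t \<in> {-\<epsilon><..<\<epsilon>}"
      using t by (simp add: J_def)
    from fun_cong[OF eq[OF this], of i]
    have "velocity M (Suc i) (velocity M i (\<lambda>s. \<eta> s i)) t = iter_lift M S i (velocity M i (\<lambda>s. \<eta> s i) t)"
      by (simp add: velocity_inf_def lift_inf_def)
    then have e: "join i (d 1 t i) (d 2 t i) = spray_field M S \<alpha> i (w i t)"
      using geodesic_equation_chart[OF M S o t c d1 d2[OF t]] v(2)[OF t] by simp
    have "((\<lambda>s. join i (d 0 s i) (d 1 s i)) has_vector_derivative join i (d 1 t i) (d 2 t i)) (at t)"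
      using bounded_linear.has_vector_derivative[OF bounded_linear_join
          has_vector_derivative_Pair[OF d1[OF t] d2[OF t]]] by simp
    then show "(w i has_vector_derivative spray_field M S \<alpha> i (w i t)) (at t)"
      unfolding e by (rule has_vector_derivative_transform_within_open[OF _ o t]) (simp add: v(2))
  qed
qed

lemma geodesic_inf_foot_continuous:
  fixes M :: "('m, 'i, 'e::banach) atlas"
  assumes M: "banach_manifold M" and S: "semispray M 0 S" and geo: "geodesic_inf M (lift_inf M S) \<epsilon> \<eta>"
    and t: "t \<in> {-\<epsilon><..<\<epsilon>}" and W: "openin (atlas_topology M) W" "foot (\<eta> t 0) \<in> W"
  shows "\<forall>\<^sub>F s in at t. foot (\<eta> s 0) \<in> W"
proof -
  have "\<eta> t \<in> Tinf M"
    using geo t by (auto simp: geodesic_inf_def smooth_curve_inf_def)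
  then obtain \<beta> where \<beta>: "\<eta> t 0 \<in> chart_dom (Tpow M 0) \<beta>"
    unfolding Tinf_def points_iff by blast
  note w = geodesic_inf_chart[OF M S geo, where \<alpha> = \<beta>]
  let ?J = "{t \<in> {-\<epsilon><..<\<epsilon>}. \<eta> t 0 \<in> chart_dom (Tpow M 0) \<beta>}"
  let ?w = "\<lambda>t. chart (Tpow M (Suc 0)) \<beta> (velocity M 0 (\<lambda>s. \<eta> s 0) t)"
  have J: "t \<in> ?J"
    using t \<beta> by blast
  have "(?w \<longlongrightarrow> ?w t) (at t)"
    using w(3)[OF J, of 0] has_vector_derivative_continuous[unfolded continuous_within] by blast
  then have "continuous (at t) (\<lambda>t. trunc 0 (?w t))"
    unfolding continuous_at by (rule bounded_linear.tendsto[OF bounded_linear_trunc])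
  moreover have "\<eta> s 0 \<in> chart_dom (Tpow M 0) \<beta> \<and> chart (Tpow M 0) \<beta> (\<eta> s 0) = trunc 0 (?w s)"
    if "s \<in> ?J" for s
    using w(2)[OF that, of 0] by blast
  ultimately show ?thesis
    using curve_foot_continuous[OF M W(1) w(1) J, where p = "\<lambda>s. \<eta> s 0" and c = "\<lambda>s. trunc 0 (?w s)"] W(2) by blast
qed

text \<open>Level 0 is treated first and alone, since it decides whether the second geodesic stays
  in the chart.\<close>

lemma geodesic_inf_unique:
  fixes M :: "('m, 'i, 'e::banach) atlas"
  assumes M: "banach_manifold M" and S: "semispray M 0 S" and \<epsilon>: "\<epsilon> > 0"
    and \<theta>: "geodesic_inf M (lift_inf M S) \<epsilon> \<theta>" and \<eta>: "geodesic_inf M (lift_inf M S) \<epsilon> \<eta>"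
    and dom: "\<And>t. t \<in> {-\<epsilon><..<\<epsilon>} \<Longrightarrow> \<theta> t 0 \<in> chart_dom (Tpow M 0) \<alpha>"
    and init: "\<theta> 0 = \<eta> 0" "velocity_inf M 0 \<theta> 0 = velocity_inf M 0 \<eta> 0"
    and t: "t \<in> {-\<epsilon><..<\<epsilon>}"
  shows "\<theta> t = \<eta> t"
proof -
  note g = good_charts[OF M]
  let ?I = "{-\<epsilon><..<\<epsilon>}"
  let ?J = "{t \<in> ?I. \<eta> t 0 \<in> chart_dom (Tpow M 0) \<alpha>}"
  let ?w = "\<lambda>i t. chart (Tpow M (Suc i)) \<alpha> (velocity M i (\<lambda>s. \<eta> s i) t)"
  let ?z = "\<lambda>i t. chart (Tpow M (Suc i)) \<alpha> (velocity M i (\<lambda>s. \<theta> s i) t)"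
  note z = geodesic_inf_chart[OF M S \<theta>, where \<alpha> = \<alpha>] and w = geodesic_inf_chart[OF M S \<eta>, where \<alpha> = \<alpha>]
  have A: "tsmooth (Suc i) (Suc i) (cyl (Suc i) (overlap M \<alpha> \<alpha>)) (spray_field M S \<alpha> i)" for i
    by (rule spray_field_tsmooth[OF M S])
  have v0: "velocity M i (\<lambda>s. \<theta> s i) 0 = velocity M i (\<lambda>s. \<eta> s i) 0" for i
    using fun_cong[OF init(2), of i] by (simp add: velocity_inf_def)
  \<comment> \<open>Base point and velocity are tracked together: velocities alone could be compared
    at times when \<eta> is outside the chart and \<open>?w\<close> has no meaning.\<close>
  let ?P = "\<lambda>t. \<theta> t 0 = \<eta> t 0 \<and> ?z 0 t = ?w 0 t"
  have P: "?P t" if "t \<in> ?I" for t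
  proof (rule interval_clopen[where P = ?P, OF _ \<epsilon> _ _ that])
    show "?P 0"
      using init(1) v0 by simp
  next
    fix t assume t: "t \<in> ?I" and Pt: "?P t"
    then have tJ: "t \<in> ?J"
      using dom[OF t] by simp
    \<comment> \<open>Besides equality this yields that \<eta> remains in the chart near t.\<close>
    have "\<exists>\<delta>>0. \<forall>s. \<bar>s - t\<bar> < \<delta> \<longrightarrow> s \<in> ?J \<and> ?z 0 s = ?w 0 s"
    proof (rule ode_unique_local[OF A w(1) tJ])
      show "?z 0 s \<in> cyl (Suc 0) (overlap M \<alpha> \<alpha>) \<and>
          (?z 0 has_vector_derivative spray_field M S \<alpha> 0 (?z 0 s)) (at s)" if "s \<in> ?J" for s
        using that dom by (intro z(3)) auto
    qed (use w(3) Pt in auto)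
    then obtain \<delta> where \<delta>: "\<delta> > 0" "\<And>s. \<bar>s - t\<bar> < \<delta> \<Longrightarrow> s \<in> ?J \<and> ?z 0 s = ?w 0 s"
      by blast
    have "\<theta> s 0 = \<eta> s 0" if "\<bar>s - t\<bar> < \<delta>" for s
    proof (rule inj_onD[OF good_chartsD(1)[OF g, of 0 \<alpha>]])
      have s: "s \<in> ?J" "?z 0 s = ?w 0 s"
        using \<delta>(2)[OF that] by auto
      moreover have "s \<in> {t \<in> ?I. \<theta> t 0 \<in> chart_dom (Tpow M 0) \<alpha>}"
        using s(1) dom by auto
      ultimately show "\<theta> s 0 \<in> chart_dom (Tpow M 0) \<alpha>" "\<eta> s 0 \<in> chart_dom (Tpow M 0) \<alpha>"
        "chart (Tpow M 0) \<alpha> (\<theta> s 0) = chart (Tpow M 0) \<alpha> (\<eta> s 0)"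
        using z(2)[of s 0] w(2)[of s 0] by auto
    qed
    then show "\<exists>\<delta>>0. \<forall>s. \<bar>s - t\<bar> < \<delta> \<longrightarrow> ?P s"
      using \<delta> by blast
  next
    fix t assume t: "t \<in> ?I" and Pt: "\<not> ?P t"
    have "\<forall>\<^sub>F s in at t. \<not> ?P s"
    \<comment> \<open>With equal base points both curves are in the chart and their velocities
      differ, which persists by continuity; with different base points the Hausdorff property
      separates the base curves.\<close>
    proof (cases "\<theta> t 0 = \<eta> t 0")
      case True
      then have tJ: "t \<in> ?J" "t \<in> {t \<in> ?I. \<theta> t 0 \<in> chart_dom (Tpow M 0) \<alpha>}"
        using t dom[OF t] by simp_all
      have "((\<lambda>s. ?z 0 s - ?w 0 s) \<longlongrightarrow> ?z 0 t - ?w 0 t) (at t)"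
        using z(3)[OF tJ(2), of 0] w(3)[OF tJ(1), of 0] has_vector_derivative_continuous[unfolded continuous_within]
        by (intro tendsto_diff) blast+
      then have "\<forall>\<^sub>F s in at t. ?z 0 s - ?w 0 s \<noteq> 0"
        by (rule tendsto_imp_eventually_ne) (use Pt True in simp)
      then show ?thesis
        by eventually_elim auto
    next
      case False
      have T: "\<theta> t 0 \<in> points (Tpow M 0)" "\<eta> t 0 \<in> points (Tpow M 0)"
        using \<theta> \<eta> t by (auto simp: geodesic_inf_def smooth_curve_inf_def Tinf_def)
      have inj: "inj_on (chart M \<beta>) (chart_dom M \<beta>)" for \<beta>
        by (rule banach_manifold_overlap(2)[OF M])
      have "open (chart M \<beta> ` (points M \<inter> chart_dom M \<beta>))" for \<beta>
      proof -
        have "points M \<inter> chart_dom M \<beta> = chart_dom M \<beta>"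
          by (auto simp: points_def)
        then show ?thesis
          using M by (simp add: banach_manifold_def)
      qed
      then have "points M \<subseteq> topspace (atlas_topology M)"
        by (intro openin_subset) (simp add: openin_atlas_topology[OF inj])
      moreover have "foot (\<theta> t 0) \<in> points M" "foot (\<eta> t 0) \<in> points M"
        using T by (auto simp: points_def Tpow.simps(1))
      ultimately have top: "foot (\<theta> t 0) \<in> topspace (atlas_topology M)" "foot (\<eta> t 0) \<in> topspace (atlas_topology M)"
        by blast+
      have ne: "foot (\<theta> t 0) \<noteq> foot (\<eta> t 0)"
        using T False by (auto simp: points_def Tpow.simps(1))
      have "Hausdorff_space (atlas_topology M)"
        using M by (simp add: banach_manifold_def)
      then have "\<exists>U V. openin (atlas_topology M) U \<and> openin (atlas_topology M) V \<and>
          foot (\<theta> t 0) \<in> U \<and> foot (\<eta> t 0) \<in> V \<and> disjnt U V"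
        using top ne by (simp add: Hausdorff_space_def)
      then obtain U V where UV: "openin (atlas_topology M) U" "openin (atlas_topology M) V"
        "foot (\<theta> t 0) \<in> U" "foot (\<eta> t 0) \<in> V" "disjnt U V"
        by (elim exE conjE)
      have "\<forall>\<^sub>F s in at t. foot (\<theta> s 0) \<in> U" "\<forall>\<^sub>F s in at t. foot (\<eta> s 0) \<in> V"
        by (rule geodesic_inf_foot_continuous[OF M S \<theta> t UV(1,3)],
            rule geodesic_inf_foot_continuous[OF M S \<eta> t UV(2,4)])
      then show ?thesis
        by eventually_elim (use UV(5) in \<open>auto simp: disjnt_def\<close>)
    qed
    then obtain \<delta> where "\<delta> > 0" "\<And>s. s \<noteq> t \<Longrightarrow> dist s t < \<delta> \<Longrightarrow> \<not> ?P s"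
      unfolding eventually_at by blast
    then show "\<exists>\<delta>>0. \<forall>s. \<bar>s - t\<bar> < \<delta> \<longrightarrow> \<not> ?P s"
      using Pt by (metis dist_real_def)
  qed
  \<comment> \<open>Now \<eta> is in the chart at all times, so each level is settled on the whole
    interval by uniqueness for its own equation.\<close>
  have "\<eta> s 0 \<in> chart_dom (Tpow M 0) \<alpha>" if "s \<in> ?I" for s
    using P[OF that] dom[OF that] by simp
  then have J: "?J = ?I"
    by blast
  show ?thesis
  proof
    fix i
    have "?z i t = ?w i t"
    proof (rule ode_unique[OF A \<epsilon> _ _ _ t])
      show "?z i 0 = ?w i 0"
        using v0 by simp
      show "?z i s \<in> cyl (Suc i) (overlap M \<alpha> \<alpha>) \<and>
          (?z i has_vector_derivative spray_field M S \<alpha> i (?z i s)) (at s)" if "s \<in> ?I" for s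
        using that dom by (intro z(3)) auto
      show "?w i s \<in> cyl (Suc i) (overlap M \<alpha> \<alpha>) \<and>
          (?w i has_vector_derivative spray_field M S \<alpha> i (?w i s)) (at s)" if "s \<in> ?I" for s
        using that J by (intro w(3)) blast
    qed
    moreover have "t \<in> ?J"
      using t J by blast
    moreover have "t \<in> {t \<in> ?I. \<theta> t 0 \<in> chart_dom (Tpow M 0) \<alpha>}"
      using t dom by auto
    ultimately show "\<theta> t i = \<eta> t i"
      using z(2)[of t i] w(2)[of t i] inj_onD[OF good_chartsD(1)[OF g, of i \<alpha>], of "\<theta> t i" "\<eta> t i"] by auto
  qed
qed

text \<open>The second hypothesis on u is the compatibility of the initial vectors under the tangent
  maps of the projections. The interval is fixed at level 0, before the levels are climbed; the last
  conjunct says that the base curves project to one another.\<close>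

lemma lifted_flow:
  fixes M :: "('m, 'i, 'e::banach) atlas"
  assumes M: "banach_manifold M" and S: "semispray M 0 S"
    and u: "\<And>i. u i \<in> cyl (Suc i) (overlap M \<alpha> \<alpha>)" "\<And>i. trunc (Suc i) (flip i (u (Suc i))) = u i"
  shows "\<exists>a>0. \<exists>z. \<forall>i. z i 0 = u i \<and> (\<forall>t\<in>{-a..a}. z i t \<in> cyl (Suc i) (overlap M \<alpha> \<alpha>) \<and>
    (z i has_vector_derivative spray_field M S \<alpha> i (z i t)) (at t within {-a..a}) \<and>
    trunc i (trunc (Suc i) (z (Suc i) t)) = trunc i (z i t))"
proof -
  let ?A = "spray_field M S \<alpha>" and ?C = "\<lambda>i. cyl (Suc i) (overlap M \<alpha> \<alpha>)"
  have A: "tsmooth (Suc i) (Suc i) (?C i) (?A i)" for i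
    by (rule spray_field_tsmooth[OF M S])
  obtain a z0 where a: "a > 0" and z0: "z0 0 = u 0"
    "\<And>t. t \<in> {-a..a} \<Longrightarrow> z0 t \<in> ?C 0 \<and> (z0 has_vector_derivative ?A 0 (z0 t)) (at t within {-a..a})"
    using local_flow[OF A u(1)[of 0]] by blast
  let ?P = "\<lambda>i z. z 0 = u i \<and> (\<forall>t\<in>{-a..a}. z t \<in> ?C i \<and>
    (z has_vector_derivative ?A i (z t)) (at t within {-a..a}))"
  let ?Q = "\<lambda>i z z'. \<forall>t\<in>{-a..a}. trunc i (trunc (Suc i) (z' t)) = trunc i (z t)"
  have "\<exists>z'. ?P (Suc i) z' \<and> ?Q i z z'" if z: "?P i z" for i z
  proof -
    have zC: "z ` {-a..a} \<subseteq> ?C i" and zm: "\<And>t. t \<in> {-a..a} \<Longrightarrow> z t \<in> model (Suc i)"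
      and dz: "\<And>t. t \<in> {-a..a} \<Longrightarrow> (z has_vector_derivative ?A i (z t)) (at t within {-a..a})"
      using z by (auto simp: cyl_def)
    have cont: "continuous_on {-a..a} z"
      unfolding continuous_on_eq_continuous_within using dz has_vector_derivative_continuous by blast
    \<comment> \<open>The linear equation starts at the second half of the flipped initial vector,
      whose first half is u i; so (z, v) starts at that flipped vector and \<open>?z\<close> at u
      (Suc i).\<close>
    obtain v where v: "v 0 = shift (Suc i) (flip i (u (Suc i)))"
      "\<And>t. t \<in> {-a..a} \<Longrightarrow> v t \<in> model (Suc i)"
      "\<And>t. t \<in> {-a..a} \<Longrightarrow> (v has_vector_derivative dd (Suc i) (?A i) (z t) (v t)) (at t within {-a..a})"
      using linear_flow[OF A cont zC a shift_in_model] by blast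
    let ?z = "\<lambda>t. flip i (join (Suc i) (z t) (v t))"
    have um: "u (Suc i) \<in> model (Suc (Suc i))"
      using u(1)[of "Suc i"] by (simp add: cyl_def)
    have "?z 0 = flip i (join (Suc i) (trunc (Suc i) (flip i (u (Suc i)))) (shift (Suc i) (flip i (u (Suc i)))))"
      using z v(1) u(2)[of i] by simp
    also have "\<dots> = u (Suc i)"
      using um by (subst join_trunc_shift) simp
    finally have z0: "?z 0 = u (Suc i)" .
    have zC': "?z t \<in> ?C (Suc i)" if "t \<in> {-a..a}" for t
      using z that v(2)[OF that] by (simp add: cyl_def)
    have ff: "flip i (?z t) = join (Suc i) (z t) (v t)" if "t \<in> {-a..a}" for t
      using v(2)[OF that] by simp
    \<comment> \<open>\<open>flip\<close> fixes the first quarter of its argument, which here comes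
      from z.\<close>
    have tr: "?Q i z ?z"
    proof
      fix t assume t: "t \<in> {-a..a}"
      obtain x y where xy: "x \<in> model i" "y \<in> model i" "z t = join i x y"
        using model_Suc_cases[OF zm[OF t]] .
      obtain X Y where XY: "X \<in> model i" "Y \<in> model i" "v t = join i X Y"
        using model_Suc_cases[OF v(2)[OF t]] .
      show "trunc i (trunc (Suc i) (?z t)) = trunc i (z t)"
        unfolding xy(3) XY(3) using xy(1,2) XY(1,2) by simp
    qed
    have dz': "(?z has_vector_derivative ?A (Suc i) (?z t)) (at t within {-a..a})" if t: "t \<in> {-a..a}" for t
    proof -
      have "((\<lambda>s. join (Suc i) (z s) (v s)) has_vector_derivative
          join (Suc i) (?A i (z t)) (dd (Suc i) (?A i) (z t) (v t))) (at t within {-a..a})"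
        using bounded_linear.has_vector_derivative[OF bounded_linear_join
            has_vector_derivative_Pair[OF dz[OF t] v(3)[OF t]]] by simp
      then have "(?z has_vector_derivative
          flip i (join (Suc i) (?A i (z t)) (dd (Suc i) (?A i) (z t) (v t)))) (at t within {-a..a})"
        by (rule bounded_linear.has_vector_derivative[OF bounded_linear_flip])
      moreover have "join (Suc i) (?A i (z t)) (dd (Suc i) (?A i) (z t) (v t)) =
          tan_map (Suc i) (Suc i) (?A i) (flip i (?z t))"
        unfolding ff[OF t] using zm[OF t] v(2)[OF t] by (simp add: tan_map_def)
      ultimately show ?thesis
        using spray_field_Suc[OF M S zC'[OF t]] by simp
    qed
    show ?thesis
      using z0 zC' dz' tr by (intro exI[of _ ?z]) blast
  qed
  moreover have "\<exists>z. ?P 0 z"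
    using z0 by blast
  \<comment> \<open>Dependent choice: each curve is built from the one chosen on the level
    below.\<close>
  ultimately obtain z where "\<And>i. ?P i (z i)" "\<And>i. ?Q i (z i) (z (Suc i))"
    using dependent_nat_choice[of ?P ?Q] by blast
  then show ?thesis
    using a by (intro exI[of _ a] conjI exI[of _ z]) blast+
qed

text \<open>In the chart the projection is \<open>trunc i\<close>, and its tangent map sends (x, y,
  X, Y) to (x, X), the first half of the flipped vector.\<close>

lemma tmap_proj_chart:
  fixes M :: "('m, 'i, 'e::banach) atlas"
  assumes M: "banach_manifold M" and q: "q \<in> chart_dom (Tpow M (Suc (Suc i))) \<alpha>"
  shows "chart (Tpow M (Suc i)) \<alpha> (tmap M (Suc i) i proj q) =
    trunc (Suc i) (flip i (chart (Tpow M (Suc (Suc i))) \<alpha> q))"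
proof -
  note g = good_charts[OF M]
  have F: "tsmooth (Suc i) i (cyl (Suc i) (overlap M \<alpha> \<alpha>)) (trunc i)"
    by (rule tsmooth_linear[OF bounded_linear_trunc _ mopen_cyl[OF banach_manifold_overlap(1)[OF M]]]) simp
  have "proj p \<in> chart_dom (Tpow M i) \<alpha> \<and> chart (Tpow M i) \<alpha> (proj p) = trunc i (chart (Tpow M (Suc i)) \<alpha> p)"
    if p: "p \<in> chart_dom (Tpow M (Suc i)) \<alpha>" for p
  proof
    show 1: "proj p \<in> chart_dom (Tpow M i) \<alpha>"
      using p by (simp add: chart_dom_Suc)
    then have "chart (Tpow M i) \<alpha> (proj p) \<in> model i"
      using good_chartsD(2)[OF g 1] by (simp add: cyl_def)
    then show "chart (Tpow M i) \<alpha> (proj p) = trunc i (chart (Tpow M (Suc i)) \<alpha> p)"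
      by (simp add: chart_Suc)
  qed
  from tmap_eq(3)[OF M F this q]
  have "chart (Tpow M (Suc i)) \<alpha> (tmap M (Suc i) i proj q) =
      tan_map (Suc i) i (trunc i) (chart (Tpow M (Suc (Suc i))) \<alpha> q)" .
  moreover obtain x y X Y where m: "x \<in> model i" "y \<in> model i" "X \<in> model i" "Y \<in> model i"
    "chart (Tpow M (Suc (Suc i))) \<alpha> q = join (Suc i) (join i x y) (join i X Y)"
    using good_chartsD(2)[OF g q] model_Suc_Suc_cases unfolding cyl_def by blast
  ultimately show ?thesis
    by (simp add: tan_map_linear(3)[OF bounded_linear_trunc])
qed

theorem theorem3p11:
  fixes M :: "('m, 'i, 'e::banach) atlas"
    and S :: "('m, 'i, 'e) tp \<Rightarrow> ('m, 'i, 'e) tp"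
    and x \<xi> :: "nat \<Rightarrow> ('m, 'i, 'e) tp"
  assumes "banach_manifold M" and "partitionable M"
    and "semispray M 0 S"
    and "x \<in> Tinf M" and "\<xi> \<in> tangent_space_inf M x"
  shows "\<exists>\<epsilon>>0. \<exists>\<gamma>.
    (geodesic_inf M (lift_inf M S) \<epsilon> \<gamma> \<and> \<gamma> 0 = x \<and> velocity_inf M 0 \<gamma> 0 = \<xi>) \<and>
    (\<forall>\<eta>. geodesic_inf M (lift_inf M S) \<epsilon> \<eta> \<and> \<eta> 0 = x \<and> velocity_inf M 0 \<eta> 0 = \<xi> \<longrightarrow>
      (\<forall>t\<in>{-\<epsilon><..<\<epsilon>}. \<eta> t = \<gamma> t)) \<and>
    (\<exists>g :: nat \<Rightarrow> real \<Rightarrow> ('m, 'i, 'e) tp.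
      (\<forall>i. geodesic M i (iter_lift M S i) \<epsilon> (g i) \<and> g i 0 = x i \<and> velocity M i (g i) 0 = \<xi> i) \<and>
      (\<forall>t\<in>{-\<epsilon><..<\<epsilon>}. \<gamma> t = (\<lambda>i. g i t)))"
proof -
  note M = assms(1) and S = assms(3) and x = assms(4) and \<xi> = assms(5)
  note g = good_charts[OF M]
  have x\<xi>: "proj (\<xi> i) = x i" "\<xi> i \<in> points (Tpow M (Suc i))" "tmap M (Suc i) i proj (\<xi> (Suc i)) = \<xi> i" for i
    using \<xi> by (auto simp: tangent_space_inf_def TTinf_def)
  have "x 0 \<in> points (Tpow M 0)"
    using x unfolding Tinf_def by blast
  then obtain \<alpha> where "x 0 \<in> chart_dom (Tpow M 0) \<alpha>"
    unfolding points_iff by blast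
  then have xd: "x i \<in> chart_dom (Tpow M i) \<alpha>" for i
    by (rule Tinf_chart_dom[OF x])
  have \<xi>d: "\<xi> i \<in> chart_dom (Tpow M (Suc i)) \<alpha>" for i
    using x\<xi>(1,2)[of i] xd[of i] unfolding points_iff chart_dom_Suc by auto
  let ?A = "spray_field M S \<alpha>"
  define u where "u i = chart (Tpow M (Suc i)) \<alpha> (\<xi> i)" for i
  have u: "u i \<in> cyl (Suc i) (overlap M \<alpha> \<alpha>)" for i
    unfolding u_def by (rule good_chartsD(2)[OF g \<xi>d])
  \<comment> \<open>The condition defining \<open>TTinf\<close>, read in the chart.\<close>
  have "trunc (Suc i) (flip i (u (Suc i))) = u i" for i
    using tmap_proj_chart[OF M \<xi>d, of i] by (simp add: u_def x\<xi>(3))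
  from lifted_flow[OF M S u this] obtain \<epsilon> z where \<epsilon>: "\<epsilon> > 0" and z0: "\<And>i. z i 0 = u i"
    and z: "\<And>i t. t \<in> {-\<epsilon>..\<epsilon>} \<Longrightarrow> z i t \<in> cyl (Suc i) (overlap M \<alpha> \<alpha>) \<and>
      (z i has_vector_derivative ?A i (z i t)) (at t within {-\<epsilon>..\<epsilon>}) \<and>
      trunc i (trunc (Suc i) (z (Suc i) t)) = trunc i (z i t)"
    by blast
  let ?I = "{-\<epsilon><..<\<epsilon>}"
  have zC: "z i t \<in> cyl (Suc i) (overlap M \<alpha> \<alpha>)" and zm: "z i t \<in> model (Suc i)"
    and dz: "(z i has_vector_derivative ?A i (z i t)) (at t)" if "t \<in> ?I" for i t
  proof -
    have "at t within {-\<epsilon>..\<epsilon>} = at t"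
      using that by (intro at_within_interior) simp
    then show "z i t \<in> cyl (Suc i) (overlap M \<alpha> \<alpha>)" "z i t \<in> model (Suc i)"
      "(z i has_vector_derivative ?A i (z i t)) (at t)"
      using z[of t i] that by (auto simp: cyl_def)
  qed
  \<comment> \<open>z i plays the role of the velocity curve in coordinates; its first half is the
    base curve.\<close>
  define c where "c i t = trunc i (z i t)" for i t
  define \<gamma> where "\<gamma> t i = chart_inv (Tpow M i) \<alpha> (c i t)" for t i
  have c: "\<gamma> t i \<in> chart_dom (Tpow M i) \<alpha> \<and> chart (Tpow M i) \<alpha> (\<gamma> t i) = c i t" if "t \<in> ?I" for t i
  proof -
    have "c i t \<in> cyl i (overlap M \<alpha> \<alpha>)"
      using zC[OF that, of i] by (simp add: c_def cyl_def)
    then show ?thesis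
      unfolding \<gamma>_def using good_chartsD(3,4)[OF g] by blast
  qed
  \<comment> \<open>By the semispray property the first half of the field at z is the second half of
    z.\<close>
  have c1: "(c i has_vector_derivative shift i (z i t)) (at t)" if "t \<in> ?I" for t i
    using bounded_linear.has_vector_derivative[OF bounded_linear_trunc dz[OF that, of i], of i]
      trunc_spray_field[OF M S zC[OF that]] by (simp add: c_def[abs_def])
  have c2: "((\<lambda>t. shift i (z i t)) has_vector_derivative shift i (?A i (z i t))) (at t)" if "t \<in> ?I" for t i
    by (rule bounded_linear.has_vector_derivative[OF bounded_linear_shift dz[OF that]])
  have zj: "join i (c i t) (shift i (z i t)) = z i t" if "t \<in> ?I" for t i
    using zm[OF that, of i] by (simp add: c_def)
  have c_smooth: "csmooth i ?I (c i)" for i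
  proof -
    have "csmooth (Suc i) ?I (z i)"
      using zC dz by (intro csmooth_ode[OF spray_field_tsmooth[OF M S]]) auto
    moreover have "tsmooth (Suc i) i (model (Suc i)) (trunc i)"
      by (rule tsmooth_linear[OF bounded_linear_trunc _ mopen_model]) simp
    ultimately show ?thesis
      using zm by (elim csmooth_comp[rotated]) (auto simp: c_def)
  qed
  have zero: "0 \<in> ?I"
    using \<epsilon> by simp
  have \<gamma>0: "\<gamma> 0 i = x i" for i
  proof (rule inj_onD[OF good_chartsD(1)[OF g, of i \<alpha>]])
    show "\<gamma> 0 i \<in> chart_dom (Tpow M i) \<alpha>"
      using c[OF zero, of i] by blast
    have "chart (Tpow M i) \<alpha> (x i) \<in> model i"
      using good_chartsD(2)[OF g xd[of i]] by (simp add: cyl_def)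
    then have "c i 0 = chart (Tpow M i) \<alpha> (x i)"
      by (simp add: c_def z0 u_def chart_Suc x\<xi>(1))
    then show "chart (Tpow M i) \<alpha> (\<gamma> 0 i) = chart (Tpow M i) \<alpha> (x i)"
      using c[OF zero, of i] by simp
  qed (rule xd)
  have v0: "velocity M i (\<lambda>s. \<gamma> s i) 0 = \<xi> i" for i
  proof (rule inj_onD[OF good_chartsD(1)[OF g, of "Suc i" \<alpha>]])
    note v = velocity_eq(1,3)[OF M open_greaterThanLessThan zero c c1[OF zero], of i]
    show "velocity M i (\<lambda>s. \<gamma> s i) 0 \<in> chart_dom (Tpow M (Suc i)) \<alpha>"
      by (rule v(1))
    show "chart (Tpow M (Suc i)) \<alpha> (velocity M i (\<lambda>s. \<gamma> s i) 0) = chart (Tpow M (Suc i)) \<alpha> (\<xi> i)"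
      using v(2) zj[OF zero, of i] by (simp add: z0 u_def)
  qed (rule \<xi>d)
  have geo: "velocity M (Suc i) (velocity M i (\<lambda>s. \<gamma> s i)) t = iter_lift M S i (velocity M i (\<lambda>s. \<gamma> s i) t)"
    if t: "t \<in> ?I" for i t
  proof -
    \<comment> \<open>The two halves of the field at z are the first and second derivatives of the
      base curve: the geodesic equation in the chart.\<close>
    have "join i (shift i (z i t)) (shift i (?A i (z i t))) = ?A i (z i t)"
    proof -
      have "?A i (z i t) \<in> model (Suc i)"
        by (simp add: spray_field_def)
      moreover have "shift i (z i t) = trunc i (?A i (z i t))"
        by (rule trunc_spray_field[OF M S zC[OF t], symmetric])
      ultimately show ?thesis
        by simp
    qed
    then show ?thesis
      using geodesic_equation_chart[OF M S open_greaterThanLessThan t c c1 c2[OF t]] zj[OF t] by simp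
  qed
  have cp: "trunc i (c (Suc i) t) = c i t" if "t \<in> ?I" for t i
    using z[of t i] that by (simp add: c_def)
  have "smooth_curve_inf M \<epsilon> \<gamma>"
    by (rule smooth_curve_infI[OF M c_smooth c cp])
  then have gi: "geodesic_inf M (lift_inf M S) \<epsilon> \<gamma>"
    using geo by (auto simp: geodesic_inf_def velocity_inf_def lift_inf_def)
  have \<gamma>x: "\<gamma> 0 = x" and \<gamma>\<xi>: "velocity_inf M 0 \<gamma> 0 = \<xi>"
    using \<gamma>0 v0 by (auto simp: velocity_inf_def)
  have "smooth_map UNIV (real_atlas ?I) (Tpow M i) (\<lambda>t. \<gamma> t i)" for i
    by (rule smooth_map_curveI[OF M c_smooth c])
  then have "geodesic M i (iter_lift M S i) \<epsilon> (\<lambda>t. \<gamma> t i)" for i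
    using geo by (auto simp: geodesic_def)
  then have "\<exists>g. (\<forall>i. geodesic M i (iter_lift M S i) \<epsilon> (g i) \<and> g i 0 = x i \<and> velocity M i (g i) 0 = \<xi> i) \<and>
      (\<forall>t\<in>?I. \<gamma> t = (\<lambda>i. g i t))"
    using \<gamma>0 v0 by (intro exI[of _ "\<lambda>i t. \<gamma> t i"]) auto
  moreover have "\<eta> t = \<gamma> t"
    if "geodesic_inf M (lift_inf M S) \<epsilon> \<eta>" "\<eta> 0 = x" "velocity_inf M 0 \<eta> 0 = \<xi>" "t \<in> ?I" for \<eta> t
    using geodesic_inf_unique[OF M S \<epsilon> gi that(1) _ _ _ that(4), of \<alpha>] c \<gamma>x \<gamma>\<xi> that(2,3) by auto
  ultimately show ?thesis
    using \<epsilon> gi \<gamma>x \<gamma>\<xi> by (intro exI[of _ \<epsilon>] conjI exI[of _ \<gamma>]) blast+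
qed

end
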